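(* Let $r\ge 3$ be a fixed integer and let $F$ be a fixed graph with $r$ vertices. Let $L=\{\ell_1,\dots,\ell_s\}\subseteq\{0,1,\dots,r-1\}$ be a fixed subset of size $s\notin\{1,r\}$ with $\ell_1<\ell_2<\dots<\ell_s$. If $\ell_1,\ell_2,\dots,\ell_s,r$ do not form an arithmetic progression, then $\Psi_r(n,\mathrm{span}(F),L)=o(n^s)$ as $n\to\infty$. Moreover (still assuming that $\ell_1,\dots,\ell_s,r$ do not form an arithmetic progression), if either $r-\ell_s=\ell_s-\ell_{s-1}$, or $r-\ell_s\ne\ell_s-\ell_{s-1}$ and $(\ell_s-\ell_{s-1})\nmid(r-\ell_s)$, then $\Psi_r(n,\mathrm{span}(F),L)=O(n^{s-1})$.
   Context: All graphs are finite and simple. $N(G,F)$ denotes the number of copies of $F$ in $G$, i.e. the number of (not necessarily induced) subgraphs of $G$ isomorphic to $F$. For a graph $F$ on $r$ vertices let $$\mathscr{H}^r_{G,\mathrm{span}(F)}=\{S\subseteq V(G): |S|=r,\ G[S]\text{ contains a copy of }F\}.$$ For $L\subseteq\{0,\dots,r-1\}$, $G$ is $(\mathrm{span}(F),L)$-intersecting if $|S\cap S'|\in L$ for any two distinct $S,S'\in\mathscr{H}^r_{G,\mathrm{span}(F)}$. Define $$\Psi_r(n,\mathrm{span}(F),L)=\max\{N(G,F): G\text{ is an }n\text{-vertex }(\mathrm{span}(F),L)\text{-intersecting graph}\},$$ with the convention that the maximum over an empty set is $0$. Asymptotic notation is for $n\to\infty$ with $r,F,L$ fixed. *)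

theory Defs
  imports Complex_Main "HOL-Library.Landau_Symbols"
begin

type_synonym 'a ugraph = "'a set \<times> 'a set set"

abbreviation verts :: "'a ugraph \<Rightarrow> 'a set" where "verts G \<equiv> fst G"
abbreviation edges :: "'a ugraph \<Rightarrow> 'a set set" where "edges G \<equiv> snd G"

definition simple_graph :: "'a ugraph \<Rightarrow> bool" where
  "simple_graph G \<longleftrightarrow> finite (verts G) \<and> (\<forall>e\<in>edges G. e \<subseteq> verts G \<and> card e = 2)"

definition subgraph :: "'a ugraph \<Rightarrow> 'a ugraph \<Rightarrow> bool" where
  "subgraph H G \<longleftrightarrow> simple_graph H \<and> verts H \<subseteq> verts G \<and> edges H \<subseteq> edges G"

definition induced :: "'a ugraph \<Rightarrow> 'a set \<Rightarrow> 'a ugraph" where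
  "induced G S = (S, {e \<in> edges G. e \<subseteq> S})"

definition graph_iso :: "'a ugraph \<Rightarrow> 'b ugraph \<Rightarrow> bool" where
  "graph_iso G H \<longleftrightarrow> (\<exists>f. bij_betw f (verts G) (verts H) \<and> edges H = (\<lambda>e. f ` e) ` edges G)"

definition copies :: "'a ugraph \<Rightarrow> 'b ugraph \<Rightarrow> 'a ugraph set" where
  "copies G F = {H. subgraph H G \<and> graph_iso H F}"

definition num_copies :: "'a ugraph \<Rightarrow> 'b ugraph \<Rightarrow> nat" where
  "num_copies G F = card (copies G F)"

definition span_family :: "nat \<Rightarrow> 'a ugraph \<Rightarrow> 'b ugraph \<Rightarrow> 'a set set" where
  "span_family r G F = {S. S \<subseteq> verts G \<and> card S = r \<and> copies (induced G S) F \<noteq> {}}"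

definition span_intersecting :: "nat \<Rightarrow> 'a ugraph \<Rightarrow> 'b ugraph \<Rightarrow> nat set \<Rightarrow> bool" where
  "span_intersecting r G F L \<longleftrightarrow>
     (\<forall>S\<in>span_family r G F. \<forall>S'\<in>span_family r G F. S \<noteq> S' \<longrightarrow> card (S \<inter> S') \<in> L)"

text \<open>
  Every finite graph is isomorphic to one with vertices in \<^typ>\<open>nat\<close>, so the host graphs
  range over graphs of that type.
\<close>
definition span_counts :: "nat \<Rightarrow> nat \<Rightarrow> 'b ugraph \<Rightarrow> nat set \<Rightarrow> nat set" where
  "span_counts r n F L =
     {num_copies G F | G :: nat ugraph.
        simple_graph G \<and> card (verts G) = n \<and> span_intersecting r G F L}"

definition Psi :: "nat \<Rightarrow> nat \<Rightarrow> 'b ugraph \<Rightarrow> nat set \<Rightarrow> nat" where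
  "Psi r n F L = (if span_counts r n F L = {} then 0 else Max (span_counts r n F L))"

text \<open>
  The maximum in the definition of \<^const>\<open>Psi\<close> is over a finite set of numbers, although
  infinitely many graphs \<open>G\<close> contribute to it.
\<close>
lemma finite_span_counts: "finite (span_counts r n F L)"
proof (rule finite_subset)
  show "span_counts r n F L \<subseteq> {..2 ^ n * 2 ^ (2 ^ n)}"
  proof
    fix m assume "m \<in> span_counts r n F L"
    then obtain G :: "nat ugraph" where m: "m = num_copies G F"
      and G: "simple_graph G" "card (verts G) = n"
      unfolding span_counts_def by blast
    have fin: "finite (verts G)" using G(1) by (simp add: simple_graph_def)
    have sub: "copies G F \<subseteq> Pow (verts G) \<times> Pow (Pow (verts G))"
      unfolding copies_def subgraph_def simple_graph_def by fastforce
    have "m \<le> card (Pow (verts G) \<times> Pow (Pow (verts G)))"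
      unfolding m num_copies_def by (rule card_mono[OF _ sub]) (simp add: fin)
    also have "\<dots> = 2 ^ n * 2 ^ (2 ^ n)"
      using fin G(2) by (simp add: card_cartesian_product card_Pow)
    finally show "m \<in> {..2 ^ n * 2 ^ (2 ^ n)}" by simp
  qed
qed simp

text \<open>
  The terms \<open>a 1, \<dots>, a k\<close> form an arithmetic progression. This holds trivially for
  \<open>k \<le> 2\<close>; in particular, a single term is an arithmetic progression. Differences are
  taken in \<^typ>\<open>int\<close> to avoid truncated subtraction.
\<close>
definition arith_prog :: "(nat \<Rightarrow> nat) \<Rightarrow> nat \<Rightarrow> bool" where
  "arith_prog a k \<longleftrightarrow> (\<exists>d::int. \<forall>i\<in>{1..<k}. int (a (Suc i)) - int (a i) = d)"

end

theory Submission
  imports Defs "HOL-Library.FuncSet" "HOL-Analysis.Convex"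
begin

text \<open>
  The family of \<open>r\<close>-sets spanning a copy of \<open>F\<close> is an \<open>L\<close>-intersecting set system, and the number of
  copies is at most a constant times its size. Call a set a kernel if it is the kernel of a
  sunflower with \<open>r + 1\<close> petals in the system; two kernels then meet in a number of points that
  belongs to \<open>L\<close>. Fixing an \<open>\<ell>\<^sub>1\<close>-subset of one member and one further point removes \<open>\<ell>\<^sub>1\<close> from \<open>L\<close>
  at the cost of a factor \<open>n\<close>; passing to the kernels of size \<open>\<ell>\<^sub>s\<close> removes \<open>r\<close> from
  \<open>\<ell>\<^sub>1, \<dots>, \<ell>\<^sub>s, r\<close> at the same cost. So a bound that saves a factor \<open>n\<close> for a run of consecutive
  terms of \<open>\<ell>\<^sub>1, \<dots>, \<ell>\<^sub>s, r\<close> saves it for the whole sequence. Such a run consists of three terms whose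
  first difference does not divide the second (kernels through single points would
  partition a member into blocks), or of four terms with differences \<open>d' < d = d\<close>; one of them
  exists in the cases where \<open>O(n\<^bsup>s-1\<^esup>)\<close> is claimed.

  In the remaining case \<open>r - \<ell>\<^sub>s = (m - 1) d\<close> with \<open>d = \<ell>\<^sub>s - \<ell>\<^sub>s\<^sub>-\<^sub>1\<close> and \<open>m \<ge> 3\<close>. After reduction to
  \<open>{\<ell>\<^sub>s\<^sub>-\<^sub>1, \<ell>\<^sub>s}\<close> almost every member consists of a fixed core and \<open>m\<close> out of at most \<open>n\<close> disjoint
  blocks of size \<open>d\<close>, and two blocks determine the member. If there were \<open>\<epsilon> n\<^sup>2\<close> members, the
  regularity lemma would yield, as in the theorem of Ruzsa and Szemeredi, \<open>m\<close> blocks that pairwise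
  but not jointly lie in a member with matching positions. Every edge of \<open>F\<close> involves at most two
  blocks, so their union with the core spans a copy of \<open>F\<close> that meets a member in more than \<open>\<ell>\<^sub>s\<close>
  points.
\<close>

section \<open>Szemeredi's regularity lemma\<close>

text \<open>Partitions are encoded by generating families: the parts are the atoms cut out by the
  sets of \<open>\<A>\<close>. Enlarging \<open>\<A>\<close> refines the partition, and
  \<open>card \<A>\<close> alone controls the number of parts.\<close>

definition cell :: "'v set \<Rightarrow> 'v set set \<Rightarrow> 'v \<Rightarrow> 'v set" where
  "cell V \<A> x = {y \<in> V. \<forall>A\<in>\<A>. y \<in> A \<longleftrightarrow> x \<in> A}"

definition density :: "('v \<times> 'v) set \<Rightarrow> 'v set \<Rightarrow> 'v set \<Rightarrow> real" where
  "density E X Y = card (E \<inter> X \<times> Y) / (card X * card Y)"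

definition regular_pair :: "real \<Rightarrow> ('v \<times> 'v) set \<Rightarrow> 'v set \<Rightarrow> 'v set \<Rightarrow> bool" where
  "regular_pair \<epsilon> E A B \<longleftrightarrow> (\<forall>X\<subseteq>A. \<forall>Y\<subseteq>B. \<epsilon> * card A \<le> card X \<longrightarrow> \<epsilon> * card B \<le> card Y \<longrightarrow>
     \<bar>density E X Y - density E A B\<bar> < \<epsilon>)"

definition cell_density :: "'v set \<Rightarrow> ('v \<times> 'v) set \<Rightarrow> 'v set set \<Rightarrow> 'v \<times> 'v \<Rightarrow> real" where
  "cell_density V E \<A> p = density E (cell V \<A> (fst p)) (cell V \<A> (snd p))"

text \<open>This is \<open>(card V)\<^sup>2\<close> times the mean square density (index) of the
  partition. Summing over pairs of vertices weights each pair of cells by the product of its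
  sizes.\<close>

definition energy :: "'v set \<Rightarrow> ('v \<times> 'v) set \<Rightarrow> 'v set set \<Rightarrow> real" where
  "energy V E \<A> = (\<Sum>p\<in>V \<times> V. (cell_density V E \<A> p)\<^sup>2)"

lemma cell_self: "x \<in> V \<Longrightarrow> x \<in> cell V \<A> x"
  by (simp add: cell_def)

lemma cell_subset: "cell V \<A> x \<subseteq> V"
  by (auto simp: cell_def)

lemma finite_cell: "finite V \<Longrightarrow> finite (cell V \<A> x)"
  by (simp add: cell_def)

lemma cell_eq: "y \<in> cell V \<A> x \<Longrightarrow> cell V \<A> y = cell V \<A> x"
  by (auto simp: cell_def)

lemma cell_sym: "x \<in> V \<Longrightarrow> y \<in> cell V \<A> x \<Longrightarrow> x \<in> cell V \<A> y"
  by (auto simp: cell_def)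

lemma cell_antimono: "\<A> \<subseteq> \<A>' \<Longrightarrow> cell V \<A>' x \<subseteq> cell V \<A> x"
  by (auto simp: cell_def)

lemma cell_subset_generator: "A \<in> \<A> \<Longrightarrow> x \<in> A \<Longrightarrow> cell V \<A> x \<subseteq> A"
  by (auto simp: cell_def)

lemma card_cell_pos: "finite V \<Longrightarrow> x \<in> V \<Longrightarrow> card (cell V \<A> x) > 0"
  using cell_self[of x V] finite_cell[of V] by (fastforce simp: card_gt_0_iff)

lemma card_cells_le:
  assumes "finite \<A>"
  shows "finite (cell V \<A> ` V)" "card (cell V \<A> ` V) \<le> 2 ^ card \<A>"
proof -
  have *: "cell V \<A> ` V \<subseteq> (\<lambda>P. {y \<in> V. \<forall>A\<in>\<A>. y \<in> A \<longleftrightarrow> A \<in> P}) ` Pow \<A>"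
  proof
    fix C assume "C \<in> cell V \<A> ` V"
    then obtain x where "C = cell V \<A> x" by blast
    then have "C = (\<lambda>P. {y \<in> V. \<forall>A\<in>\<A>. y \<in> A \<longleftrightarrow> A \<in> P}) {A \<in> \<A>. x \<in> A}"
      by (auto simp: cell_def)
    then show "C \<in> (\<lambda>P. {y \<in> V. \<forall>A\<in>\<A>. y \<in> A \<longleftrightarrow> A \<in> P}) ` Pow \<A>" by blast
  qed
  show "finite (cell V \<A> ` V)" by (rule finite_subset[OF *]) (use assms in simp)
  have "card (cell V \<A> ` V) \<le> card (Pow \<A>)"
    by (rule surj_card_le[OF _ *]) (use assms in simp)
  then show "card (cell V \<A> ` V) \<le> 2 ^ card \<A>" using assms by (simp add: card_Pow)
qed

lemma density_nonneg: "density E X Y \<ge> 0"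
  by (simp add: density_def)

lemma density_le_1:
  assumes "finite X" "finite Y"
  shows "density E X Y \<le> 1"
proof -
  have "card (E \<inter> X \<times> Y) \<le> card (X \<times> Y)" using assms by (intro card_mono) auto
  then have "card (E \<inter> X \<times> Y) \<le> card X * card Y" by (simp add: card_cartesian_product)
  then have "real (card (E \<inter> X \<times> Y)) \<le> real (card X * card Y)" by linarith
  then show ?thesis
    by (cases "card X * card Y = 0") (auto simp: density_def divide_le_eq_1 simp flip: of_nat_mult)
qed

lemma energy_le:
  assumes "finite V"
  shows "energy V E \<A> \<le> (real (card V))\<^sup>2"
proof -
  have "energy V E \<A> \<le> (\<Sum>p\<in>V \<times> V. 1)"
    unfolding energy_def
    by (intro sum_mono power_le_one)
       (simp_all add: cell_density_def density_nonneg density_le_1 finite_cell assms)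
  then show ?thesis by (simp add: card_cartesian_product power2_eq_square)
qed

text \<open>Averaging over cells is invisible to functions that are constant on products of cells.\<close>
lemma sum_cell_density:
  fixes h :: "'v \<times> 'v \<Rightarrow> real"
  assumes V: "finite V" and E: "E \<subseteq> V \<times> V"
    and h: "\<And>x y x' y'. \<lbrakk>x \<in> V; y \<in> V; x' \<in> cell V \<A> x; y' \<in> cell V \<A> y\<rbrakk> \<Longrightarrow> h (x', y') = h (x, y)"
  shows "(\<Sum>p\<in>V \<times> V. cell_density V E \<A> p * h p) = (\<Sum>e\<in>E. h e)"
proof -
  let ?c = "cell V \<A>"
  let ?w = "\<lambda>p. real (card (?c (fst p)) * card (?c (snd p)))"
  have finE: "finite E" using V E finite_subset by blast
  \<comment> \<open>Fact \<open>1\<close> spreads each density over the edges that it counts. After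
    exchanging the sums, fact \<open>2\<close> shows that an edge \<open>e\<close> receives
    \<open>h e / ?w e\<close> from each of the \<open>?w e\<close> pairs in its own product of
    cells.\<close>
  have 1: "cell_density V E \<A> p * h p
      = (\<Sum>e\<in>E. if e \<in> ?c (fst p) \<times> ?c (snd p) then h p / ?w p else 0)" for p
  proof -
    have "(\<Sum>e\<in>E. if e \<in> ?c (fst p) \<times> ?c (snd p) then h p / ?w p else 0)
       = (\<Sum>e\<in>E \<inter> ?c (fst p) \<times> ?c (snd p). h p / ?w p)"
      by (rule sum.inter_restrict[OF finE, symmetric])
    then show ?thesis by (simp add: cell_density_def density_def)
  qed
  have 2: "(\<Sum>p\<in>V \<times> V. if e \<in> ?c (fst p) \<times> ?c (snd p) then h p / ?w p else 0) = h e"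
    if e: "e \<in> E" for e
  proof -
    obtain u v where uv: "e = (u, v)" "u \<in> V" "v \<in> V" using e E by auto
    have "(\<Sum>p\<in>V \<times> V. if e \<in> ?c (fst p) \<times> ?c (snd p) then h p / ?w p else 0)
        = (\<Sum>p\<in>V \<times> V. if p \<in> ?c u \<times> ?c v then h e / ?w e else 0)"
    proof (rule sum.cong[OF refl])
      fix p assume p: "p \<in> V \<times> V"
      have iff: "e \<in> ?c (fst p) \<times> ?c (snd p) \<longleftrightarrow> p \<in> ?c u \<times> ?c v"
        using p uv by (auto intro: cell_sym)
      moreover have "h p / ?w p = h e / ?w e" if "p \<in> ?c u \<times> ?c v"
      proof -
        have "h p = h e" using that h[of u v "fst p" "snd p"] uv by auto
        moreover have "?c (fst p) = ?c u" "?c (snd p) = ?c v" using that by (auto dest: cell_eq)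
        ultimately show ?thesis using uv by simp
      qed
      ultimately show "(if e \<in> ?c (fst p) \<times> ?c (snd p) then h p / ?w p else 0)
          = (if p \<in> ?c u \<times> ?c v then h e / ?w e else 0)" by presburger
    qed
    also have "\<dots> = (\<Sum>p\<in>(V \<times> V) \<inter> (?c u \<times> ?c v). h e / ?w e)"
      by (rule sum.inter_restrict[symmetric]) (use V in simp)
    also have "(V \<times> V) \<inter> (?c u \<times> ?c v) = ?c u \<times> ?c v" using cell_subset[of V] by blast
    finally show ?thesis
      using card_cell_pos[OF V, of u] card_cell_pos[OF V, of v] uv
      by (simp add: card_cartesian_product)
  qed
  show ?thesis unfolding 1 by (subst sum.swap) (simp add: 2 cong: sum.cong)
qed

text \<open>Pythagoras: the coarse density is the orthogonal projection of the fine one onto the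
  functions constant on products of coarse cells, so the mixed term equals the coarse
  energy.\<close>

lemma energy_diff:
  assumes V: "finite V" and E: "E \<subseteq> V \<times> V" and sub: "\<A> \<subseteq> \<A>'"
  shows "energy V E \<A>' - energy V E \<A>
    = (\<Sum>p\<in>V \<times> V. (cell_density V E \<A>' p - cell_density V E \<A> p)\<^sup>2)"
proof -
  let ?q = "cell_density V E \<A>" and ?q' = "cell_density V E \<A>'"
  have q: "?q (x', y') = ?q (x, y)" if "x' \<in> cell V \<A> x" "y' \<in> cell V \<A> y" for x y x' y'
    using that by (simp add: cell_density_def cell_eq)
  have "(\<Sum>p\<in>V \<times> V. ?q' p * ?q p) = (\<Sum>e\<in>E. ?q e)"
    by (rule sum_cell_density[OF V E]) (use q cell_antimono[OF sub] in blast)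
  moreover have "(\<Sum>p\<in>V \<times> V. ?q p * ?q p) = (\<Sum>e\<in>E. ?q e)"
    by (rule sum_cell_density[OF V E]) (use q in blast)
  moreover have "(\<Sum>p\<in>V \<times> V. (?q' p - ?q p)\<^sup>2) = energy V E \<A>' - energy V E \<A>
      - 2 * ((\<Sum>p\<in>V \<times> V. ?q' p * ?q p) - (\<Sum>p\<in>V \<times> V. ?q p * ?q p))"
    unfolding energy_def sum_subtractf[symmetric] sum_distrib_left
    by (rule sum.cong) (auto simp: power2_eq_square algebra_simps)
  ultimately show ?thesis by simp
qed

text \<open>The fine density deviates from the coarse one by at least \<open>\<epsilon>\<close> on
  average over \<open>X \<times> Y\<close>, which fills at least an
  \<open>\<epsilon>\<^sup>2\<close> share of the product of the two cells. Cauchy-Schwarz turns the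
  mean deviation into a mean square deviation.\<close>

lemma irregular_energy:
  fixes \<epsilon> :: real
  assumes V: "finite V" and E: "E \<subseteq> V \<times> V" and sub: "\<A> \<subseteq> \<A>'" and \<epsilon>: "\<epsilon> > 0"
    and x: "x \<in> V" and y: "y \<in> V"
    and X: "X \<subseteq> cell V \<A> x" "X \<in> \<A>'" "\<epsilon> * card (cell V \<A> x) \<le> card X"
    and Y: "Y \<subseteq> cell V \<A> y" "Y \<in> \<A>'" "\<epsilon> * card (cell V \<A> y) \<le> card Y"
    and irr: "\<epsilon> \<le> \<bar>density E X Y - density E (cell V \<A> x) (cell V \<A> y)\<bar>"
  shows "\<epsilon> ^ 4 * (card (cell V \<A> x) * card (cell V \<A> y))
    \<le> (\<Sum>p\<in>cell V \<A> x \<times> cell V \<A> y. (cell_density V E \<A>' p - cell_density V E \<A> p)\<^sup>2)"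
proof -
  let ?q = "cell_density V E \<A>" and ?q' = "cell_density V E \<A>'"
  let ?C = "cell V \<A> x" and ?D = "cell V \<A> y"
  let ?N = "real (card X * card Y)"
  have fin: "finite ?C" "finite ?D" by (simp_all add: finite_cell V)
  have finXY: "finite X" "finite Y" using fin X(1) Y(1) finite_subset by auto
  have XV: "X \<subseteq> V" "Y \<subseteq> V" using X(1) Y(1) cell_subset[of V] by blast+
  \<comment> \<open>As \<open>X\<close> and \<open>Y\<close> are generators of the fine partition,
    the indicator of \<open>X \<times> Y\<close> is constant on products of fine cells.\<close>
  have "(\<Sum>p\<in>V \<times> V. ?q' p * of_bool (p \<in> X \<times> Y)) = (\<Sum>e\<in>E. of_bool (e \<in> X \<times> Y))"
  proof (rule sum_cell_density[OF V E])
    fix u v u' v' assume "u \<in> V" "v \<in> V" "u' \<in> cell V \<A>' u" "v' \<in> cell V \<A>' v"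
    then have "u' \<in> X \<longleftrightarrow> u \<in> X" "v' \<in> Y \<longleftrightarrow> v \<in> Y"
      using X(2) Y(2) by (auto simp: cell_def)
    then show "of_bool ((u', v') \<in> X \<times> Y) = (of_bool ((u, v) \<in> X \<times> Y) :: real)" by simp
  qed
  moreover have "(\<Sum>p\<in>V \<times> V. ?q' p * of_bool (p \<in> X \<times> Y)) = (\<Sum>p\<in>X \<times> Y. ?q' p)"
    using XV by (intro sum.mono_neutral_cong_right) (auto simp: V)
  moreover have "(\<Sum>e\<in>E. of_bool (e \<in> X \<times> Y)) = real (card (E \<inter> X \<times> Y))"
  proof -
    have "finite E" using V E finite_subset by blast
    then show ?thesis by (simp add: Int_def flip: mem_Times_iff)
  qed
  ultimately have s1: "(\<Sum>p\<in>X \<times> Y. ?q' p) = card (E \<inter> X \<times> Y)" by simp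
  have cC: "card ?C > 0" "card ?D > 0" using card_cell_pos[OF V] x y by auto
  have cX: "real (card X) > 0" "real (card Y) > 0"
    using X(3) Y(3) cC mult_pos_pos[OF \<epsilon>] by (metis of_nat_0_less_iff order.strict_trans2)+
  have N: "?N > 0" using cX by simp
  have s2: "(\<Sum>p\<in>X \<times> Y. ?q p) = ?N * density E ?C ?D"
  proof -
    have "?q p = density E ?C ?D" if "p \<in> X \<times> Y" for p
    proof -
      have "cell V \<A> (fst p) = ?C" "cell V \<A> (snd p) = ?D" using that X(1) Y(1)
        by (auto intro!: cell_eq)
      then show ?thesis by (simp add: cell_density_def)
    qed
    then show ?thesis by (simp add: card_cartesian_product)
  qed
  have s3: "(\<Sum>p\<in>X \<times> Y. ?q' p - ?q p) = ?N * (density E X Y - density E ?C ?D)"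
    unfolding sum_subtractf s1 s2 using cX by (auto simp: density_def right_diff_distrib)
  have "(?N * \<epsilon>)\<^sup>2 \<le> (?N * (density E X Y - density E ?C ?D))\<^sup>2"
    using irr N \<epsilon> by (simp add: abs_le_square_iff[symmetric] abs_mult mult_left_mono)
  also have "\<dots> = (\<Sum>p\<in>X \<times> Y. 1 * (?q' p - ?q p))\<^sup>2" by (simp only: s3 mult_1)
  also have "\<dots> \<le> (\<Sum>p\<in>X \<times> Y. 1\<^sup>2) * (\<Sum>p\<in>X \<times> Y. (?q' p - ?q p)\<^sup>2)"
    by (rule Cauchy_Schwarz_ineq_sum)
  also have "(\<Sum>p\<in>X \<times> Y. 1\<^sup>2) = ?N" by (simp add: card_cartesian_product)
  finally have "?N * (?N * \<epsilon>\<^sup>2) \<le> ?N * (\<Sum>p\<in>X \<times> Y. (?q' p - ?q p)\<^sup>2)"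
    by (simp add: power2_eq_square algebra_simps)
  then have "?N * \<epsilon>\<^sup>2 \<le> (\<Sum>p\<in>X \<times> Y. (?q' p - ?q p)\<^sup>2)" using N by (simp only: mult_le_cancel_left_pos)
  also have "\<dots> \<le> (\<Sum>p\<in>?C \<times> ?D. (?q' p - ?q p)\<^sup>2)"
    using X(1) Y(1) fin by (intro sum_mono2) auto
  finally have A: "?N * \<epsilon>\<^sup>2 \<le> (\<Sum>p\<in>?C \<times> ?D. (?q' p - ?q p)\<^sup>2)" .
  have "(\<epsilon> * card ?C) * (\<epsilon> * card ?D) \<le> card X * card Y"
    using mult_mono[OF X(3) Y(3)] \<epsilon> by simp
  then have "((\<epsilon> * card ?C) * (\<epsilon> * card ?D)) * \<epsilon>\<^sup>2 \<le> ?N * \<epsilon>\<^sup>2"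
    by (rule mult_right_mono) simp
  moreover have "((\<epsilon> * card ?C) * (\<epsilon> * card ?D)) * \<epsilon>\<^sup>2 = \<epsilon> ^ 4 * (card ?C * card ?D)"
    by (simp add: power4_eq_xxxx power2_eq_square)
  ultimately show ?thesis using A by linarith
qed

text \<open>Pairs of vertices are counted instead of pairs of cells, so an irregular pair of cells
  enters with the product of its sizes.\<close>

definition irregular_pairs :: "real \<Rightarrow> 'v set \<Rightarrow> ('v \<times> 'v) set \<Rightarrow> 'v set set \<Rightarrow> ('v \<times> 'v) set" where
  "irregular_pairs \<epsilon> V E \<A> =
     {p \<in> V \<times> V. \<not> regular_pair \<epsilon> E (cell V \<A> (fst p)) (cell V \<A> (snd p))}"

text \<open>One pair of witnesses is adjoined for each irregular pair of cells, of which there are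
  at most \<open>4 ^ card \<A>\<close>. The local gains add up to at least
  \<open>\<epsilon> ^ 4\<close> times the number of irregular pairs of vertices.\<close>

lemma energy_increment:
  fixes \<epsilon> :: real
  assumes V: "finite V" and E: "E \<subseteq> V \<times> V" and \<A>: "finite \<A>" and \<epsilon>: "\<epsilon> > 0"
    and irr: "\<epsilon> * (real (card V))\<^sup>2 < card (irregular_pairs \<epsilon> V E \<A>)"
  obtains \<A>' where "\<A> \<subseteq> \<A>'" "finite \<A>'" "card \<A>' \<le> card \<A> + 2 * 4 ^ card \<A>"
    "energy V E \<A> + \<epsilon> ^ 5 * (real (card V))\<^sup>2 \<le> energy V E \<A>'"
proof -
  let ?I = "irregular_pairs \<epsilon> V E \<A>"
  let ?cc = "\<lambda>p. (cell V \<A> (fst p), cell V \<A> (snd p))"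
  define J where "J = ?cc ` ?I"
  have "\<exists>X Y. X \<subseteq> fst c \<and> Y \<subseteq> snd c \<and> \<epsilon> * card (fst c) \<le> card X \<and> \<epsilon> * card (snd c) \<le> card Y
      \<and> \<epsilon> \<le> \<bar>density E X Y - density E (fst c) (snd c)\<bar>" if "c \<in> J" for c
  proof -
    have "\<not> regular_pair \<epsilon> E (fst c) (snd c)"
      using that unfolding J_def irregular_pairs_def by auto
    then show ?thesis unfolding regular_pair_def by (simp only: not_all not_imp not_less) blast
  qed
  then obtain X Y where XY: "\<And>c. c \<in> J \<Longrightarrow> X c \<subseteq> fst c \<and> Y c \<subseteq> snd c
      \<and> \<epsilon> * card (fst c) \<le> card (X c) \<and> \<epsilon> * card (snd c) \<le> card (Y c)
      \<and> \<epsilon> \<le> \<bar>density E (X c) (Y c) - density E (fst c) (snd c)\<bar>"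
    by metis
  have Jsub: "J \<subseteq> cell V \<A> ` V \<times> cell V \<A> ` V" by (auto simp: J_def irregular_pairs_def)
  have finJ: "finite J" by (rule finite_subset[OF Jsub]) (simp add: card_cells_le \<A>)
  have "card J \<le> card (cell V \<A> ` V \<times> cell V \<A> ` V)"
    by (rule card_mono[OF _ Jsub]) (simp add: card_cells_le \<A>)
  also have "\<dots> \<le> 2 ^ card \<A> * 2 ^ card \<A>"
    unfolding card_cartesian_product by (intro mult_mono card_cells_le \<A>) auto
  also have "\<dots> = 4 ^ card \<A>" by (simp flip: power_mult_distrib)
  finally have cJ: "card J \<le> 4 ^ card \<A>" .
  define \<A>' where "\<A>' = \<A> \<union> X ` J \<union> Y ` J"
  have sub: "\<A> \<subseteq> \<A>'" by (auto simp: \<A>'_def)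
  have fin': "finite \<A>'" using \<A> finJ by (simp add: \<A>'_def)
  have card': "card \<A>' \<le> card \<A> + 2 * 4 ^ card \<A>"
  proof -
    have "card \<A>' \<le> card \<A> + card (X ` J) + card (Y ` J)"
      unfolding \<A>'_def by (meson card_Un_le add_le_mono1 le_trans)
    also have "\<dots> \<le> card \<A> + card J + card J" by (intro add_mono card_image_le finJ order_refl)
    finally show ?thesis using cJ by simp
  qed
  let ?g = "\<lambda>p. (cell_density V E \<A>' p - cell_density V E \<A> p)\<^sup>2"
  have finI: "finite ?I" using V by (simp add: irregular_pairs_def)
  have fib: "{p \<in> ?I. ?cc p = c} = fst c \<times> snd c" if c: "c \<in> J" for c
  proof -
    obtain x y where xy: "(x, y) \<in> ?I" "c = ?cc (x, y)" using c by (auto simp: J_def)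
    show ?thesis
    proof safe
      fix u v assume "(u, v) \<in> ?I"
      then have "u \<in> V" "v \<in> V" by (auto simp: irregular_pairs_def)
      then show "u \<in> fst (?cc (u, v))" "v \<in> snd (?cc (u, v))" by (auto simp: cell_self)
    next
      fix u v assume uv: "u \<in> fst c" "v \<in> snd c"
      then have "cell V \<A> u = cell V \<A> x" "cell V \<A> v = cell V \<A> y"
        using xy by (auto intro!: cell_eq)
      then show "?cc (u, v) = c" "(u, v) \<in> ?I"
        using xy uv by (auto simp: irregular_pairs_def dest: subsetD[OF cell_subset])
    qed
  qed
  have "\<epsilon> ^ 5 * (real (card V))\<^sup>2 = \<epsilon> ^ 4 * (\<epsilon> * (real (card V))\<^sup>2)" by (simp add: eval_nat_numeral)
  also have "\<dots> \<le> \<epsilon> ^ 4 * card ?I" using irr \<epsilon> by (intro mult_left_mono) auto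
  also have "\<dots> = (\<Sum>p\<in>?I. \<epsilon> ^ 4)" by simp
  also have "\<dots> = (\<Sum>c\<in>J. \<Sum>p\<in>{p \<in> ?I. ?cc p = c}. \<epsilon> ^ 4)"
    unfolding J_def by (rule sum.image_gen[OF finI])
  also have "\<dots> = (\<Sum>c\<in>J. \<epsilon> ^ 4 * (card (fst c) * card (snd c)))"
    by (simp add: fib card_cartesian_product mult.commute)
  also have "\<dots> \<le> (\<Sum>c\<in>J. \<Sum>p\<in>{p \<in> ?I. ?cc p = c}. ?g p)"
  proof (rule sum_mono)
    fix c assume c: "c \<in> J"
    then obtain x y where xy: "x \<in> V" "y \<in> V" "c = ?cc (x, y)"
      by (auto simp: J_def irregular_pairs_def)
    have "\<epsilon> ^ 4 * (card (fst c) * card (snd c)) \<le> (\<Sum>p\<in>fst c \<times> snd c. ?g p)"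
      using irregular_energy[OF V E sub \<epsilon> xy(1,2), of "X c" "Y c"] XY[OF c] c xy
      by (simp add: \<A>'_def)
    then show "\<epsilon> ^ 4 * (card (fst c) * card (snd c)) \<le> (\<Sum>p\<in>{p \<in> ?I. ?cc p = c}. ?g p)"
      using fib[OF c] by simp
  qed
  also have "\<dots> = (\<Sum>p\<in>?I. ?g p)"
    unfolding J_def by (rule sum.image_gen[OF finI, symmetric])
  also have "\<dots> \<le> (\<Sum>p\<in>V \<times> V. ?g p)"
    by (rule sum_mono2) (use V in \<open>auto simp: irregular_pairs_def\<close>)
  also have "\<dots> = energy V E \<A>' - energy V E \<A>" by (rule energy_diff[OF V E sub, symmetric])
  finally show ?thesis using that[OF sub fin' card'] by simp
qed

text \<open>The number \<open>k\<close> bounds how many energy increments are still possible: each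
  adds \<open>\<epsilon> ^ 5 * (real (card V))\<^sup>2\<close>, and the energy never exceeds
  \<open>(real (card V))\<^sup>2\<close>. The bound for \<open>Suc k\<close> comes from the one for
  \<open>k\<close> with \<open>a + 2 * 4 ^ a\<close> initial generators.\<close>

lemma regularity_aux:
  fixes \<epsilon> :: real
  assumes \<epsilon>: "\<epsilon> > 0"
  shows "\<exists>M. \<forall>(V :: 'v set) E \<A>. finite V \<longrightarrow> E \<subseteq> V \<times> V \<longrightarrow> finite \<A> \<longrightarrow> card \<A> \<le> a \<longrightarrow>
     (1 - real k * \<epsilon> ^ 5) * (real (card V))\<^sup>2 \<le> energy V E \<A> \<longrightarrow>
     (\<exists>\<A>'. \<A> \<subseteq> \<A>' \<and> finite \<A>' \<and> card \<A>' \<le> M \<and>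
        card (irregular_pairs \<epsilon> V E \<A>') \<le> \<epsilon> * (real (card V))\<^sup>2)"
proof (induction k arbitrary: a)
  case 0
  show ?case
  proof (intro exI[of _ a] allI impI)
    fix V :: "'v set" and E \<A>
    assume A: "finite V" "E \<subseteq> V \<times> V" "finite \<A>" "card \<A> \<le> a"
      "(1 - real 0 * \<epsilon> ^ 5) * (real (card V))\<^sup>2 \<le> energy V E \<A>"
    have "card (irregular_pairs \<epsilon> V E \<A>) \<le> \<epsilon> * (real (card V))\<^sup>2"
    proof (rule ccontr)
      assume "\<not> ?thesis"
      then have irr: "\<epsilon> * (real (card V))\<^sup>2 < card (irregular_pairs \<epsilon> V E \<A>)" by simp
      then have "V \<noteq> {}" by (auto simp: irregular_pairs_def)
      then have "\<epsilon> ^ 5 * (real (card V))\<^sup>2 > 0" using \<epsilon> A(1) by (simp add: card_gt_0_iff)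
      moreover obtain \<A>' where "energy V E \<A> + \<epsilon> ^ 5 * (real (card V))\<^sup>2 \<le> energy V E \<A>'"
        using energy_increment[OF A(1-3) \<epsilon> irr] by blast
      ultimately show False using energy_le[OF A(1), of E \<A>'] A(5) by simp
    qed
    with A show "\<exists>\<A>'. \<A> \<subseteq> \<A>' \<and> finite \<A>' \<and> card \<A>' \<le> a \<and>
        card (irregular_pairs \<epsilon> V E \<A>') \<le> \<epsilon> * (real (card V))\<^sup>2" by blast
  qed
next
  case (Suc k)
  obtain M where M: "\<And>(V :: 'v set) E \<A>. \<lbrakk>finite V; E \<subseteq> V \<times> V; finite \<A>; card \<A> \<le> a + 2 * 4 ^ a;
     (1 - real k * \<epsilon> ^ 5) * (real (card V))\<^sup>2 \<le> energy V E \<A>\<rbrakk> \<Longrightarrow>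
     \<exists>\<A>'. \<A> \<subseteq> \<A>' \<and> finite \<A>' \<and> card \<A>' \<le> M \<and>
        card (irregular_pairs \<epsilon> V E \<A>') \<le> \<epsilon> * (real (card V))\<^sup>2"
    using Suc.IH[of "a + 2 * 4 ^ a"] by blast
  show ?case
  proof (intro exI[of _ "max a M"] allI impI)
    fix V :: "'v set" and E \<A>
    assume A: "finite V" "E \<subseteq> V \<times> V" "finite \<A>" "card \<A> \<le> a"
      "(1 - real (Suc k) * \<epsilon> ^ 5) * (real (card V))\<^sup>2 \<le> energy V E \<A>"
    show "\<exists>\<A>'. \<A> \<subseteq> \<A>' \<and> finite \<A>' \<and> card \<A>' \<le> max a M \<and>
        card (irregular_pairs \<epsilon> V E \<A>') \<le> \<epsilon> * (real (card V))\<^sup>2"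
    proof (cases "card (irregular_pairs \<epsilon> V E \<A>) \<le> \<epsilon> * (real (card V))\<^sup>2")
      case True
      with A show ?thesis by (intro exI[of _ \<A>]) auto
    next
      case False
      then have irr: "\<epsilon> * (real (card V))\<^sup>2 < card (irregular_pairs \<epsilon> V E \<A>)" by simp
      obtain \<A>' where \<A>': "\<A> \<subseteq> \<A>'" "finite \<A>'" "card \<A>' \<le> card \<A> + 2 * 4 ^ card \<A>"
        "energy V E \<A> + \<epsilon> ^ 5 * (real (card V))\<^sup>2 \<le> energy V E \<A>'"
        by (rule energy_increment[OF A(1-3) \<epsilon> irr])
      have "card \<A> + 2 * 4 ^ card \<A> \<le> a + 2 * 4 ^ a"
        using A(4) by (intro add_mono mult_left_mono power_increasing) auto
      moreover have "(1 - real k * \<epsilon> ^ 5) * (real (card V))\<^sup>2 \<le> energy V E \<A>'"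
        using A(5) \<A>'(4) by (simp add: algebra_simps)
      ultimately obtain \<A>'' where "\<A>' \<subseteq> \<A>''" "finite \<A>''" "card \<A>'' \<le> M"
        "card (irregular_pairs \<epsilon> V E \<A>'') \<le> \<epsilon> * (real (card V))\<^sup>2"
        using M[OF A(1,2) \<A>'(2)] \<A>'(3) by fastforce
      with \<A>'(1) show ?thesis by (intro exI[of _ \<A>'']) auto
    qed
  qed
qed

text \<open>Prescribing the initial family makes it possible to keep the cells inside given colour
  classes. Cells may differ in size; the application discards the small ones.\<close>

lemma szemeredi_regularity:
  fixes \<epsilon> :: real
  assumes \<epsilon>: "\<epsilon> > 0"
  shows "\<exists>M. \<forall>(V :: 'v set) E \<A>. finite V \<longrightarrow> E \<subseteq> V \<times> V \<longrightarrow> finite \<A> \<longrightarrow> card \<A> \<le> a \<longrightarrow>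
     (\<exists>\<A>'. \<A> \<subseteq> \<A>' \<and> finite \<A>' \<and> card \<A>' \<le> M \<and>
        card (irregular_pairs \<epsilon> V E \<A>') \<le> \<epsilon> * (real (card V))\<^sup>2)"
proof -
  \<comment> \<open>For such \<open>k\<close> the lower bound demanded of the energy is not positive
    and hence holds for every initial family.\<close>
  obtain k :: nat where "1 / \<epsilon> ^ 5 < k" using reals_Archimedean2 by blast
  then have k: "1 - k * \<epsilon> ^ 5 \<le> 0" using \<epsilon> by (simp add: field_simps)
  have "(1 - real k * \<epsilon> ^ 5) * (real (card V))\<^sup>2 \<le> energy V E \<A>" for V :: "'v set" and E \<A>
  proof -
    have "(1 - real k * \<epsilon> ^ 5) * (real (card V))\<^sup>2 \<le> 0" using k by (simp add: mult_nonpos_nonneg)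
    also have "0 \<le> energy V E \<A>" by (simp add: energy_def sum_nonneg)
    finally show ?thesis .
  qed
  then show ?thesis using regularity_aux[OF \<epsilon>, where 'v = 'v and a = a and k = k] by simp
qed

section \<open>Spurious cliques in linear systems\<close>

text \<open>A large set of vertices with low degree into \<open>Y\<close> would have density at most
  \<open>\<delta>\<close> to \<open>Y\<close>, whereas regularity gives more than
  \<open>2 * \<delta> - \<epsilon>\<close>, which is at least \<open>\<delta>\<close>.\<close>

lemma few_low_degree:
  fixes \<epsilon> \<delta> :: real
  assumes reg: "regular_pair \<epsilon> E A B" and dens: "2 * \<delta> \<le> density E A B" and le: "\<epsilon> \<le> \<delta>"
    and fin: "finite A" "finite B" and A: "A \<noteq> {}" and \<epsilon>: "\<epsilon> > 0"
    and Y: "Y \<subseteq> B" "\<epsilon> * card B \<le> card Y"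
  shows "card {x \<in> A. card {y \<in> Y. (x, y) \<in> E} < \<delta> * card Y} < \<epsilon> * card A"
proof (rule ccontr)
  let ?Z = "{x \<in> A. card {y \<in> Y. (x, y) \<in> E} < \<delta> * card Y}"
  assume "\<not> ?thesis"
  then have Z: "\<epsilon> * card A \<le> card ?Z" by simp
  have finY: "finite Y" using Y(1) fin(2) finite_subset by blast
  have "\<bar>density E ?Z Y - density E A B\<bar> < \<epsilon>"
    using reg[unfolded regular_pair_def, rule_format, of ?Z Y] Z Y by simp
  then have gt: "\<delta> < density E ?Z Y" using dens le by linarith
  have "E \<inter> ?Z \<times> Y = (SIGMA x:?Z. {y \<in> Y. (x, y) \<in> E})" by auto
  moreover have "card (SIGMA x:?Z. {y \<in> Y. (x, y) \<in> E}) = (\<Sum>x\<in>?Z. card {y \<in> Y. (x, y) \<in> E})"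
    by (rule card_SigmaI) (use fin finY in auto)
  ultimately have "card (E \<inter> ?Z \<times> Y) = (\<Sum>x\<in>?Z. card {y \<in> Y. (x, y) \<in> E})"
    by presburger
  then have "real (card (E \<inter> ?Z \<times> Y)) = (\<Sum>x\<in>?Z. real (card {y \<in> Y. (x, y) \<in> E}))" by simp
  also have "\<dots> \<le> (\<Sum>x\<in>?Z. \<delta> * card Y)" by (rule sum_mono) auto
  finally have 1: "real (card (E \<inter> ?Z \<times> Y)) \<le> \<delta> * (card ?Z * card Y)"
    by (simp add: algebra_simps)
  have "0 < \<epsilon> * card A" using A fin \<epsilon> by (simp add: card_gt_0_iff)
  then have Zpos: "real (card ?Z) > 0" using Z by linarith
  show False
  proof (cases "card Y = 0")
    \<comment> \<open>Division by zero makes the density 0 here, which already contradicts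
      \<open>gt\<close>.\<close>
    case True
    then show False using gt le \<epsilon> by (simp add: density_def)
  next
    case False
    then have "real (card ?Z * card Y) > 0" using Zpos by simp
    then have "density E ?Z Y \<le> \<delta>" using 1 by (simp add: density_def divide_le_eq)
    with gt show False by simp
  qed
qed

text \<open>The vertices are chosen one at a time, each choice keeping a \<open>\<delta>\<close>
  share of every later candidate set. The set \<open>forb x k\<close> excludes at most one vertex in
  terms of the earlier choices; this freedom will make the clique spurious.\<close>

lemma greedy_embedding:
  fixes \<epsilon> \<delta> :: real and A :: "nat \<Rightarrow> 'v set" and forb :: "(nat \<Rightarrow> 'v) \<Rightarrow> nat \<Rightarrow> 'v set"
  assumes \<epsilon>: "\<epsilon> > 0" and \<delta>: "\<delta> > 0" "\<delta> \<le> 1" and small: "real (m + 1) * \<epsilon> \<le> \<delta> ^ m"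
    and fin: "\<And>i. i < m \<Longrightarrow> finite (A i)" and big: "\<And>i. i < m \<Longrightarrow> 2 \<le> \<epsilon> * card (A i)"
    and reg: "\<And>i j. i < j \<Longrightarrow> j < m \<Longrightarrow> regular_pair \<epsilon> E (A i) (A j)"
    and dens: "\<And>i j. i < j \<Longrightarrow> j < m \<Longrightarrow> 2 * \<delta> \<le> density E (A i) (A j)"
    and forb: "\<And>x k. finite (forb x k)" "\<And>x k. card (forb x k) \<le> 1"
      "\<And>x y k. (\<And>i. i < k \<Longrightarrow> x i = y i) \<Longrightarrow> forb x k = forb y k"
  shows "\<exists>x. (\<forall>i<m. x i \<in> A i \<and> x i \<notin> forb x i) \<and> (\<forall>j<m. \<forall>i<j. (x i, x j) \<in> E)"
proof -
  let ?N = "\<lambda>x k j. {y \<in> A j. \<forall>i<k. (x i, y) \<in> E}"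
  \<comment> \<open>The last conjunct is the invariant: after \<open>k\<close> choices, each later
    set retains a \<open>\<delta> ^ k\<close> share of vertices adjacent to all chosen ones.\<close>
  have "\<exists>x. (\<forall>i<k. x i \<in> A i \<and> x i \<notin> forb x i) \<and> (\<forall>j<k. \<forall>i<j. (x i, x j) \<in> E) \<and>
      (\<forall>j. k \<le> j \<longrightarrow> j < m \<longrightarrow> \<delta> ^ k * card (A j) \<le> card (?N x k j))" if "k \<le> m" for k
    using that
  proof (induction k)
    case 0
    then show ?case by simp
  next
    case (Suc k)
    then have k: "k < m" by simp
    obtain x where x: "\<And>i. i < k \<Longrightarrow> x i \<in> A i \<and> x i \<notin> forb x i"
      "\<And>i j. j < k \<Longrightarrow> i < j \<Longrightarrow> (x i, x j) \<in> E"
      "\<And>j. k \<le> j \<Longrightarrow> j < m \<Longrightarrow> \<delta> ^ k * card (A j) \<le> card (?N x k j)"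
      using Suc by fastforce
    have dk: "\<delta> ^ m \<le> \<delta> ^ k" using \<delta> k by (intro power_decreasing) auto
    have le: "real (m + 1) * \<epsilon> * card (A j) \<le> card (?N x k j)" if "k \<le> j" "j < m" for j
    proof -
      have "real (m + 1) * \<epsilon> * card (A j) \<le> \<delta> ^ k * card (A j)"
        using small dk by (intro mult_right_mono) auto
      then show ?thesis using x(3)[OF that] by linarith
    qed
    have "\<delta> ^ m \<le> \<delta> ^ 1" using \<delta> k by (intro power_decreasing) auto
    moreover have "1 * \<epsilon> \<le> real (m + 1) * \<epsilon>" using \<epsilon> by (intro mult_right_mono) auto
    ultimately have \<epsilon>\<delta>: "\<epsilon> \<le> \<delta>" using small by simp
    have ne: "A j \<noteq> {}" if "j < m" for j using big[OF that] by auto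
    define Z where "Z j = {v \<in> A k. card {y \<in> ?N x k j. (v, y) \<in> E} < \<delta> * card (?N x k j)}" for j
    have Zcard: "card (Z j) \<le> \<epsilon> * card (A k)" if "j \<in> {k<..<m}" for j
    proof -
      have j: "k < j" "j < m" using that by auto
      have "\<epsilon> * card (A j) \<le> real (m + 1) * \<epsilon> * card (A j)"
        using \<epsilon> by (intro mult_right_mono) auto
      then have le': "\<epsilon> * card (A j) \<le> card (?N x k j)" using le[of j] j by linarith
      show ?thesis unfolding Z_def
        by (rule less_imp_le, rule few_low_degree[OF reg[OF j] dens[OF j] \<epsilon>\<delta> fin fin ne \<epsilon>])
           (use k j le' in auto)
    qed
    have "card (\<Union>j\<in>{k<..<m}. Z j) \<le> (\<Sum>j\<in>{k<..<m}. card (Z j))" by (rule card_UN_le) simp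
    then have "real (card (\<Union>j\<in>{k<..<m}. Z j)) \<le> (\<Sum>j\<in>{k<..<m}. real (card (Z j)))"
      by (metis of_nat_le_iff of_nat_sum)
    also have "\<dots> \<le> (\<Sum>j\<in>{k<..<m}. \<epsilon> * card (A k))" using Zcard by (intro sum_mono) auto
    also have "\<dots> \<le> m * (\<epsilon> * card (A k))" using \<epsilon> by (simp add: mult_right_mono)
    finally have U: "real (card (\<Union>j\<in>{k<..<m}. Z j)) \<le> m * (\<epsilon> * card (A k))" .
    \<comment> \<open>Of at least \<open>(m + 1) * \<epsilon> * card (A k)\<close> candidates, at
      most \<open>m * \<epsilon> * card (A k)\<close> have low degree into some later candidate set
      and at most one is forbidden. Since \<open>\<epsilon> * card (A k)\<close> is at least 2, a
      vertex remains.\<close>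
    have "\<not> ?N x k k \<subseteq> (\<Union>j\<in>{k<..<m}. Z j) \<union> forb x k"
    proof
      assume sub: "?N x k k \<subseteq> (\<Union>j\<in>{k<..<m}. Z j) \<union> forb x k"
      have "finite (\<Union>j\<in>{k<..<m}. Z j)" using fin[OF k] by (auto simp: Z_def)
      then have "card (?N x k k) \<le> card ((\<Union>j\<in>{k<..<m}. Z j) \<union> forb x k)"
        using forb(1) by (intro card_mono[OF _ sub]) auto
      also have "\<dots> \<le> card (\<Union>j\<in>{k<..<m}. Z j) + 1"
        using card_Un_le[of "\<Union>j\<in>{k<..<m}. Z j" "forb x k"] forb(2)[of x k] by linarith
      finally have "real (card (?N x k k)) \<le> m * (\<epsilon> * card (A k)) + 1" using U by linarith
      moreover have "real (m + 1) * \<epsilon> * card (A k) = m * (\<epsilon> * card (A k)) + \<epsilon> * card (A k)"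
        by (simp add: algebra_simps)
      ultimately show False using le[OF order_refl k] big[OF k] by linarith
    qed
    then obtain v where v: "v \<in> ?N x k k" "v \<notin> forb x k" "\<And>j. j \<in> {k<..<m} \<Longrightarrow> v \<notin> Z j" by blast
    define x' where "x' = x(k := v)"
    have forb': "forb x' i = forb x i" if "i \<le> k" for i
      by (rule forb(3)) (use that in \<open>auto simp: x'_def\<close>)
    have "x' i \<in> A i \<and> x' i \<notin> forb x' i" if "i < Suc k" for i
      using x(1) v that forb'[of i] by (cases "i = k") (auto simp: x'_def)
    moreover have "(x' i, x' j) \<in> E" if "j < Suc k" "i < j" for i j
      using x(2) v that by (cases "j = k") (auto simp: x'_def)
    moreover have "\<delta> ^ Suc k * card (A j) \<le> card (?N x' (Suc k) j)" if j: "Suc k \<le> j" "j < m" for j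
    proof -
      have eq: "?N x' (Suc k) j = {y \<in> ?N x k j. (v, y) \<in> E}"
        by (auto simp: x'_def less_Suc_eq)
      have "v \<notin> Z j" "v \<in> A k" using v j by auto
      then have "\<delta> * card (?N x k j) \<le> card {y \<in> ?N x k j. (v, y) \<in> E}"
        by (simp add: Z_def not_less)
      moreover have "\<delta> * (\<delta> ^ k * card (A j)) \<le> \<delta> * card (?N x k j)"
        using x(3)[of j] j \<delta> by (intro mult_left_mono) auto
      ultimately show ?thesis unfolding eq by (simp add: mult.assoc)
    qed
    ultimately show ?case by blast
  qed
  from this[OF order_refl] show ?thesis by blast
qed

text \<open>The members of \<open>T\<close> act as \<open>m\<close>-cliques with one vertex of each
  colour \<open>\<rho>\<close>, any two of which determine the clique. The tuple \<open>x\<close>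
  looks like a member in every two positions without being one, as in the Ruzsa-Szemeredi theorem.
  The first argument fixes the type of the vertices.\<close>

definition forces_spurious_clique :: "'v itself \<Rightarrow> nat \<Rightarrow> real \<Rightarrow> nat \<Rightarrow> bool" where
  "forces_spurious_clique (_ :: 'v itself) m c n \<longleftrightarrow> (\<forall>(V :: 'v set) T \<rho>. finite V \<longrightarrow> card V \<le> n \<longrightarrow>
    (\<forall>f\<in>T. \<forall>i<m. f i \<in> V \<and> \<rho> (f i) = i) \<longrightarrow>
    (\<forall>f\<in>T. \<forall>g\<in>T. \<forall>i<m. \<forall>j<m. i \<noteq> j \<longrightarrow> f i = g i \<longrightarrow> f j = g j \<longrightarrow> f = g) \<longrightarrow>
    c * real n ^ 2 \<le> card T \<longrightarrow>
    (\<exists>x. (\<forall>i<m. \<forall>j<m. i \<noteq> j \<longrightarrow> (\<exists>f\<in>T. f i = x i \<and> f j = x j)) \<and> \<not> (\<exists>f\<in>T. \<forall>i<m. f i = x i)))"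

lemma forces_spurious_cliqueD:
  fixes V :: "'v set"
  assumes "forces_spurious_clique TYPE('v) m c n" "finite V" "card V \<le> n"
    "\<forall>f\<in>T. \<forall>i<m. f i \<in> V \<and> \<rho> (f i) = i"
    "\<forall>f\<in>T. \<forall>g\<in>T. \<forall>i<m. \<forall>j<m. i \<noteq> j \<longrightarrow> f i = g i \<longrightarrow> f j = g j \<longrightarrow> f = g"
    "c * real n ^ 2 \<le> card T"
  shows "\<exists>x. (\<forall>i<m. \<forall>j<m. i \<noteq> j \<longrightarrow> (\<exists>f\<in>T. f i = x i \<and> f j = x j)) \<and>
    \<not> (\<exists>f\<in>T. \<forall>i<m. f i = x i)"
proof -
  note * = assms(1)[unfolded forces_spurious_clique_def, THEN spec, of V, THEN spec, of T, THEN spec, of \<rho>]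
  show ?thesis
    by (rule *[THEN mp, THEN mp, THEN mp, THEN mp, THEN mp]) (rule assms(2-6))+
qed

text \<open>
  The Ruzsa--Szemeredi argument: after discarding sparse, irregular and small pairs of cells some
  member of the system survives, and its cells contain many further cliques of the shadow graph.
\<close>
lemma linear_system_spurious_clique:
  fixes m :: nat and c :: real
  assumes m: "m \<ge> 3" and c: "c > 0"
  shows "\<exists>N. \<forall>n\<ge>N. forces_spurious_clique TYPE('v) m c n"
proof -
  \<comment> \<open>Pairs of cells of density below \<open>2 * \<delta>\<close> carry at most a
    quarter of \<open>c * n\<^sup>2\<close> edges. The choice of \<open>\<epsilon>\<close> is the
    one required by the greedy embedding.\<close>
  define \<delta> where "\<delta> = min 1 (c / 8)"
  define \<epsilon> where "\<epsilon> = \<delta> ^ m / real (m + 1)"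
  have \<delta>: "\<delta> > 0" "\<delta> \<le> 1" "\<delta> \<le> c / 8" using c by (auto simp: \<delta>_def)
  have \<epsilon>: "\<epsilon> > 0" "real (m + 1) * \<epsilon> \<le> \<delta> ^ m" using \<delta> by (auto simp: \<epsilon>_def)
  have "\<delta> ^ m \<le> \<delta> ^ 1" using \<delta> m by (intro power_decreasing) auto
  moreover have "1 * \<epsilon> \<le> real (m + 1) * \<epsilon>" using \<epsilon> by (intro mult_right_mono) auto
  ultimately have \<epsilon>c: "\<epsilon> \<le> c / 8" using \<epsilon>(2) \<delta> by simp
  obtain M where M: "\<And>(V :: 'v set) E \<A>. finite V \<Longrightarrow> E \<subseteq> V \<times> V \<Longrightarrow> finite \<A> \<Longrightarrow> card \<A> \<le> m \<Longrightarrow>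
     (\<exists>\<A>'. \<A> \<subseteq> \<A>' \<and> finite \<A>' \<and> card \<A>' \<le> M \<and>
        card (irregular_pairs \<epsilon> V E \<A>') \<le> \<epsilon> * (real (card V))\<^sup>2)"
    using szemeredi_regularity[OF \<epsilon>(1), of m, where 'v = 'v] by blast
  \<comment> \<open>A bound for the number of vertices in small cells: there are at most
    \<open>2 ^ M\<close> cells, and a small one has fewer than \<open>2 / \<epsilon>\<close>
    vertices.\<close>
  define Q :: real where "Q = 2 ^ M * (2 / \<epsilon>)"
  have Q: "Q > 0" using \<epsilon> by (simp add: Q_def)
  obtain N where N: "8 * Q / c < real N" using reals_Archimedean2 by blast
  have main: "\<exists>x. (\<forall>i<m. \<forall>j<m. i \<noteq> j \<longrightarrow> (\<exists>f\<in>T. f i = x i \<and> f j = x j)) \<and> \<not> (\<exists>f\<in>T. \<forall>i<m. f i = x i)"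
    if n: "n \<ge> N" and V: "finite V" "card V \<le> n"
      and T: "\<And>f i. f \<in> T \<Longrightarrow> i < m \<Longrightarrow> f i \<in> V" and \<rho>: "\<And>f i. f \<in> T \<Longrightarrow> i < m \<Longrightarrow> \<rho> (f i) = i"
      and lin: "\<And>f g i j. \<lbrakk>f \<in> T; g \<in> T; i < m; j < m; i \<noteq> j; f i = g i; f j = g j\<rbrakk> \<Longrightarrow> f = g"
      and large: "c * real n ^ 2 \<le> card T" for n and V :: "'v set" and T \<rho>
  proof -
    have nQ: "8 * Q < c * n" using N n c by (simp add: field_simps) (smt (verit) mult_left_mono of_nat_le_iff)
    then have npos: "real n > 0" using Q c by (smt (verit) zero_less_mult_pos)
    \<comment> \<open>The shadow graph, each pair oriented by increasing position.\<close>
    define E where "E = {(f i, f j) |f i j. f \<in> T \<and> i < j \<and> j < m}"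
    have EV: "E \<subseteq> V \<times> V" unfolding E_def using T by fastforce
    then have finE: "finite E" using V(1) finite_subset by blast
    \<comment> \<open>Starting from the colour classes keeps each cell that meets one of them inside
      it.\<close>
    define \<A>\<^sub>0 where "\<A>\<^sub>0 = (\<lambda>i. {v \<in> V. \<rho> v = i}) ` {..<m}"
    have "finite \<A>\<^sub>0" "card \<A>\<^sub>0 \<le> m" using card_image_le[of "{..<m}"] by (auto simp: \<A>\<^sub>0_def)
    then obtain \<A> where \<A>: "\<A>\<^sub>0 \<subseteq> \<A>" "finite \<A>" "card \<A> \<le> M"
      "card (irregular_pairs \<epsilon> V E \<A>) \<le> \<epsilon> * (real (card V))\<^sup>2"
      using M[OF V(1) EV] by blast
    define I where "I = irregular_pairs \<epsilon> V E \<A>"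
    define Low where "Low = {e \<in> E. cell_density V E \<A> e < 2 * \<delta>}"
    define S where "S = {x \<in> V. \<epsilon> * card (cell V \<A> x) < 2}"
    have V2: "(real (card V))\<^sup>2 \<le> (real n)\<^sup>2" using V(2) by (intro power_mono) auto
    have finI: "finite I" using V(1) by (simp add: I_def irregular_pairs_def)
    have finS: "finite S" using V(1) by (simp add: S_def)
    have cI: "card I \<le> c / 8 * (real n)\<^sup>2"
    proof -
      have "\<epsilon> * (real (card V))\<^sup>2 \<le> c / 8 * (real n)\<^sup>2"
        using \<epsilon>c V2 \<epsilon>(1) c by (intro mult_mono) auto
      then show ?thesis using \<A>(4) by (simp add: I_def)
    qed
    have cLow: "card Low \<le> c / 4 * (real n)\<^sup>2"
    proof -
      let ?h = "\<lambda>e. of_bool (cell_density V E \<A> e < 2 * \<delta>) :: real"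
      have "real (card Low) = (\<Sum>e\<in>E. ?h e)" using finE by (simp add: Low_def Int_def)
      also have "\<dots> = (\<Sum>p\<in>V \<times> V. cell_density V E \<A> p * ?h p)"
        by (rule sum_cell_density[OF V(1) EV, symmetric]) (simp add: cell_density_def cell_eq)
      also have "\<dots> \<le> (\<Sum>p\<in>V \<times> V. 2 * \<delta>)" using \<delta>(1) by (intro sum_mono) auto
      also have "\<dots> = 2 * \<delta> * (real (card V))\<^sup>2"
        by (simp add: card_cartesian_product power2_eq_square)
      also have "\<dots> \<le> c / 4 * (real n)\<^sup>2" using \<delta> V2 c by (intro mult_mono) auto
      finally show ?thesis .
    qed
    have cS: "real (card S) \<le> Q"
    proof -
      define CS where "CS = {C \<in> cell V \<A> ` V. \<epsilon> * card C < 2}"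
      have fCS: "finite CS" using card_cells_le(1)[OF \<A>(2)] by (simp add: CS_def)
      have "S \<subseteq> \<Union> CS" using cell_self by (fastforce simp: S_def CS_def)
      then have "card S \<le> card (\<Union> CS)"
        using fCS V(1) by (intro card_mono) (auto simp: CS_def finite_cell)
      also have "\<dots> \<le> (\<Sum>C\<in>CS. card C)" using card_UN_le[OF fCS, of id] by simp
      finally have "real (card S) \<le> (\<Sum>C\<in>CS. real (card C))" by (metis of_nat_le_iff of_nat_sum)
      also have "\<dots> \<le> (\<Sum>C\<in>CS. 2 / \<epsilon>)"
        by (rule sum_mono) (use \<epsilon>(1) in \<open>simp add: CS_def field_simps\<close>)
      also have "\<dots> = card CS * (2 / \<epsilon>)" by simp
      also have "\<dots> \<le> Q" unfolding Q_def
      proof (rule mult_right_mono)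
        have "card CS \<le> card (cell V \<A> ` V)"
          using card_cells_le(1)[OF \<A>(2)] by (intro card_mono) (auto simp: CS_def)
        also have "\<dots> \<le> 2 ^ card \<A>" by (rule card_cells_le(2)[OF \<A>(2)])
        also have "\<dots> \<le> 2 ^ M" using \<A>(3) by (intro power_increasing) auto
        finally show "real (card CS) \<le> 2 ^ M" by simp
      qed (use \<epsilon>(1) in simp)
      finally show ?thesis .
    qed
    have cSV: "card (S \<times> V \<union> V \<times> S) \<le> c / 4 * (real n)\<^sup>2"
    proof -
      have "card (S \<times> V \<union> V \<times> S) \<le> 2 * (card S * card V)"
        using card_Un_le[of "S \<times> V" "V \<times> S"] by (simp add: card_cartesian_product mult.commute)
      then have "real (card (S \<times> V \<union> V \<times> S)) \<le> 2 * (real (card S) * real (card V))"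
        by (simp flip: of_nat_mult)
      also have "\<dots> \<le> 2 * (Q * n)" using cS V(2) Q by (intro mult_left_mono mult_mono) auto
      also have "\<dots> \<le> 2 * (c / 8 * n * n)" using nQ npos by (intro mult_left_mono mult_right_mono) auto
      finally show ?thesis by (simp add: power2_eq_square)
    qed
    define Bad where "Bad = I \<union> Low \<union> (S \<times> V \<union> V \<times> S)"
    have finBad: "finite Bad" using finI finE finS V(1) by (simp add: Bad_def Low_def)
    have "card Bad \<le> card I + card Low + card (S \<times> V \<union> V \<times> S)"
      unfolding Bad_def by (meson card_Un_le add_le_mono1 le_trans)
    then have "real (card Bad) \<le> real (card I) + card Low + card (S \<times> V \<union> V \<times> S)"
      by simp
    also have "\<dots> \<le> c / 8 * (real n)\<^sup>2 + c / 4 * (real n)\<^sup>2 + c / 4 * (real n)\<^sup>2"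
      by (intro add_mono cI cLow cSV)
    also have "\<dots> < c * (real n)\<^sup>2" using c npos by simp
    finally have cBad: "card Bad < card T" using large by simp
    \<comment> \<open>Selecting a bad pair in every member would be injective, because the colours
      reveal the positions of the pair and two coordinates determine the member. There are fewer bad
      pairs than members.\<close>
    have "\<exists>f\<in>T. \<forall>j<m. \<forall>i<j. (f i, f j) \<notin> Bad"
    proof (rule ccontr)
      assume "\<not> ?thesis"
      then have "\<forall>f\<in>T. \<exists>i j. i < j \<and> j < m \<and> (f i, f j) \<in> Bad" by blast
      then obtain a b where ab: "\<And>f. f \<in> T \<Longrightarrow> a f < b f \<and> b f < m \<and> (f (a f), f (b f)) \<in> Bad"
        by metis
      have "inj_on (\<lambda>f. (f (a f), f (b f))) T"
      proof (rule inj_onI)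
        fix f g assume fg: "f \<in> T" "g \<in> T" "(f (a f), f (b f)) = (g (a g), g (b g))"
        have "a f = a g" "b f = b g"
          using fg \<rho>[of f "a f"] \<rho>[of g "a g"] \<rho>[of f "b f"] \<rho>[of g "b g"] ab[of f] ab[of g] by auto
        then show "f = g" using lin[of f g "a f" "b f"] fg ab[of f] by auto
      qed
      then have "card T \<le> card Bad"
        by (rule card_inj_on_le[OF _ _ finBad]) (use ab in auto)
      with cBad show False by simp
    qed
    then obtain f where f: "f \<in> T" "\<And>i j. i < j \<Longrightarrow> j < m \<Longrightarrow> (f i, f j) \<notin> Bad" by blast
    define A where "A i = cell V \<A> (f i)" for i
    have fV: "f i \<in> V" if "i < m" for i using T f(1) that by blast
    have big: "2 \<le> \<epsilon> * card (A i)" if "i < m" for i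
    proof (rule ccontr)
      assume "\<not> ?thesis"
      then have "f i \<in> S" using fV[OF that] by (simp add: S_def A_def)
      then have "(f i, f j) \<in> Bad" "(f j, f i) \<in> Bad" if "j < m" for j
        using fV[OF that] by (auto simp: Bad_def)
      then show False using f(2)[of i "i + 1"] f(2)[of 0 i] that m
        by (cases "i = 0") auto
    qed
    \<comment> \<open>At \<open>k = 2\<close> this excludes the third vertex of the only possible
      member through \<open>x 0\<close> and \<open>x 1\<close>, so \<open>x\<close> cannot be a
      member.\<close>
    define forb where "forb x k = (if 2 \<le> k \<and> k < m then {g k |g. g \<in> T \<and> g 0 = x 0 \<and> g 1 = x 1} else {})"
      for x :: "nat \<Rightarrow> 'v" and k
    have forb1: "\<exists>v. forb x k \<subseteq> {v}" for x :: "nat \<Rightarrow> 'v" and k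
    proof (cases "\<exists>g. g \<in> T \<and> g 0 = x 0 \<and> g 1 = x 1")
      case True
      then obtain g where g: "g \<in> T" "g 0 = x 0" "g 1 = x 1" by blast
      have "h = g" if "h \<in> T" "h 0 = x 0" "h 1 = x 1" for h
        using lin[of h g 0 1] g that m by simp
      then have "forb x k \<subseteq> {g k}" by (auto simp: forb_def)
      then show ?thesis by blast
    qed (auto simp: forb_def)
    have "\<exists>x. (\<forall>i<m. x i \<in> A i \<and> x i \<notin> forb x i) \<and> (\<forall>j<m. \<forall>i<j. (x i, x j) \<in> E)"
    proof (rule greedy_embedding[OF \<epsilon>(1) \<delta>(1,2) \<epsilon>(2) _ big])
      show "finite (A i)" for i by (simp add: A_def finite_cell V)
      show "regular_pair \<epsilon> E (A i) (A j)" if "i < j" "j < m" for i j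
        using f(2)[OF that] fV[of i] fV[of j] that
        by (auto simp: Bad_def I_def irregular_pairs_def A_def)
      show "2 * \<delta> \<le> density E (A i) (A j)" if "i < j" "j < m" for i j
      proof -
        have "(f i, f j) \<in> E" using f(1) that by (auto simp: E_def)
        then show ?thesis using f(2)[OF that] by (auto simp: Bad_def Low_def A_def cell_density_def)
      qed
      show "finite (forb x k)" for x k using forb1[of x k] finite_subset by blast
      show "card (forb x k) \<le> 1" for x k
        using forb1[of x k] by (metis card_mono finite.emptyI finite_insert is_singletonI is_singleton_altdef)
      show "forb x k = forb y k" if "\<And>i. i < k \<Longrightarrow> x i = y i" for x y k
        using that[of 0] that[of 1] by (auto simp: forb_def)
    qed
    then obtain x where x: "\<And>i. i < m \<Longrightarrow> x i \<in> A i" "\<And>i. i < m \<Longrightarrow> x i \<notin> forb x i"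
      "\<And>i j. i < j \<Longrightarrow> j < m \<Longrightarrow> (x i, x j) \<in> E" by blast
    have \<rho>x: "\<rho> (x i) = i" if "i < m" for i
    proof -
      have "{v \<in> V. \<rho> v = i} \<in> \<A>" using \<A>(1) that by (auto simp: \<A>\<^sub>0_def)
      from cell_subset_generator[OF this, of "f i" V] show ?thesis
        using x(1)[OF that] fV[OF that] \<rho>[OF f(1) that] by (auto simp: A_def)
    qed
    have lt: "\<exists>g\<in>T. g i = x i \<and> g j = x j" if ij: "i < j" "j < m" for i j
    proof -
      obtain g i' j' where g: "g \<in> T" "i' < j'" "j' < m" "x i = g i'" "x j = g j'"
        using x(3)[OF ij] by (auto simp: E_def)
      have "i' = i" "j' = j"
        using \<rho>[of g i'] \<rho>[of g j'] \<rho>x[of i] \<rho>x[of j] g ij by auto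
      then show ?thesis using g by auto
    qed
    have "\<exists>g\<in>T. g i = x i \<and> g j = x j" if "i < m" "j < m" "i \<noteq> j" for i j
      using lt[of i j] lt[of j i] that by (cases "i < j") auto
    moreover have "\<not> (\<exists>g\<in>T. \<forall>i<m. g i = x i)"
    proof
      assume "\<exists>g\<in>T. \<forall>i<m. g i = x i"
      then obtain g where g: "g \<in> T" "\<And>i. i < m \<Longrightarrow> g i = x i" by blast
      have "g 2 \<in> forb x 2" using g(1) g(2)[of 0] g(2)[of 1] m by (auto simp: forb_def)
      then show False using x(2)[of 2] g(2)[of 2] m by simp
    qed
    ultimately show ?thesis by blast
  qed
  show ?thesis
    unfolding forces_spurious_clique_def
  proof (intro exI[of _ N] allI impI, goal_cases)
    case (1 n V T \<rho>)
    then show ?case by (intro main[of n V T \<rho>]) simp_all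
  qed
qed

section \<open>Kernels of sunflowers\<close>

definition intersecting_system :: "'a set \<Rightarrow> nat \<Rightarrow> nat set \<Rightarrow> 'a set set \<Rightarrow> bool" where
  "intersecting_system V r L H \<longleftrightarrow> H \<subseteq> Pow V \<and> (\<forall>S\<in>H. card S = r) \<and>
     (\<forall>S\<in>H. \<forall>S'\<in>H. S \<noteq> S' \<longrightarrow> card (S \<inter> S') \<in> L)"

text \<open>Strict inclusion rules out empty petals. In the applications \<open>k = r + 1\<close>
  exceeds the size of every member, so some petal avoids any given member.\<close>

definition kernel :: "nat \<Rightarrow> 'a set set \<Rightarrow> 'a set \<Rightarrow> bool" where
  "kernel k H K \<longleftrightarrow> (\<exists>P\<subseteq>H. finite P \<and> card P = k \<and> (\<forall>S\<in>P. K \<subset> S) \<and>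
     (\<forall>S\<in>P. \<forall>S'\<in>P. S \<noteq> S' \<longrightarrow> S \<inter> S' = K))"

lemma intersecting_system_subset:
  "intersecting_system V r L H \<Longrightarrow> H' \<subseteq> H \<Longrightarrow> intersecting_system V r L H'"
  unfolding intersecting_system_def by blast

lemma intersecting_system_mono:
  "intersecting_system V r L H \<Longrightarrow> L \<subseteq> L' \<Longrightarrow> intersecting_system V r L' H"
  unfolding intersecting_system_def by blast

lemma intersecting_systemD:
  assumes "intersecting_system V r L H"
  shows "S \<in> H \<Longrightarrow> S \<subseteq> V" "S \<in> H \<Longrightarrow> card S = r"
    "S \<in> H \<Longrightarrow> S' \<in> H \<Longrightarrow> S \<noteq> S' \<Longrightarrow> card (S \<inter> S') \<in> L"
  using assms unfolding intersecting_system_def by blast+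

lemma finite_system: "finite V \<Longrightarrow> intersecting_system V r L H \<Longrightarrow> finite H"
  unfolding intersecting_system_def by (meson finite_Pow_iff finite_subset)

lemma finite_system_member: "finite V \<Longrightarrow> intersecting_system V r L H \<Longrightarrow> S \<in> H \<Longrightarrow> finite S"
  using intersecting_systemD(1) finite_subset by metis

lemma kernel_mono: "kernel k H K \<Longrightarrow> H \<subseteq> H' \<Longrightarrow> kernel k H' K"
  unfolding kernel_def by (fast intro: subset_trans)

lemma kernelE:
  assumes "kernel k H K"
  obtains P where "P \<subseteq> H" "finite P" "card P = k" "\<forall>S\<in>P. K \<subset> S"
    "\<forall>S\<in>P. \<forall>S'\<in>P. S \<noteq> S' \<longrightarrow> S \<inter> S' = K"
  using assms unfolding kernel_def by (elim exE conjE)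

text \<open>The petals are disjoint outside \<open>K\<close>, so fewer than \<open>k\<close> points
  cannot meet all of them.\<close>

lemma kernel_petal_avoiding:
  assumes "kernel k H K" "finite B" "card B < k"
  shows "\<exists>S\<in>H. K \<subset> S \<and> S \<inter> B \<subseteq> K"
proof (rule ccontr)
  assume no: "\<not> ?thesis"
  obtain P where P0: "P \<subseteq> H" "finite P" "card P = k" "\<forall>S\<in>P. K \<subset> S"
    "\<forall>S\<in>P. \<forall>S'\<in>P. S \<noteq> S' \<longrightarrow> S \<inter> S' = K"
    using assms(1) by (rule kernelE)
  note P = P0(1-3) P0(4,5)[rule_format]
  have "\<forall>S\<in>P. \<exists>x. x \<in> S \<and> x \<in> B \<and> x \<notin> K" using no P(1,4) by blast
  then obtain e where e: "\<And>S. S \<in> P \<Longrightarrow> e S \<in> S \<and> e S \<in> B \<and> e S \<notin> K" by metis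
  have "inj_on e P"
  proof (rule inj_onI)
    fix S S' assume SS: "S \<in> P" "S' \<in> P" "e S = e S'"
    show "S = S'"
    proof (rule ccontr)
      assume "S \<noteq> S'"
      then have "S \<inter> S' = K" using P(5) SS by blast
      then show False using e[of S] e[of S'] SS by auto
    qed
  qed
  then have "card P \<le> card B" by (rule card_inj_on_le) (use e assms(2) in auto)
  with P(3) assms(3) show False by simp
qed

text \<open>A kernel of at least two petals is the intersection of two distinct members.\<close>

lemma kernel_superset:
  assumes "kernel k H K" "2 \<le> k" "\<And>S. S \<in> H \<Longrightarrow> T \<subseteq> S"
  shows "T \<subseteq> K"
proof -
  obtain P where P0: "P \<subseteq> H" "finite P" "card P = k" "\<forall>S\<in>P. K \<subset> S"
    "\<forall>S\<in>P. \<forall>S'\<in>P. S \<noteq> S' \<longrightarrow> S \<inter> S' = K"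
    using assms(1) by (rule kernelE)
  note P = P0(1-3) P0(4,5)[rule_format]
  have "\<exists>S\<in>P. \<exists>S'\<in>P. S \<noteq> S'"
  proof (rule ccontr)
    assume "\<not> ?thesis"
    then have "card P \<le> 1" using card_le_Suc0_iff_eq[OF P(2)] by auto
    with P(3) assms(2) show False by simp
  qed
  then obtain S S' where "S \<in> P" "S' \<in> P" "S \<noteq> S'" by blast
  then have "S \<in> H" "S' \<in> H" "K = S \<inter> S'" using P by auto
  then show ?thesis using assms(3)[of S] assms(3)[of S'] by simp
qed

text \<open>Choose a member \<open>S\<close> around \<open>K\<close> that avoids \<open>K'\<close>
  outside \<open>K\<close>, then a member \<open>S'\<close> around \<open>K'\<close> that avoids
  \<open>S\<close> outside \<open>K'\<close>. They meet exactly in \<open>K \<inter> K'\<close>. For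
  \<open>K = K'\<close> this says that the size of a kernel lies in \<open>L\<close>.\<close>

lemma kernel_inter:
  assumes V: "finite V" and H: "intersecting_system V r L H"
    and K: "kernel k H K" "kernel k H K'" and k: "r < k"
  shows "card (K \<inter> K') \<in> L"
proof -
  obtain S0 where S0: "S0 \<in> H" "K' \<subset> S0"
    using kernel_petal_avoiding[OF K(2), of "{}"] k by auto
  have K': "finite K'" "card K' < k"
    using finite_subset[of K' S0] psubset_card_mono[of S0 K'] S0(2)
      finite_system_member[OF V H S0(1)] intersecting_systemD(2)[OF H S0(1)] k by auto
  obtain S where S: "S \<in> H" "K \<subset> S" "S \<inter> K' \<subseteq> K"
    using kernel_petal_avoiding[OF K(1) K'] by blast
  obtain S' where S': "S' \<in> H" "K' \<subset> S'" "S' \<inter> S \<subseteq> K'"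
    using kernel_petal_avoiding[OF K(2), of S] finite_system_member[OF V H S(1)]
      intersecting_systemD(2)[OF H S(1)] k by auto
  have "S \<noteq> S'" using S' by blast
  moreover have "S \<inter> S' = K \<inter> K'" using S S' by blast
  ultimately show ?thesis using intersecting_systemD(3)[OF H S(1) S'(1)] by simp
qed

section \<open>The sunflower lemma and covered members\<close>

text \<open>The Erdos-Rado argument by induction on \<open>r\<close>. A maximal disjoint subfamily
  either has more than \<open>k\<close> members, forming a sunflower with empty kernel, or its union
  has at most \<open>k * r\<close> points and meets every member. In the latter case some point lies
  in many members.\<close>

lemma sunflower_lemma:
  assumes "finite H" "\<And>S. S \<in> H \<Longrightarrow> finite S \<and> card S = r" "fact r * k ^ r < card H"
  shows "\<exists>K. kernel (Suc k) H K"
  using assms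
proof (induction r arbitrary: H)
  case 0
  have "S = {}" if "S \<in> H" for S using "0.prems"(2)[OF that] by auto
  then have "H \<subseteq> {{}}" by blast
  then have "card H \<le> 1" using card_mono[of "{{}}" H] by simp
  with 0 show ?case by simp
next
  case (Suc r)
  let ?D = "{M \<in> Pow H. pairwise disjnt M}"
  have D: "finite ?D" "{} \<in> ?D" using Suc.prems(1) by simp_all
  from finite_has_maximal2[OF D] obtain M
    where M: "M \<in> ?D" "\<forall>M'\<in>?D. M \<subseteq> M' \<longrightarrow> M = M'" by (elim bexE conjE)
  have MH: "M \<subseteq> H" "pairwise disjnt M" "finite M" using M(1) Suc.prems(1) finite_subset by auto
  show ?case
  proof (cases "Suc k \<le> card M")
    case True
    then obtain P where P: "P \<subseteq> M" "card P = Suc k" by (meson obtain_subset_with_card_n)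
    have "finite P" using P MH(3) finite_subset by blast
    moreover have "{} \<subset> S" if "S \<in> P" for S using Suc.prems(2)[of S] that P(1) MH(1) by force
    moreover have "S \<inter> S' = {}" if "S \<in> P" "S' \<in> P" "S \<noteq> S'" for S S'
      using MH(2) that P(1) by (auto simp: pairwise_def disjnt_def)
    ultimately have "kernel (Suc k) H {}"
      unfolding kernel_def using P MH(1) by (intro exI[of _ P]) auto
    then show ?thesis by blast
  next
    case False
    let ?U = "\<Union> M"
    have finU: "finite ?U" using MH Suc.prems(2) by blast
    have "card ?U \<le> (\<Sum>S\<in>M. card S)" using card_UN_le[OF MH(3), of id] by simp
    also have "\<dots> = (\<Sum>S\<in>M. Suc r)" using MH(1) Suc.prems(2) by (intro sum.cong) auto
    also have "\<dots> \<le> k * Suc r" using False by (simp del: mult_Suc_right)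
    finally have cU: "card ?U \<le> k * Suc r" .
    have meet: "\<exists>x\<in>?U. x \<in> S" if S: "S \<in> H" for S
    proof (rule ccontr)
      assume no: "\<not> ?thesis"
      then have "insert S M \<in> ?D"
        using MH S by (auto simp: pairwise_insert disjnt_def)
      then have "S \<in> M" using bspec[OF M(2), of "insert S M"] by auto
      moreover have "S \<noteq> {}" using Suc.prems(2)[OF S] by auto
      ultimately show False using no by blast
    qed
    have "\<exists>x\<in>?U. fact r * k ^ r < card {S \<in> H. x \<in> S}"
    proof (rule ccontr)
      assume "\<not> ?thesis"
      then have le: "card {S \<in> H. x \<in> S} \<le> fact r * k ^ r" if "x \<in> ?U" for x using that by force
      have "card H \<le> card (\<Union>x\<in>?U. {S \<in> H. x \<in> S})"
      proof (rule card_mono)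
        show "finite (\<Union>x\<in>?U. {S \<in> H. x \<in> S})"
          by (rule finite_subset[of _ H]) (use Suc.prems(1) in auto)
        show "H \<subseteq> (\<Union>x\<in>?U. {S \<in> H. x \<in> S})" using meet by blast
      qed
      also have "\<dots> \<le> (\<Sum>x\<in>?U. card {S \<in> H. x \<in> S})" by (rule card_UN_le[OF finU])
      also have "\<dots> \<le> (\<Sum>x\<in>?U. fact r * k ^ r)" by (rule sum_mono) (use le in auto)
      also have "\<dots> = card ?U * (fact r * k ^ r)" by simp
      also have "\<dots> \<le> (k * Suc r) * (fact r * k ^ r)" by (rule mult_right_mono[OF cU]) simp
      also have "\<dots> = fact (Suc r) * k ^ Suc r" by (simp add: algebra_simps)
      finally show False using Suc.prems(3) by simp
    qed
    then obtain x where x: "fact r * k ^ r < card {S \<in> H. x \<in> S}" by blast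
    \<comment> \<open>The link of the popular point \<open>x\<close>; putting \<open>x\<close> back
      into its sunflower enlarges the kernel and leaves the petals alone.\<close>
    define G where "G = (\<lambda>S. S - {x}) ` {S \<in> H. x \<in> S}"
    have inj: "inj_on (\<lambda>S. S - {x}) {S \<in> H. x \<in> S}" by (rule inj_onI) auto
    have "\<exists>K. kernel (Suc k) G K"
    proof (rule Suc.IH)
      show "finite G" using Suc.prems(1) by (simp add: G_def)
      show "finite S \<and> card S = r" if "S \<in> G" for S using that Suc.prems(2) by (auto simp: G_def)
      show "fact r * k ^ r < card G" using x card_image[OF inj] by (simp add: G_def)
    qed
    then obtain K where "kernel (Suc k) G K" by blast
    then obtain P where P0: "P \<subseteq> G" "finite P" "card P = Suc k" "\<forall>S\<in>P. K \<subset> S"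
      "\<forall>S\<in>P. \<forall>S'\<in>P. S \<noteq> S' \<longrightarrow> S \<inter> S' = K"
      by (rule kernelE)
    note P = P0(1-3) P0(4,5)[rule_format]
    have G: "x \<notin> S \<and> insert x S \<in> H" if "S \<in> G" for S using that by (auto simp: G_def insert_absorb)
    have "inj_on (insert x) P"
    proof (rule inj_onI)
      fix S S' assume S: "S \<in> P" "S' \<in> P" "insert x S = insert x S'"
      then have "x \<notin> S" "x \<notin> S'" using G P(1) by auto
      with S(3) show "S = S'" by (metis insert_ident)
    qed
    then have "card (insert x ` P) = Suc k" using P(3) by (simp add: card_image)
    moreover have "insert x K \<subset> A" if A: "A \<in> insert x ` P" for A
    proof -
      obtain S where S: "S \<in> P" "A = insert x S" using A by blast
      then have "K \<subset> S" "x \<notin> S" using P(4)[of S] G[of S] P(1) by auto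
      moreover from this have "x \<notin> K" by blast
      ultimately show ?thesis
        unfolding S(2) psubset_eq by (simp add: insert_ident subset_insertI2)
    qed
    moreover have "A \<inter> A' = insert x K"
      if A: "A \<in> insert x ` P" "A' \<in> insert x ` P" "A \<noteq> A'" for A A'
    proof -
      obtain S S' where "S \<in> P" "S' \<in> P" "A = insert x S" "A' = insert x S'" using A by auto
      then show ?thesis using P(5)[of S S'] A(3) by auto
    qed
    moreover have "insert x ` P \<subseteq> H" using P(1) G by blast
    ultimately have "kernel (Suc k) H (insert x K)"
      unfolding kernel_def using P(2)
      by (intro exI[of _ "insert x ` P"] conjI ballI impI) simp_all
    then show ?thesis by blast
  qed
qed

text \<open>Too many such members would contain a sunflower among themselves. Its kernel contains
  \<open>T\<close> and lies properly inside one of them, so that member was covered after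
  all.\<close>

lemma uncovered_card_le:
  assumes V: "finite V" and H: "intersecting_system V r L H" and r: "r > 0"
  shows "card {S \<in> H. T \<subseteq> S \<and> \<not> (\<exists>K. kernel (Suc r) H K \<and> T \<subseteq> K \<and> K \<subset> S)} \<le> fact r * r ^ r"
    (is "card ?U \<le> _")
proof (rule ccontr)
  assume "\<not> ?thesis"
  then have "fact r * r ^ r < card ?U" by simp
  moreover have "finite ?U" using finite_system[OF V H] by simp
  moreover have "finite S \<and> card S = r" if "S \<in> ?U" for S
    using that finite_system_member[OF V H] intersecting_systemD(2)[OF H] by blast
  ultimately obtain K where K: "kernel (Suc r) ?U K" using sunflower_lemma[of ?U r r] by blast
  have "T \<subseteq> K" by (rule kernel_superset[OF K]) (use r in auto)
  moreover have "kernel (Suc r) H K" using kernel_mono[OF K] by blast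
  moreover obtain S where "S \<in> ?U" "K \<subset> S" using kernel_petal_avoiding[OF K, of "{}"] by auto
  ultimately show False by blast
qed

text \<open>Applied with the singletons and with the pairs of points as \<open>\<T>\<close>: for
  fixed \<open>r\<close>, all but \<open>O(card \<T>)\<close> members are covered.\<close>

definition covered :: "nat \<Rightarrow> 'a set set \<Rightarrow> 'a set set \<Rightarrow> 'a set \<Rightarrow> bool" where
  "covered r H \<T> S \<longleftrightarrow> (\<forall>T\<in>\<T>. T \<subseteq> S \<longrightarrow> (\<exists>K. kernel (Suc r) H K \<and> T \<subseteq> K \<and> K \<subset> S))"

lemma not_covered_card_le:
  assumes V: "finite V" and H: "intersecting_system V r L H" and r: "r > 0" and \<T>: "finite \<T>"
  shows "card {S \<in> H. \<not> covered r H \<T> S} \<le> card \<T> * (fact r * r ^ r)"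
proof -
  let ?U = "\<lambda>T. {S \<in> H. T \<subseteq> S \<and> \<not> (\<exists>K. kernel (Suc r) H K \<and> T \<subseteq> K \<and> K \<subset> S)}"
  have "card {S \<in> H. \<not> covered r H \<T> S} \<le> card (\<Union>T\<in>\<T>. ?U T)"
    using finite_system[OF V H] \<T> by (intro card_mono) (auto simp: covered_def)
  also have "\<dots> \<le> (\<Sum>T\<in>\<T>. card (?U T))" by (rule card_UN_le[OF \<T>])
  also have "\<dots> \<le> (\<Sum>T\<in>\<T>. fact r * r ^ r)" by (intro sum_mono uncovered_card_le[OF V H r])
  finally show ?thesis by simp
qed

lemma ex_covered:
  assumes "finite V" "intersecting_system V r L H" "r > 0" "finite \<T>"
    and "card \<T> * (fact r * r ^ r) < card H"
  shows "\<exists>S\<in>H. covered r H \<T> S"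
proof (rule ccontr)
  assume "\<not> ?thesis"
  then have "{S \<in> H. \<not> covered r H \<T> S} = H" by auto
  then show False using not_covered_card_le[OF assms(1-4)] assms(5) by simp
qed

text \<open>Every member meets a fixed member in at least \<open>l\<close> points.\<close>
lemma card_le_by_cores:
  fixes B :: real
  assumes V: "finite V" and H: "intersecting_system V r L H" and l: "\<And>x. x \<in> L \<Longrightarrow> l \<le> x" "l \<le> r"
    and B: "B \<ge> 0"
      "\<And>D H'. \<lbrakk>D \<subseteq> V; card D = l; H' \<subseteq> H; \<And>S. S \<in> H' \<Longrightarrow> D \<subseteq> S\<rbrakk> \<Longrightarrow> card H' \<le> B"
  shows "card H \<le> 2 ^ r * B"
proof (cases "H = {}")
  case True
  then show ?thesis using B(1) by simp
next
  case False
  then obtain S0 where S0: "S0 \<in> H" by blast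
  have fin: "finite S0" "card S0 = r" "S0 \<subseteq> V"
    using finite_system_member[OF V H S0] intersecting_systemD[OF H] S0 by auto
  let ?Ds = "{D \<in> Pow S0. card D = l}"
  have "\<exists>D\<in>?Ds. D \<subseteq> S" if "S \<in> H" for S
  proof -
    have "l \<le> card (S \<inter> S0)"
      using intersecting_systemD(3)[OF H that S0] l fin by (cases "S = S0") auto
    then obtain D where "D \<subseteq> S \<inter> S0" "card D = l" by (meson obtain_subset_with_card_n)
    then show ?thesis by blast
  qed
  then have "H \<subseteq> (\<Union>D\<in>?Ds. {S \<in> H. D \<subseteq> S})" by blast
  then have "card H \<le> card (\<Union>D\<in>?Ds. {S \<in> H. D \<subseteq> S})"
    using finite_system[OF V H] fin(1) by (intro card_mono) auto
  also have "\<dots> \<le> (\<Sum>D\<in>?Ds. card {S \<in> H. D \<subseteq> S})" using fin(1) by (intro card_UN_le) simp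
  finally have "real (card H) \<le> (\<Sum>D\<in>?Ds. real (card {S \<in> H. D \<subseteq> S}))"
    by (simp flip: of_nat_sum)
  also have "\<dots> \<le> (\<Sum>D\<in>?Ds. B)" 
  proof (rule sum_mono)
    fix D assume "D \<in> ?Ds"
    then show "real (card {S \<in> H. D \<subseteq> S}) \<le> B"
      by (intro B(2)[of D]) (use fin(3) in auto)
  qed
  also have "\<dots> = card ?Ds * B" by simp
  also have "\<dots> \<le> 2 ^ r * B"
  proof (rule mult_right_mono[OF _ B(1)])
    have "card ?Ds \<le> card (Pow S0)" using fin(1) by (intro card_mono) auto
    then have "card ?Ds \<le> 2 ^ r" using fin by (simp add: card_Pow)
    then show "real (card ?Ds) \<le> 2 ^ r" by (simp flip: of_nat_le_iff)
  qed
  finally show ?thesis .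
qed

section \<open>Shortening the sequence of intersection sizes at either end\<close>

text \<open>Members that contain a common \<open>l\<close>-set \<open>D\<close> and share a further
  point \<open>x\<close> meet in more than \<open>l\<close> points. There are at most
  \<open>card V\<close> choices for \<open>x\<close>, and \<open>D\<close> may be taken among the
  subsets of one member.\<close>

lemma remove_bottom:
  fixes B :: real
  assumes V: "finite V" and H: "intersecting_system V r L H" and l: "\<And>x. x \<in> L \<Longrightarrow> l \<le> x" "l < r"
    and B: "B \<ge> 0" "\<And>H'. H' \<subseteq> H \<Longrightarrow> intersecting_system V r (L - {l}) H' \<Longrightarrow> card H' \<le> B"
  shows "card H \<le> 2 ^ r * (card V * B)"
proof -
  have core: "card H' \<le> card V * B"
    if D: "D \<subseteq> V" "card D = l" and H': "H' \<subseteq> H" "\<And>S. S \<in> H' \<Longrightarrow> D \<subseteq> S" for D H'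
  proof -
  let ?G = "\<lambda>x. {S \<in> H'. x \<in> S}"
  have finD: "finite D" using D V finite_subset by blast
  have finH': "finite H'" using finite_system[OF V H] H'(1) finite_subset by blast
  have "H' \<subseteq> (\<Union>x\<in>V - D. ?G x)"
  proof
    fix S assume S: "S \<in> H'"
    have "S \<in> H" using S H'(1) by blast
    then have "card S = r" "S \<subseteq> V"
      using intersecting_systemD(1,2)[OF H, of S] by auto
    then have "\<not> S \<subseteq> D" using card_mono[OF finD, of S] D(2) l(2) by auto
    then show "S \<in> (\<Union>x\<in>V - D. ?G x)" using S \<open>S \<subseteq> V\<close> by blast
  qed
  then have "card H' \<le> card (\<Union>x\<in>V - D. ?G x)" using V finH' by (intro card_mono) auto
  also have "\<dots> \<le> (\<Sum>x\<in>V - D. card (?G x))" using V by (intro card_UN_le) simp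
  finally have "real (card H') \<le> (\<Sum>x\<in>V - D. real (card (?G x)))"
    by (simp flip: of_nat_sum)
  also have "\<dots> \<le> (\<Sum>x\<in>V - D. B)"
  proof (rule sum_mono)
    fix x assume x: "x \<in> V - D"
    have "card (S \<inter> S') \<in> L - {l}" if S: "S \<in> ?G x" "S' \<in> ?G x" "S \<noteq> S'" for S S'
    proof -
      have "finite (S \<inter> S')" using finite_system_member[OF V H] S H'(1) by blast
      then have "card (insert x D) \<le> card (S \<inter> S')" using S H'(2) by (intro card_mono) auto
      then have "l < card (S \<inter> S')" using finD D(2) x by simp
      then show ?thesis using intersecting_systemD(3)[OF H, of S S'] S H'(1) by auto
    qed
    then have "intersecting_system V r (L - {l}) (?G x)"
      using H'(1) intersecting_systemD(1,2)[OF H] unfolding intersecting_system_def by blast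
    then show "real (card (?G x)) \<le> B" using B(2)[of "?G x"] H'(1) by blast
  qed
  also have "\<dots> = card (V - D) * B" by simp
  also have "\<dots> \<le> card V * B" using V B(1) by (intro mult_right_mono) (auto intro: card_mono)
  finally show ?thesis .
  qed
  have "0 \<le> card V * B" using B(1) by simp
  from card_le_by_cores[OF V H l(1) less_imp_le[OF l(2)] this core] show ?thesis by simp
qed

lemma remove_bottoms:
  fixes B :: real
  assumes V: "finite V" and mono: "strict_mono_on {i..j} a" and lt: "a j < r" and t: "i + t \<le> j"
    and H: "intersecting_system V r (a ` {i..j}) H"
    and B: "B \<ge> 0" "\<And>H'. H' \<subseteq> H \<Longrightarrow> intersecting_system V r (a ` {i + t..j}) H' \<Longrightarrow> card H' \<le> B"
  shows "card H \<le> (2 ^ r * real (card V)) ^ t * B"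
  using t B
proof (induction t arbitrary: B)
  case 0
  then show ?case using H by simp
next
  case (Suc t)
  have "card H \<le> (2 ^ r * real (card V)) ^ t * (2 ^ r * (card V * B))"
  proof (rule Suc.IH)
    fix H' assume H': "H' \<subseteq> H" "intersecting_system V r (a ` {i + t..j}) H'"
    have am: "a x < a y" if "i \<le> x" "x < y" "y \<le> j" for x y
      using strict_mono_onD[OF mono] that by auto
    show "card H' \<le> 2 ^ r * (card V * B)"
    proof (rule remove_bottom[OF V H'(2), of "a (i + t)"])
      show "a (i + t) \<le> x" if x: "x \<in> a ` {i + t..j}" for x
      proof -
        obtain y where y: "x = a y" "i + t \<le> y" "y \<le> j" using x by auto
        then show ?thesis using am[of "i + t" y] by (cases "y = i + t") auto
      qed
      show "a (i + t) < r" using am[of "i + t" j] lt Suc.prems(1) by simp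
      fix H'' assume H'': "H'' \<subseteq> H'" "intersecting_system V r (a ` {i + t..j} - {a (i + t)}) H''"
      have "a ` {i + t..j} - {a (i + t)} \<subseteq> a ` {i + Suc t..j}"
      proof
        fix x assume "x \<in> a ` {i + t..j} - {a (i + t)}"
        then obtain y where y: "x = a y" "i + t \<le> y" "y \<le> j" "y \<noteq> i + t"
          by fastforce
        then show "x \<in> a ` {i + Suc t..j}" by auto
      qed
      from Suc.prems(3)[OF _ intersecting_system_mono[OF H''(2) this]]
      show "card H'' \<le> B" using H'(1) H''(1) by simp
    qed (rule Suc.prems(2))
  qed (use Suc.prems(1,2) in auto)
  then show ?case by (simp add: algebra_simps)
qed

text \<open>The kernels of size \<open>a j\<close> form a uniform system whose intersection sizes
  are \<open>a i, ..., a (j - 1)\<close>, and each of them lies in at most \<open>card V\<close>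
  members. The members without such a kernel are handled by removing all sizes below
  \<open>a j\<close>.\<close>

lemma remove_top:
  fixes B :: real
  assumes V: "finite V" and mono: "strict_mono_on {i..j} a" and ij: "i \<le> j" and lt: "a j < r"
    and H: "intersecting_system V r (a ` {i..j}) H"
    and B: "B \<ge> 0" "\<And>\<K>. intersecting_system V (a j) (a ` {i..<j}) \<K> \<Longrightarrow> card \<K> \<le> B"
  shows "card H \<le> B * card V + (2 ^ r * real (card V)) ^ (j - i) * (2 ^ r * real r)"
proof -
  have amax: "x \<le> a j" if x: "x \<in> a ` {i..j}" for x
  proof -
    obtain y where y: "x = a y" "i \<le> y" "y \<le> j" using x by auto
    then show ?thesis using strict_mono_onD[OF mono, of y j] by (cases "y = j") auto
  qed
  have finH: "finite H" by (rule finite_system[OF V H])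
  define \<K> where "\<K> = {K. kernel (Suc r) H K \<and> card K = a j}"
  have \<K>V: "\<K> \<subseteq> Pow V"
  proof
    fix K assume "K \<in> \<K>"
    then obtain S where "S \<in> H" "K \<subset> S"
      using kernel_petal_avoiding[of "Suc r" H K "{}"] by (auto simp: \<K>_def)
    then show "K \<in> Pow V" using intersecting_systemD(1)[OF H] by blast
  qed
  then have fin\<K>: "finite \<K>" using V by (meson finite_Pow_iff finite_subset)
  have "card (K \<inter> K') \<in> a ` {i..<j}" if K: "K \<in> \<K>" "K' \<in> \<K>" "K \<noteq> K'" for K K'
  proof -
    have fin: "finite K" "finite K'" using K \<K>V V finite_subset by blast+
    have "card (K \<inter> K') \<in> a ` {i..j}"
      using kernel_inter[OF V H, of "Suc r" K K'] K by (auto simp: \<K>_def)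
    moreover have "card (K \<inter> K') \<noteq> a j"
    proof
      assume "card (K \<inter> K') = a j"
      moreover have "card K = a j" "card K' = a j" using K by (simp_all add: \<K>_def)
      ultimately have "K \<inter> K' = K" "K \<inter> K' = K'"
        by (intro card_subset_eq fin; simp)+
      then show False using K(3) by simp
    qed
    ultimately obtain y where y: "card (K \<inter> K') = a y" "i \<le> y" "y \<le> j" "y \<noteq> j" by fastforce
    then show ?thesis by auto
  qed
  then have "intersecting_system V (a j) (a ` {i..<j}) \<K>"
    using \<K>V unfolding intersecting_system_def by (auto simp: \<K>_def)
  then have c\<K>: "card \<K> \<le> B" by (rule B(2))
  \<comment> \<open>Two members containing \<open>K\<close> meet in at most \<open>a j\<close>
    points, hence exactly in \<open>K\<close>; so one point outside \<open>K\<close> determines the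
    member.\<close>
  have fib: "card {S \<in> H. K \<subseteq> S} \<le> card V" if K: "K \<in> \<K>" for K
  proof -
    have "K \<subseteq> V" using K \<K>V by blast
    then have cK: "finite K" "card K = a j" using K finite_subset[OF _ V] by (simp_all add: \<K>_def)
    have "\<forall>S\<in>{S \<in> H. K \<subseteq> S}. \<exists>x. x \<in> S - K"
    proof safe
      fix S assume S: "S \<in> H" "K \<subseteq> S"
      have "S \<noteq> K" using intersecting_systemD(2)[OF H S(1)] cK lt by auto
      then show "\<exists>x. x \<in> S - K" using S(2) by blast
    qed
    then obtain e where "\<forall>S\<in>{S \<in> H. K \<subseteq> S}. e S \<in> S - K" by (elim bchoice[THEN exE])
    then have e: "e S \<in> S - K" if "S \<in> H" "K \<subseteq> S" for S using that by simp
    have "inj_on e {S \<in> H. K \<subseteq> S}"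
    proof (rule inj_onI)
      fix S S' assume S: "S \<in> {S \<in> H. K \<subseteq> S}" "S' \<in> {S \<in> H. K \<subseteq> S}" "e S = e S'"
      show "S = S'"
      proof (rule ccontr)
        assume ne: "S \<noteq> S'"
        have "finite (S \<inter> S')" using finite_system_member[OF V H] S by blast
        then have "card (insert (e S) K) \<le> card (S \<inter> S')"
          using S e[of S] e[of S'] by (intro card_mono) auto
        then have "a j < card (S \<inter> S')" using cK e[of S] S by simp
        moreover have "card (S \<inter> S') \<le> a j"
          using amax[OF intersecting_systemD(3)[OF H, of S S']] S ne by simp
        ultimately show False by simp
      qed
    qed
    then show ?thesis
    proof (rule card_inj_on_le[OF _ _ V])
      show "e ` {S \<in> H. K \<subseteq> S} \<subseteq> V"
      proof
        fix x assume "x \<in> e ` {S \<in> H. K \<subseteq> S}"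
        then obtain S where "S \<in> H" "K \<subseteq> S" "x = e S" by blast
        then show "x \<in> V" using e[of S] intersecting_systemD(1)[OF H, of S] by blast
      qed
    qed
  qed
  define H\<^sub>0 where "H\<^sub>0 = {S \<in> H. \<not> (\<exists>K\<in>\<K>. K \<subseteq> S)}"
  have H\<^sub>0: "intersecting_system V r (a ` {i..j}) H\<^sub>0"
    by (rule intersecting_system_subset[OF H]) (simp add: H\<^sub>0_def)
  \<comment> \<open>When only the size \<open>a j\<close> is left, the members through a common set
    of \<open>a j\<close> points form a sunflower. With more than \<open>r\<close> of them that set
    would belong to \<open>\<K>\<close>, contrary to the choice of \<open>H\<^sub>0\<close>.\<close>
  have c0: "card H\<^sub>0 \<le> (2 ^ r * real (card V)) ^ (j - i) * (2 ^ r * real r)"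
  proof (rule remove_bottoms[OF V mono lt _ H\<^sub>0])
    fix H' assume H': "H' \<subseteq> H\<^sub>0" "intersecting_system V r (a ` {i + (j - i)..j}) H'"
    have H'': "intersecting_system V r {a j} H'" using H'(2) ij by simp
    show "card H' \<le> 2 ^ r * real r"
    proof (rule card_le_by_cores[OF V H'', of "a j"])
      fix D G assume D: "D \<subseteq> V" "card D = a j" and G: "G \<subseteq> H'" "\<And>S. S \<in> G \<Longrightarrow> D \<subseteq> S"
      have "card G \<le> r"
      proof (rule ccontr)
        assume "\<not> card G \<le> r"
        then obtain P where P: "P \<subseteq> G" "card P = Suc r"
          using obtain_subset_with_card_n[of "Suc r" G] by auto
        have "finite P" using P(2) card.infinite by fastforce
        moreover have "D \<subset> S" if "S \<in> P" for S
        proof -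
          have "S \<in> H'" "D \<subseteq> S" using that P(1) G by auto
          moreover from this have "D \<noteq> S" using D(2) lt intersecting_systemD(2)[OF H'', of S] by auto
          ultimately show ?thesis by blast
        qed
        moreover have "S \<inter> S' = D" if S: "S \<in> P" "S' \<in> P" "S \<noteq> S'" for S S'
        proof -
          have SH: "S \<in> H'" "S' \<in> H'" using S P(1) G(1) by auto
          have "card (S \<inter> S') = card D" using intersecting_systemD(3)[OF H'' SH S(3)] D(2) by simp
          moreover have "finite (S \<inter> S')" using finite_system_member[OF V H'' SH(1)] by simp
          moreover have "D \<subseteq> S \<inter> S'" using G(2) S P(1) by blast
          ultimately show ?thesis by (metis card_subset_eq)
        qed
        moreover have "P \<subseteq> H" using P(1) G(1) H'(1) by (auto simp: H\<^sub>0_def)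
        ultimately have "kernel (Suc r) H D"
          unfolding kernel_def using P(2) by (intro exI[of _ P] conjI ballI impI) simp_all
        then have "D \<in> \<K>" using D(2) by (simp add: \<K>_def)
        moreover obtain S where "S \<in> P" using P(2) by (metis card.empty ex_in_conv nat.distinct(1))
        moreover from this have "S \<in> H\<^sub>0" "D \<subseteq> S" using P(1) G(1) G(2)[of S] H'(1) by auto
        ultimately show False by (auto simp: H\<^sub>0_def)
      qed
      then show "real (card G) \<le> real r" by simp
    qed (use lt in auto)
  qed (use ij in auto)
  have "H \<subseteq> H\<^sub>0 \<union> (\<Union>K\<in>\<K>. {S \<in> H. K \<subseteq> S})" by (auto simp: H\<^sub>0_def)
  then have "card H \<le> card (H\<^sub>0 \<union> (\<Union>K\<in>\<K>. {S \<in> H. K \<subseteq> S}))"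
    using finH fin\<K> by (intro card_mono) (auto simp: H\<^sub>0_def)
  also have "\<dots> \<le> card H\<^sub>0 + card (\<Union>K\<in>\<K>. {S \<in> H. K \<subseteq> S})" by (rule card_Un_le)
  also have "card (\<Union>K\<in>\<K>. {S \<in> H. K \<subseteq> S}) \<le> (\<Sum>K\<in>\<K>. card {S \<in> H. K \<subseteq> S})"
    by (rule card_UN_le[OF fin\<K>])
  also have "\<dots> \<le> (\<Sum>K\<in>\<K>. card V)" by (rule sum_mono) (rule fib)
  finally have "card H \<le> card H\<^sub>0 + card \<K> * card V" by simp
  then have "real (card H) \<le> card H\<^sub>0 + real (card \<K>) * card V" by (simp flip: of_nat_add of_nat_mult)
  also have "\<dots> \<le> (2 ^ r * real (card V)) ^ (j - i) * (2 ^ r * real r) + B * card V"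
    by (intro add_mono c0 mult_right_mono c\<K>) simp
  finally show ?thesis by simp
qed

section \<open>Systems with few members\<close>

definition power_bounded :: "'v itself \<Rightarrow> nat \<Rightarrow> nat set \<Rightarrow> nat \<Rightarrow> bool" where
  "power_bounded (_ :: 'v itself) r L e \<longleftrightarrow> (\<exists>C\<ge>0. \<forall>(V :: 'v set) H. finite V \<longrightarrow>
     intersecting_system V r L H \<longrightarrow> real (card H) \<le> C * real (card V) ^ e)"

lemma power_boundedI:
  assumes "C \<ge> 0" "\<And>(V :: 'v set) H. finite V \<Longrightarrow> intersecting_system V r L H \<Longrightarrow>
    real (card H) \<le> C * real (card V) ^ e"
  shows "power_bounded TYPE('v) r L e"
  using assms unfolding power_bounded_def by (intro exI[of _ C] conjI allI impI) simp_all

lemma power_boundedE: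
  assumes "power_bounded TYPE('v) r L e"
  obtains C where "C \<ge> 0" "\<forall>(V :: 'v set) H. finite V \<longrightarrow> intersecting_system V r L H \<longrightarrow>
    real (card H) \<le> C * real (card V) ^ e"
  using assms unfolding power_bounded_def by (elim exE conjE)

lemma power_bounded_add_top:
  assumes mono: "strict_mono_on {i..Suc (Suc k)} a" and ik: "i \<le> k"
    and bd: "power_bounded TYPE('v) (a (Suc k)) (a ` {i..k}) (k - i)"
  shows "power_bounded TYPE('v) (a (Suc (Suc k))) (a ` {i..Suc k}) (Suc k - i)"
proof -
  obtain C where C: "C \<ge> 0" "\<forall>(V :: 'v set) H. finite V \<longrightarrow>
     intersecting_system V (a (Suc k)) (a ` {i..k}) H \<longrightarrow> real (card H) \<le> C * real (card V) ^ (k - i)"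
    using bd by (rule power_boundedE)
  let ?r = "a (Suc (Suc k))"
  let ?C = "C + (2 ^ ?r) ^ (Suc k - i) * (2 ^ ?r * real ?r)"
  show ?thesis
  proof (rule power_boundedI)
    show "?C \<ge> 0" using C(1) by simp
    fix V :: "'v set" and H
    assume V: "finite V" and H: "intersecting_system V ?r (a ` {i..Suc k}) H"
    have mono': "strict_mono_on {i..Suc k} a"
      using mono by (rule monotone_on_subset) simp
    have lt: "a (Suc k) < ?r" using strict_mono_onD[OF mono, of "Suc k" "Suc (Suc k)"] ik by simp
    have "real (card H) \<le> C * real (card V) ^ (k - i) * card V
        + (2 ^ ?r * real (card V)) ^ (Suc k - i) * (2 ^ ?r * real ?r)"
    proof (rule remove_top[OF V mono' _ lt H])
      fix \<K> assume "intersecting_system V (a (Suc k)) (a ` {i..<Suc k}) \<K>"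
      then show "real (card \<K>) \<le> C * real (card V) ^ (k - i)"
        using C(2) V by (simp add: atLeastLessThanSuc_atLeastAtMost)
    qed (use ik C(1) in simp_all)
    also have "\<dots> = ?C * real (card V) ^ (Suc k - i)"
      using ik by (simp add: Suc_diff_le power_mult_distrib distrib_right)
    finally show "real (card H) \<le> ?C * real (card V) ^ (Suc k - i)" .
  qed
qed

lemma power_bounded_add_bottom:
  assumes mono: "strict_mono_on {1..Suc s} a" and i: "1 \<le> i" "i \<le> s"
    and bd: "power_bounded TYPE('v) (a (Suc s)) (a ` {i..s}) (s - i)"
  shows "power_bounded TYPE('v) (a (Suc s)) (a ` {1..s}) (s - 1)"
proof -
  let ?r = "a (Suc s)"
  obtain C where C: "C \<ge> 0" "\<forall>(V :: 'v set) H. finite V \<longrightarrow>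
     intersecting_system V ?r (a ` {i..s}) H \<longrightarrow> real (card H) \<le> C * real (card V) ^ (s - i)"
    using bd by (rule power_boundedE)
  let ?C = "(2 ^ ?r) ^ (i - 1) * C"
  show ?thesis
  proof (rule power_boundedI)
    show "?C \<ge> 0" using C(1) by simp
    fix V :: "'v set" and H
    assume V: "finite V" and H: "intersecting_system V ?r (a ` {1..s}) H"
    have mono': "strict_mono_on {1..s} a" using mono by (rule monotone_on_subset) simp
    have lt: "a s < ?r" using strict_mono_onD[OF mono, of s "Suc s"] i by simp
    have "real (card H) \<le> (2 ^ ?r * real (card V)) ^ (i - 1) * (C * real (card V) ^ (s - i))"
      by (rule remove_bottoms[OF V mono' lt _ H]) (use i C V in simp_all)
    also have "\<dots> = ?C * (real (card V) ^ (i - 1) * real (card V) ^ (s - i))"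
      by (simp add: power_mult_distrib)
    also have "real (card V) ^ (i - 1) * real (card V) ^ (s - i) = real (card V) ^ (s - 1)"
      using i by (simp flip: power_add)
    finally show "real (card H) \<le> ?C * real (card V) ^ (s - 1)" .
  qed
qed

text \<open>The run has \<open>j - i + 1\<close> intersection sizes, so its bound saves one factor.
  The terms above it are added first, changing the uniformity up to \<open>a (Suc s)\<close>, then
  those below it. Each term raises the exponent by one, so the saving survives.\<close>

lemma power_bounded_interval:
  assumes mono: "strict_mono_on {1..Suc s} a" and ij: "1 \<le> i" "i \<le> j" "j \<le> s"
    and bd: "power_bounded TYPE('v) (a (Suc j)) (a ` {i..j}) (j - i)"
  shows "power_bounded TYPE('v) (a (Suc s)) (a ` {1..s}) (s - 1)"
proof -
  have "power_bounded TYPE('v) (a (Suc s)) (a ` {i..s}) (s - i)"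
    using ij(3)
  proof (induction rule: dec_induct)
    case base
    then show ?case by (rule bd)
  next
    case (step k)
    have "strict_mono_on {i..Suc (Suc k)} a"
      using mono by (rule monotone_on_subset) (use ij step in auto)
    then show ?case by (rule power_bounded_add_top) (use ij step in simp_all)
  qed
  from power_bounded_add_bottom[OF mono ij(1) _ this] show ?thesis using ij by simp
qed

section \<open>Systems with a common core and their blocks\<close>

locale cored_system =
  fixes V :: "'v set" and r :: nat and L :: "nat set" and H :: "'v set set" and D :: "'v set"
  assumes finite_V: "finite V" and system: "intersecting_system V r L H"
    and r_pos: "r > 0" and D_sub: "S \<in> H \<Longrightarrow> D \<subseteq> S"
begin

lemma kernelD:
  assumes "kernel (Suc r) H K"
  shows "K \<subseteq> V" "finite K" "D \<subseteq> K" "card K \<in> L"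
proof -
  obtain S where S: "S \<in> H" "K \<subset> S"
    using kernel_petal_avoiding[OF assms, of "{}"] by auto
  then show "K \<subseteq> V" using intersecting_systemD(1)[OF system S(1)] by blast
  then show "finite K" using finite_V finite_subset by blast
  show "D \<subseteq> K" by (rule kernel_superset[OF assms]) (use r_pos D_sub in simp_all)
  show "card K \<in> L" using kernel_inter[OF finite_V system assms assms] by simp
qed

lemma kernel_Int:
  assumes "kernel (Suc r) H K" "kernel (Suc r) H K'"
  shows "card (K \<inter> K') \<in> L" "D \<subseteq> K \<inter> K'" "K \<noteq> K' \<Longrightarrow> card K = card K' \<Longrightarrow> card (K \<inter> K') < card K"
proof -
  show "card (K \<inter> K') \<in> L" using kernel_inter[OF finite_V system assms] by simp
  show "D \<subseteq> K \<inter> K'" using kernelD(3)[OF assms(1)] kernelD(3)[OF assms(2)] by simp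
  assume "K \<noteq> K'" "card K = card K'"
  then have "\<not> K \<subseteq> K'" using card_subset_eq[OF kernelD(2)[OF assms(2)], of K] by auto
  then show "card (K \<inter> K') < card K" by (intro psubset_card_mono kernelD(2)[OF assms(1)]) auto
qed

end

locale block_system = cored_system V r "{l\<^sub>1, l\<^sub>2}" H D
  for V :: "'v set" and r l\<^sub>1 l\<^sub>2 :: nat and H D +
  assumes l12: "l\<^sub>1 < l\<^sub>2" and card_D: "card D = l\<^sub>1"
begin

definition blocks :: "'v set set" where
  "blocks = {K - D |K. kernel (Suc r) H K \<and> card K = l\<^sub>2}"

lemma blockE:
  assumes "B \<in> blocks"
  obtains K where "kernel (Suc r) H K" "card K = l\<^sub>2" "B = K - D" "K = D \<union> B"
proof -
  obtain K where K: "kernel (Suc r) H K" "card K = l\<^sub>2" "B = K - D"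
    using assms by (auto simp: blocks_def)
  moreover have "K = D \<union> B" using K(3) kernelD(3)[OF K(1)] by blast
  ultimately show thesis by (rule that)
qed

lemma blockD:
  assumes "B \<in> blocks"
  shows "B \<subseteq> V" "finite B" "card B = l\<^sub>2 - l\<^sub>1" "B \<inter> D = {}" "B \<noteq> {}"
proof -
  obtain K where K: "kernel (Suc r) H K" "card K = l\<^sub>2" "B = K - D" using assms by (rule blockE)
  show "B \<subseteq> V" "finite B" "B \<inter> D = {}" using K kernelD(1,2)[OF K(1)] by auto
  have "finite D" using kernelD(2,3)[OF K(1)] finite_subset by blast
  then show c: "card B = l\<^sub>2 - l\<^sub>1"
    using K kernelD(3)[OF K(1)] card_D by (simp add: card_Diff_subset)
  show "B \<noteq> {}" using c l12 by auto
qed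

text \<open>Distinct kernels of size \<open>l\<^sub>2\<close> meet in fewer than
  \<open>l\<^sub>2\<close> points, hence in exactly \<open>l\<^sub>1\<close> points, which are those
  of \<open>D\<close>.\<close>

lemma blocks_disjoint:
  assumes "B \<in> blocks" "B' \<in> blocks" "B \<noteq> B'"
  shows "B \<inter> B' = {}"
proof -
  obtain K where K: "kernel (Suc r) H K" "card K = l\<^sub>2" "B = K - D" using assms(1) by (rule blockE)
  obtain K' where K': "kernel (Suc r) H K'" "card K' = l\<^sub>2" "B' = K' - D" using assms(2) by (rule blockE)
  have "K \<noteq> K'" using assms(3) K(3) K'(3) by auto
  then have "card (K \<inter> K') = card D"
    using kernel_Int[OF K(1) K'(1)] K(2) K'(2) card_D by simp
  moreover have "finite (K \<inter> K')" using kernelD(2)[OF K(1)] by simp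
  ultimately have "D = K \<inter> K'" using kernel_Int(2)[OF K(1) K'(1)] by (metis card_subset_eq)
  then show ?thesis using K(3) K'(3) by blast
qed

lemma finite_blocks: "finite blocks"
  by (rule finite_subset[of _ "Pow V"]) (use blockD(1) finite_V in auto)

lemma card_blocks_le: "card blocks \<le> card V"
proof -
  have "card blocks = (\<Sum>B\<in>blocks. 1)" by simp
  also have "\<dots> \<le> (\<Sum>B\<in>blocks. card B)"
  proof (rule sum_mono)
    fix B assume "B \<in> blocks"
    then show "1 \<le> card B" using blockD(3)[of B] l12 by simp
  qed
  also have "\<dots> = card (\<Union> blocks)"
    by (rule card_Union_disjoint[symmetric])
       (simp_all add: pairwise_def disjnt_def blocks_disjoint blockD(2))
  also have "\<dots> \<le> card V"
    by (rule card_mono[OF finite_V]) (use blockD(1) in blast)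
  finally show ?thesis .
qed

text \<open>A kernel through a point outside \<open>D\<close> properly contains \<open>D\<close>, so
  its size is \<open>l\<^sub>2\<close> and it yields a block.\<close>

lemma blocks_cover:
  assumes S: "S \<in> H" and cov: "covered r H ((\<lambda>x. {x}) ` V) S"
  shows "S - D = \<Union> {B \<in> blocks. B \<subseteq> S}"
proof
  show "\<Union> {B \<in> blocks. B \<subseteq> S} \<subseteq> S - D" using blockD(4) by blast
  show "S - D \<subseteq> \<Union> {B \<in> blocks. B \<subseteq> S}"
  proof
    fix x assume x: "x \<in> S - D"
    then have "{x} \<in> (\<lambda>x. {x}) ` V" "{x} \<subseteq> S" using intersecting_systemD(1)[OF system S] by auto
    then obtain K where K: "kernel (Suc r) H K" "{x} \<subseteq> K" "K \<subset> S"
      using cov unfolding covered_def by meson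
    have "D \<subset> K" using kernelD(3)[OF K(1)] K(2) x by auto
    then have "card D < card K" by (rule psubset_card_mono[OF kernelD(2)[OF K(1)]])
    then have "card K = l\<^sub>2" using kernelD(4)[OF K(1)] card_D by simp
    then have "K - D \<in> blocks" using K(1) by (auto simp: blocks_def)
    then show "x \<in> \<Union> {B \<in> blocks. B \<subseteq> S}" using K x by auto
  qed
qed

lemma card_blocks_in:
  assumes S: "S \<in> H" and cov: "covered r H ((\<lambda>x. {x}) ` V) S"
  shows "(l\<^sub>2 - l\<^sub>1) * card {B \<in> blocks. B \<subseteq> S} = r - l\<^sub>1"
proof -
  have "finite D" using D_sub[OF S] finite_system_member[OF finite_V system S] finite_subset by blast
  then have "r - l\<^sub>1 = card (S - D)"
    using D_sub[OF S] card_D intersecting_systemD(2)[OF system S] by (simp add: card_Diff_subset)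
  also have "\<dots> = card (\<Union> {B \<in> blocks. B \<subseteq> S})" by (simp only: blocks_cover[OF assms])
  also have "\<dots> = (\<Sum>B\<in>{B \<in> blocks. B \<subseteq> S}. card B)"
    by (rule card_Union_disjoint) (simp_all add: pairwise_def disjnt_def blocks_disjoint blockD(2))
  also have "\<dots> = (\<Sum>B\<in>{B \<in> blocks. B \<subseteq> S}. l\<^sub>2 - l\<^sub>1)" by (rule sum.cong) (simp_all add: blockD(3))
  finally show ?thesis by (simp add: mult.commute)
qed

end

text \<open>Beyond the bound some member through a core \<open>D\<close> has all its points covered.
  It consists of \<open>D\<close> and disjoint blocks of size \<open>l\<^sub>2 - l\<^sub>1\<close>,
  so this difference divides \<open>r - l\<^sub>1\<close> and hence
  \<open>r - l\<^sub>2\<close>.\<close>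

lemma power_bounded_not_dvd:
  assumes l: "l\<^sub>1 < l\<^sub>2" "l\<^sub>2 < r" and ndvd: "\<not> (l\<^sub>2 - l\<^sub>1) dvd (r - l\<^sub>2)"
  shows "power_bounded TYPE('v) r {l\<^sub>1, l\<^sub>2} 1"
proof (rule power_boundedI)
  let ?\<phi> = "fact r * real r ^ r"
  show "0 \<le> 2 ^ r * ?\<phi>" by simp
  fix V :: "'v set" and H
  assume V: "finite V" and H: "intersecting_system V r {l\<^sub>1, l\<^sub>2} H"
  have core: "real (card H') \<le> ?\<phi> * card V"
    if D: "D \<subseteq> V" "card D = l\<^sub>1" and H': "H' \<subseteq> H" "\<And>S. S \<in> H' \<Longrightarrow> D \<subseteq> S" for D H'
  proof (rule ccontr)
    have sys: "intersecting_system V r {l\<^sub>1, l\<^sub>2} H'" by (rule intersecting_system_subset[OF H H'(1)])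
    assume "\<not> ?thesis"
    then have "real (card V * (fact r * r ^ r)) < real (card H')" by (simp add: mult.commute)
    then have "card V * (fact r * r ^ r) < card H'" by (simp only: of_nat_less_iff)
    moreover have "card ((\<lambda>x. {x}) ` V) = card V" by (intro card_image) simp
    ultimately obtain S where S: "S \<in> H'" "covered r H' ((\<lambda>x. {x}) ` V) S"
      using ex_covered[OF V sys, of "(\<lambda>x. {x}) ` V"] V l by auto
    interpret block_system V r l\<^sub>1 l\<^sub>2 H' D
      by unfold_locales (use V sys l D H' in simp_all)
    have "(l\<^sub>2 - l\<^sub>1) dvd (r - l\<^sub>1)" using card_blocks_in[OF S] by (metis dvd_triv_left)
    moreover have "r - l\<^sub>1 = (r - l\<^sub>2) + (l\<^sub>2 - l\<^sub>1)" using l by simp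
    ultimately show False using ndvd by simp
  qed
  have "real (card H) \<le> 2 ^ r * (?\<phi> * card V)"
  proof (rule card_le_by_cores[OF V H _ _ _ core])
    show "l\<^sub>1 \<le> x" if "x \<in> {l\<^sub>1, l\<^sub>2}" for x using that l by auto
  qed (use l in simp_all)
  then show "real (card H) \<le> 2 ^ r * ?\<phi> * real (card V) ^ 1" by simp
qed

text \<open>
  The kernels of size \<open>l\<^sub>3\<close> have pairwise disjoint complements in \<open>S\<close>. Covering suitable pairs
  yields three of them, but \<open>3 * (r - l\<^sub>3) > r - l\<^sub>1\<close>.
\<close>
lemma (in cored_system) not_all_pairs_covered:
  assumes L: "L = {l\<^sub>1, l\<^sub>2, l\<^sub>3}" and l: "l\<^sub>1 < l\<^sub>2" "l\<^sub>2 < l\<^sub>3" "l\<^sub>3 < r"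
    and d: "r - l\<^sub>3 = l\<^sub>3 - l\<^sub>2" "l\<^sub>2 - l\<^sub>1 < l\<^sub>3 - l\<^sub>2" and card_D: "card D = l\<^sub>1"
    and S: "S \<in> H" and cov: "covered r H ((\<lambda>(x, y). {x, y}) ` (V \<times> V)) S"
  shows False
proof -
  have SV: "S \<subseteq> V" "card S = r" "finite S"
    using intersecting_systemD(1,2)[OF system S] finite_system_member[OF finite_V system S] by auto
  have ex: "\<exists>K. kernel (Suc r) H K \<and> x \<in> K \<and> y \<in> K \<and> K \<subset> S" if xy: "x \<in> S" "y \<in> S" for x y
  proof -
    have "{x, y} \<in> (\<lambda>(x, y). {x, y}) ` (V \<times> V)" "{x, y} \<subseteq> S" using xy SV(1) by auto
    then obtain K where "kernel (Suc r) H K" "{x, y} \<subseteq> K" "K \<subset> S"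
      using cov unfolding covered_def by meson
    then show ?thesis by blast
  qed
  have gt: "l\<^sub>1 < card A" if "D \<subseteq> A" "x \<in> A" "x \<notin> D" "finite A" for A x
  proof -
    have "D \<subset> A" using that by blast
    then show ?thesis using psubset_card_mono[OF that(4)] card_D by blast
  qed
  \<comment> \<open>Otherwise \<open>K\<close> would have size \<open>l\<^sub>2\<close> and meet
    \<open>K'\<close> in more than \<open>l\<^sub>1\<close> but fewer than \<open>l\<^sub>2\<close>
    points.\<close>
  have big: "card K = l\<^sub>3"
    if K: "kernel (Suc r) H K" "x \<in> K" "x \<notin> K'" "y \<in> K" "y \<in> K'" "y \<notin> D"
      and K': "kernel (Suc r) H K'" "K' \<noteq> K" for K K' x y
  proof (rule ccontr)
    assume "card K \<noteq> l\<^sub>3"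
    moreover have "l\<^sub>1 < card K" using gt[of K y] kernelD(2,3)[OF K(1)] K by simp
    ultimately have "card K = l\<^sub>2" using kernelD(4)[OF K(1)] L by auto
    moreover have "K \<inter> K' \<subset> K" using K(2,3) by blast
    then have "card (K \<inter> K') < card K" by (rule psubset_card_mono[OF kernelD(2)[OF K(1)]])
    moreover have "l\<^sub>1 < card (K \<inter> K')"
      using gt[of "K \<inter> K'" y] kernel_Int(2)[OF K(1) K'(1)] kernelD(2)[OF K(1)] K by simp
    ultimately show False using kernel_Int(1)[OF K(1) K'(1)] L l by auto
  qed
  \<comment> \<open>The union of the two kernels has at least
    \<open>2 * l\<^sub>3 - l\<^sub>2 = r\<close> points and therefore fills
    \<open>S\<close>.\<close>
  have disj: "(S - K) \<inter> (S - K') = {}"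
    if K: "kernel (Suc r) H K" "card K = l\<^sub>3" "K \<subset> S" "kernel (Suc r) H K'" "card K' = l\<^sub>3" "K' \<subset> S"
      "K \<noteq> K'" for K K'
  proof -
    have fin: "finite K" "finite K'" using kernelD(2) K by auto
    have "card (K \<inter> K') < l\<^sub>3" using kernel_Int(3)[OF K(1) K(4) K(7)] K by simp
    then have "card (K \<inter> K') \<le> l\<^sub>2" using kernel_Int(1)[OF K(1) K(4)] L l by auto
    moreover have "card K + card K' = card (K \<union> K') + card (K \<inter> K')" by (rule card_Un_Int[OF fin])
    ultimately have "r \<le> card (K \<union> K')" using K(2,5) d(1) l by linarith
    moreover have "K \<union> K' \<subseteq> S" using K by blast
    ultimately have "K \<union> K' = S" using card_seteq[OF SV(3), of "K \<union> K'"] SV(2) by simp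
    then show ?thesis by blast
  qed
  have finD: "finite D" and DS: "D \<subseteq> S" using D_sub[OF S] SV(3) finite_subset by auto
  have cS: "card (S - K) = r - l\<^sub>3" if "card K = l\<^sub>3" "K \<subset> S" for K
    using that SV card_Diff_subset[of K S] finite_subset[of K S] by auto
  \<comment> \<open>Take a kernel through a point \<open>x\<close> outside \<open>D\<close> and join
    \<open>x\<close> to a point missing from that kernel; \<open>big\<close> applies to the new
    one.\<close>
  have exl3: "\<exists>K. kernel (Suc r) H K \<and> card K = l\<^sub>3 \<and> K \<subset> S"
  proof -
    have "card D < card S" using card_D SV(2) l by simp
    then obtain x where x: "x \<in> S" "x \<notin> D" using card_mono[OF finD, of S] by (meson not_less subsetI)
    obtain K where K: "kernel (Suc r) H K" "x \<in> K" "K \<subset> S" using ex[OF x(1) x(1)] by blast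
    obtain y where y: "y \<in> S" "y \<notin> K" using K(3) by blast
    obtain K' where K': "kernel (Suc r) H K'" "y \<in> K'" "x \<in> K'" "K' \<subset> S" using ex[OF y(1) x(1)] by blast
    have "card K' = l\<^sub>3" by (rule big[OF K'(1,2) y(2) K'(3) K(2) x(2) K(1)]) (use y K' in blast)
    then show ?thesis using K' by blast
  qed
  then obtain K1 where K1: "kernel (Suc r) H K1" "card K1 = l\<^sub>3" "K1 \<subset> S" by blast
  obtain x where x: "x \<in> S" "x \<notin> K1" using K1(3) by blast
  have "D \<noteq> K1" using card_D K1(2) l by auto
  then obtain y where y: "y \<in> K1" "y \<notin> D" using kernelD(3)[OF K1(1)] by blast
  have "y \<in> S" using y K1(3) by blast
  then obtain K2 where K2: "kernel (Suc r) H K2" "x \<in> K2" "y \<in> K2" "K2 \<subset> S" using ex[OF x(1)] by blast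
  have ne12: "K1 \<noteq> K2" using x K2 by blast
  have c2: "card K2 = l\<^sub>3" by (rule big[OF K2(1,2) x(2) K2(3) y K1(1) ne12])
  \<comment> \<open>The complements of \<open>K1\<close> and \<open>K2\<close> are disjoint, so
    \<open>z\<close> lies in \<open>K1\<close>. A kernel through \<open>x\<close> and
    \<open>z\<close> differs from both and again has size \<open>l\<^sub>3\<close>.\<close>
  obtain z where z: "z \<in> S" "z \<notin> K2" using K2(4) by blast
  have d12: "(S - K1) \<inter> (S - K2) = {}" by (rule disj[OF K1 K2(1) c2 K2(4) ne12])
  have zK1: "z \<in> K1" "z \<notin> D" using d12 z kernelD(3)[OF K2(1)] by blast+
  obtain K3 where K3: "kernel (Suc r) H K3" "x \<in> K3" "z \<in> K3" "K3 \<subset> S" using ex[OF x(1) z(1)] by blast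
  have ne: "K1 \<noteq> K3" "K2 \<noteq> K3" using x z K3 by blast+
  have c3: "card K3 = l\<^sub>3" by (rule big[OF K3(1,2) x(2) K3(3) zK1 K1(1) ne(1)])
  have d13: "(S - K1) \<inter> (S - K3) = {}" by (rule disj[OF K1 K3(1) c3 K3(4) ne(1)])
  have d23: "(S - K2) \<inter> (S - K3) = {}" by (rule disj[OF K2(1) c2 K2(4) K3(1) c3 K3(4) ne(2)])
  have "card ((S - K1) \<union> (S - K2) \<union> (S - K3)) = card ((S - K1) \<union> (S - K2)) + card (S - K3)"
    by (rule card_Un_disjoint) (use SV(3) d13 d23 in auto)
  also have "card ((S - K1) \<union> (S - K2)) = card (S - K1) + card (S - K2)"
    by (rule card_Un_disjoint) (use SV(3) d12 in auto)
  finally have "card ((S - K1) \<union> (S - K2) \<union> (S - K3)) = 3 * (r - l\<^sub>3)"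
    using cS[OF K1(2,3)] cS[OF c2 K2(4)] cS[OF c3 K3(4)] by simp
  moreover have "(S - K1) \<union> (S - K2) \<union> (S - K3) \<subseteq> S - D"
    using kernelD(3)[OF K1(1)] kernelD(3)[OF K2(1)] kernelD(3)[OF K3(1)] by blast
  then have "card ((S - K1) \<union> (S - K2) \<union> (S - K3)) \<le> card (S - D)"
    using SV(3) by (intro card_mono) auto
  moreover have "card (S - D) = r - l\<^sub>1" using card_Diff_subset[OF finD DS] SV(2) card_D by simp
  ultimately have "3 * (r - l\<^sub>3) \<le> r - l\<^sub>1" by simp
  \<comment> \<open>Here \<open>r - l\<^sub>1 = 2 * (r - l\<^sub>3) + (l\<^sub>2 -
    l\<^sub>1)\<close>, and the last summand is less than \<open>r - l\<^sub>3\<close>.\<close>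
  then show False using d l by linarith
qed

text \<open>The exponent 2 comes from the number of pairs of points: beyond the bound, some member
  through a core has all its pairs covered.\<close>

lemma power_bounded_repeated_difference:
  assumes l: "l\<^sub>1 < l\<^sub>2" "l\<^sub>2 < l\<^sub>3" "l\<^sub>3 < r" and d: "r - l\<^sub>3 = l\<^sub>3 - l\<^sub>2" "l\<^sub>2 - l\<^sub>1 < l\<^sub>3 - l\<^sub>2"
  shows "power_bounded TYPE('v) r {l\<^sub>1, l\<^sub>2, l\<^sub>3} 2"
proof (rule power_boundedI)
  let ?\<phi> = "fact r * real r ^ r"
  show "0 \<le> 2 ^ r * ?\<phi>" by simp
  fix V :: "'v set" and H
  assume V: "finite V" and H: "intersecting_system V r {l\<^sub>1, l\<^sub>2, l\<^sub>3} H"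
  let ?T = "(\<lambda>(x, y). {x, y}) ` (V \<times> V)"
  have "card ?T \<le> card (V \<times> V)" using V by (intro card_image_le) simp
  then have cT: "card ?T \<le> (card V)\<^sup>2" by (simp add: card_cartesian_product power2_eq_square)
  have core: "real (card H') \<le> ?\<phi> * (real (card V))\<^sup>2"
    if D: "D \<subseteq> V" "card D = l\<^sub>1" and H': "H' \<subseteq> H" "\<And>S. S \<in> H' \<Longrightarrow> D \<subseteq> S" for D H'
  proof (rule ccontr)
    have sys: "intersecting_system V r {l\<^sub>1, l\<^sub>2, l\<^sub>3} H'" by (rule intersecting_system_subset[OF H H'(1)])
    assume "\<not> ?thesis"
    then have "real ((card V)\<^sup>2 * (fact r * r ^ r)) < real (card H')" by (simp add: mult.commute)
    then have "(card V)\<^sup>2 * (fact r * r ^ r) < card H'" by (simp only: of_nat_less_iff)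
    then have "card ?T * (fact r * r ^ r) < card H'"
      by (rule le_less_trans[OF mult_right_mono[OF cT], rotated]) simp
    then obtain S where S: "S \<in> H'" "covered r H' ?T S"
      using ex_covered[OF V sys, of ?T] V l by auto
    interpret cored_system V r "{l\<^sub>1, l\<^sub>2, l\<^sub>3}" H' D
      by unfold_locales (use V sys l D H' in simp_all)
    show False by (rule not_all_pairs_covered[OF refl l d D(2) S])
  qed
  have "real (card H) \<le> 2 ^ r * (?\<phi> * (real (card V))\<^sup>2)"
  proof (rule card_le_by_cores[OF V H _ _ _ core])
    show "l\<^sub>1 \<le> x" if "x \<in> {l\<^sub>1, l\<^sub>2, l\<^sub>3}" for x using that l by auto
  qed (use l in simp_all)
  then show "real (card H) \<le> 2 ^ r * ?\<phi> * (real (card V))\<^sup>2" by simp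
qed

text \<open>If the last difference is not a multiple of the one before, the last three terms form
  the run. If the two are equal, look at the last place \<open>j\<close> where the difference
  changes: when \<open>d j\<close> does not divide \<open>d (Suc j)\<close> three terms suffice,
  otherwise \<open>d j < d (Suc j)\<close> and four terms serve.\<close>

lemma power_bounded_not_arith_prog:
  assumes mono: "strict_mono_on {1..Suc s} a" and s: "2 \<le> s" and nap: "\<not> arith_prog a (Suc s)"
    and last: "a (Suc s) - a s = a s - a (s - 1) \<or> \<not> (a s - a (s - 1)) dvd (a (Suc s) - a s)"
  shows "power_bounded TYPE('v) (a (Suc s)) (a ` {1..s}) (s - 1)"
proof -
  have lt: "a i < a (Suc i)" if "1 \<le> i" "i \<le> s" for i
    using strict_mono_onD[OF mono, of i "Suc i"] that by simp
  have nd: ?thesis if i: "1 \<le> i" "Suc i \<le> s" and n: "\<not> (a (Suc i) - a i) dvd (a (Suc (Suc i)) - a (Suc i))" for i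
  proof (rule power_bounded_interval[OF mono i(1) _ i(2)])
    have "power_bounded TYPE('v) (a (Suc (Suc i))) {a i, a (Suc i)} 1"
      by (rule power_bounded_not_dvd) (use lt[of i] lt[of "Suc i"] i n in simp_all)
    moreover have "{i..Suc i} = {i, Suc i}" by auto
    ultimately show "power_bounded TYPE('v) (a (Suc (Suc i))) (a ` {i..Suc i}) (Suc i - i)" by simp
  qed simp
  show ?thesis
  proof (cases "a (Suc s) - a s = a s - a (s - 1)")
    case False
    then have "\<not> (a s - a (s - 1)) dvd (a (Suc s) - a s)" using last by blast
    then show ?thesis using nd[of "s - 1"] s by simp
  next
    case True
    define d where "d i = a (Suc i) - a i" for i
    define J where "J = {i \<in> {1..<s}. d i \<noteq> d (Suc i)}"
    have "J \<noteq> {}"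
    proof
      assume "J = {}"
      then have eq: "d i = d (Suc i)" if "1 \<le> i" "i < s" for i using that by (auto simp: J_def)
      have ds: "d i = d s" if "1 \<le> i" "i \<le> s" for i
        using that(2,1) by (induction rule: inc_induct) (simp_all add: eq)
      have "int (a (Suc i)) - int (a i) = int (d s)" if "i \<in> {1..<Suc s}" for i
        using lt[of i] ds[of i] that by (auto simp: d_def)
      then have "arith_prog a (Suc s)" unfolding arith_prog_def by blast
      with nap show False by blast
    qed
    moreover have finJ: "finite J" by (simp add: J_def)
    ultimately have MJ: "Max J \<in> J" by simp
    define j where "j = Max J"
    have j: "1 \<le> j" "j < s" "d j \<noteq> d (Suc j)" using MJ by (auto simp: J_def j_def)
    \<comment> \<open>The last two differences agree, so the last change occurs earlier and is
      followed by two equal differences.\<close>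
    have "d (s - 1) = d s" using True s by (simp add: d_def)
    then have "j \<noteq> s - 1" using j s by auto
    then have j2: "Suc (Suc j) \<le> s" using j(2) by simp
    have "Suc j \<notin> J" using Max_ge[OF finJ, of "Suc j"] by (auto simp: j_def)
    then have dd: "d (Suc j) = d (Suc (Suc j))" using j2 by (auto simp: J_def)
    show ?thesis
    proof (cases "d j dvd d (Suc j)")
      case False
      then show ?thesis using nd[of j] j j2 by (simp add: d_def)
    next
      case True
      have "d (Suc j) > 0" using lt[of "Suc j"] j by (simp add: d_def)
      then have less: "d j < d (Suc j)" using dvd_imp_le[OF True] j(3) by simp
      have "power_bounded TYPE('v) (a (Suc (Suc (Suc j)))) {a j, a (Suc j), a (Suc (Suc j))} 2"
        by (rule power_bounded_repeated_difference)
           (use lt[of j] lt[of "Suc j"] lt[of "Suc (Suc j)"] j j2 less dd in \<open>simp_all add: d_def\<close>)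
      moreover have "{j..Suc (Suc j)} = {j, Suc j, Suc (Suc j)}" by auto
      ultimately have "power_bounded TYPE('v) (a (Suc (Suc (Suc j)))) (a ` {j..Suc (Suc j)})
          (Suc (Suc j) - j)" by (simp add: numeral_2_eq_2)
      then show ?thesis by (rule power_bounded_interval[OF mono j(1) _ j2, rotated]) simp
    qed
  qed
qed

section \<open>Copies of a fixed graph\<close>

text \<open>Embeddings, unlike subgraphs, can be glued from pieces. They arise by inverting the
  isomorphism from a copy onto \<open>F\<close>; conversely the image of \<open>F\<close> is a
  copy.\<close>

lemma span_family_iff_embedding:
  fixes G :: "'a ugraph" and F :: "'b ugraph"
  assumes F: "simple_graph F" "card (verts F) = r" and G: "simple_graph G"
  shows "S \<in> span_family r G F \<longleftrightarrow> S \<subseteq> verts G \<and>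
    (\<exists>\<phi>. bij_betw \<phi> (verts F) S \<and> (\<forall>e\<in>edges F. \<phi> ` e \<in> edges G))"
proof
  have finF: "finite (verts F)" and Fe: "\<And>e. e \<in> edges F \<Longrightarrow> e \<subseteq> verts F \<and> card e = 2"
    using F(1) by (auto simp: simple_graph_def)
  {
    assume "S \<in> span_family r G F"
    then obtain H where S: "S \<subseteq> verts G" "card S = r" and H: "H \<in> copies (induced G S) F"
      by (auto simp: span_family_def)
    have finS: "finite S" using S G finite_subset by (auto simp: simple_graph_def)
    have H': "simple_graph H" "verts H \<subseteq> S" "edges H \<subseteq> edges G" and iso: "graph_iso H F"
      using H by (auto simp: copies_def subgraph_def induced_def)
    obtain f where f: "bij_betw f (verts H) (verts F)" "edges F = (\<lambda>e. f ` e) ` edges H"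
      using iso by (auto simp: graph_iso_def)
    have "verts H = S"
      using card_subset_eq[OF finS H'(2)] bij_betw_same_card[OF f(1)] F(2) S(2) by simp
    then have "bij_betw (inv_into (verts H) f) (verts F) S" using bij_betw_inv_into[OF f(1)] by simp
    moreover have "inv_into (verts H) f ` e \<in> edges G" if e: "e \<in> edges F" for e
    proof -
      obtain e' where e': "e' \<in> edges H" "e = f ` e'" using e f(2) by blast
      then have "e' \<subseteq> verts H" using H'(1) by (auto simp: simple_graph_def)
      then have "inv_into (verts H) f ` e = e'"
        unfolding e'(2) by (rule inv_into_image_cancel[OF bij_betw_imp_inj_on[OF f(1)]])
      then show ?thesis using e'(1) H'(3) by auto
    qed
    ultimately show "S \<subseteq> verts G \<and>
        (\<exists>\<phi>. bij_betw \<phi> (verts F) S \<and> (\<forall>e\<in>edges F. \<phi> ` e \<in> edges G))"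
      using S(1) by (intro conjI exI[of _ "inv_into (verts H) f"] ballI) simp_all
  }
  {
    assume "S \<subseteq> verts G \<and> (\<exists>\<phi>. bij_betw \<phi> (verts F) S \<and> (\<forall>e\<in>edges F. \<phi> ` e \<in> edges G))"
    then obtain \<phi> where S: "S \<subseteq> verts G" and \<phi>: "bij_betw \<phi> (verts F) S"
      and e\<phi>: "\<And>e. e \<in> edges F \<Longrightarrow> \<phi> ` e \<in> edges G" by auto
    have inj: "inj_on \<phi> (verts F)" and im: "\<phi> ` verts F = S"
      using \<phi> by (auto simp: bij_betw_def)
    let ?H = "(S, (\<lambda>e. \<phi> ` e) ` edges F)"
    have edge: "\<phi> ` e \<subseteq> S \<and> card (\<phi> ` e) = 2" if e: "e \<in> edges F" for e
    proof -
      have "e \<subseteq> verts F" "card e = 2" using Fe[OF e] by auto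
      then show ?thesis using im card_image[OF inj_on_subset[OF inj]] by auto
    qed
    have "finite S" using finF im by auto
    then have sub: "subgraph ?H (induced G S)"
      using edge e\<phi> by (auto simp: subgraph_def simple_graph_def induced_def)
    have "inv_into (verts F) \<phi> ` \<phi> ` e = e" if "e \<in> edges F" for e
      using Fe[OF that] by (intro inv_into_image_cancel[OF inj]) simp
    then have "edges F = (\<lambda>e. inv_into (verts F) \<phi> ` e) ` edges ?H"
      by (simp add: image_image)
    then have "graph_iso ?H F"
      unfolding graph_iso_def using bij_betw_inv_into[OF \<phi>]
      by (intro exI[of _ "inv_into (verts F) \<phi>"]) simp
    then have "?H \<in> copies (induced G S) F" using sub by (simp add: copies_def)
    moreover have "card S = r" using bij_betw_same_card[OF \<phi>] F(2) by simp
    ultimately show "S \<in> span_family r G F" using S unfolding span_family_def by blast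
  }
qed

text \<open>A copy is determined by its vertex set, which is in the span family, and by its edge
  set, which is one of \<open>2 ^ (2 ^ r)\<close> sets of subsets.\<close>

lemma num_copies_le:
  fixes G :: "'a ugraph" and F :: "'b ugraph"
  assumes F: "card (verts F) = r" and G: "simple_graph G"
  shows "num_copies G F \<le> card (span_family r G F) * 2 ^ (2 ^ r)"
proof -
  have finG: "finite (verts G)" using G by (simp add: simple_graph_def)
  have fin: "finite (span_family r G F)"
    by (rule finite_subset[of _ "Pow (verts G)"]) (use finG in \<open>auto simp: span_family_def\<close>)
  have S: "finite S \<and> card S = r" if "S \<in> span_family r G F" for S
    using that finite_subset[OF _ finG, of S] by (simp add: span_family_def)
  have sub: "copies G F \<subseteq> (SIGMA S:span_family r G F. Pow (Pow S))"
  proof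
    fix H assume "H \<in> copies G F"
    then have H: "simple_graph H" "verts H \<subseteq> verts G" "edges H \<subseteq> edges G" and iso: "graph_iso H F"
      by (auto simp: copies_def subgraph_def)
    have e: "e \<subseteq> verts H" if "e \<in> edges H" for e using that H(1) by (auto simp: simple_graph_def)
    have "card (verts H) = r" using iso F by (auto simp: graph_iso_def dest: bij_betw_same_card)
    moreover have "H \<in> copies (induced G (verts H)) F"
      using H e iso by (auto simp: copies_def subgraph_def induced_def)
    ultimately have "verts H \<in> span_family r G F" using H(2) by (auto simp: span_family_def)
    moreover have "edges H \<in> Pow (Pow (verts H))" using e by blast
    ultimately show "H \<in> (SIGMA S:span_family r G F. Pow (Pow S))" by (metis SigmaI prod.collapse)
  qed
  have "num_copies G F \<le> card (SIGMA S:span_family r G F. Pow (Pow S))"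
    unfolding num_copies_def by (rule card_mono[OF _ sub]) (use fin S in auto)
  also have "\<dots> = (\<Sum>S\<in>span_family r G F. card (Pow (Pow S)))"
    by (rule card_SigmaI) (use fin S in auto)
  also have "\<dots> = (\<Sum>S\<in>span_family r G F. 2 ^ (2 ^ r))"
    by (rule sum.cong) (use S in \<open>auto simp: card_Pow\<close>)
  finally show ?thesis by simp
qed

lemma span_family_system:
  "span_intersecting r G F L \<Longrightarrow> intersecting_system (verts G) r L (span_family r G F)"
  unfolding intersecting_system_def span_intersecting_def by (auto simp: span_family_def)

text \<open>
  The type \<open>t\<close> of an embedding sends a vertex of \<open>F\<close> to its image if that lies in the common core,
  and to the index of its block otherwise.
\<close>
lemma spurious_copy:
  fixes G :: "'a ugraph" and F :: "'b ugraph" and \<phi> :: "'a set \<Rightarrow> 'b \<Rightarrow> 'a" and t :: "'b \<Rightarrow> 'a + nat"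
    and x :: "nat \<Rightarrow> 'b \<Rightarrow> 'a"
  defines "P \<equiv> \<lambda>i. {v \<in> verts F. t v = Inr i}" and "P\<^sub>0 \<equiv> {v \<in> verts F. \<exists>y. t v = Inl y}"
  assumes F: "simple_graph F" "card (verts F) = r" and G: "simple_graph G"
    and int: "span_intersecting r G F L" and L: "\<And>k. k \<in> L \<Longrightarrow> k < l + 2 * d" and m: "m \<ge> 2"
    and emb: "\<And>S. S \<in> \<S> \<Longrightarrow> S \<subseteq> verts G" "\<And>S. S \<in> \<S> \<Longrightarrow> bij_betw (\<phi> S) (verts F) S"
      "\<And>S e. S \<in> \<S> \<Longrightarrow> e \<in> edges F \<Longrightarrow> \<phi> S ` e \<in> edges G"
    and t: "\<And>S v y. S \<in> \<S> \<Longrightarrow> v \<in> verts F \<Longrightarrow> t v = Inl y \<Longrightarrow> \<phi> S v = y"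
      "\<And>v i. v \<in> verts F \<Longrightarrow> t v = Inr i \<Longrightarrow> i < m"
    and card: "card P\<^sub>0 = l" "\<And>i. i < m \<Longrightarrow> card (P i) = d"
    and x: "\<And>i j. i < m \<Longrightarrow> j < m \<Longrightarrow> i \<noteq> j \<Longrightarrow>
      \<exists>S\<in>\<S>. (\<forall>v\<in>P i. \<phi> S v = x i v) \<and> (\<forall>v\<in>P j. \<phi> S v = x j v)"
  shows "\<exists>S\<in>\<S>. \<forall>i<m. \<forall>v\<in>P i. \<phi> S v = x i v"
proof -
  \<comment> \<open>The glued map: the core as prescribed by the type, block \<open>i\<close> as
    prescribed by \<open>x i\<close>.\<close>
  define \<psi> where "\<psi> v = (case t v of Inl y \<Rightarrow> y | Inr i \<Rightarrow> x i v)" for v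
  have finF: "finite (verts F)" and Fe: "\<And>e. e \<in> edges F \<Longrightarrow> e \<subseteq> verts F \<and> card e = 2"
    using F(1) by (auto simp: simple_graph_def)
  have agree: "\<psi> v = \<phi> S v"
    if "S \<in> \<S>" "\<forall>v\<in>P i. \<phi> S v = x i v" "\<forall>v\<in>P j. \<phi> S v = x j v" "v \<in> P\<^sub>0 \<union> P i \<union> P j" for S i j v
    using that t(1)[of S v] by (auto simp: \<psi>_def P_def P\<^sub>0_def)
  \<comment> \<open>Two vertices involve at most two blocks, on which some member agrees with
    \<open>\<psi>\<close>. Injectivity, the range and the edges of \<open>\<psi>\<close> all concern
    at most two vertices at a time.\<close>
  have two: "\<exists>S\<in>\<S>. \<psi> u = \<phi> S u \<and> \<psi> v = \<phi> S v" if uv: "u \<in> verts F" "v \<in> verts F" for u v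
  proof -
    have ex: "\<exists>i<m. w \<in> P\<^sub>0 \<union> P i" if w: "w \<in> verts F" for w
    proof (cases "t w")
      case (Inl y)
      then have "w \<in> P\<^sub>0 \<union> P 0" using w by (simp add: P\<^sub>0_def)
      then show ?thesis using m by (intro exI[of _ 0]) simp
    next
      case (Inr i)
      then have "w \<in> P\<^sub>0 \<union> P i" using w by (simp add: P_def)
      then show ?thesis using t(2)[OF w Inr] by blast
    qed
    obtain i where i: "i < m" "u \<in> P\<^sub>0 \<union> P i" using ex[OF uv(1)] by blast
    obtain j where j: "j < m" "v \<in> P\<^sub>0 \<union> P j" using ex[OF uv(2)] by blast
    \<comment> \<open>If both vertices lie in the same block, any second index will do.\<close>
    define j' where "j' = (if i = j then (if i = 0 then 1 else 0) else j)"
    have j': "j' < m" "i \<noteq> j'" "v \<in> P\<^sub>0 \<union> P i \<union> P j'" using i j m by (auto simp: j'_def)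
    obtain S where S: "S \<in> \<S>" "\<forall>v\<in>P i. \<phi> S v = x i v" "\<forall>v\<in>P j'. \<phi> S v = x j' v"
      using x[OF i(1) j'(1,2)] by blast
    show ?thesis using agree[OF S, of u] agree[OF S j'(3)] i(2) S(1) by blast
  qed
  have inj: "inj_on \<psi> (verts F)"
  proof (rule inj_onI)
    fix u v assume uv: "u \<in> verts F" "v \<in> verts F" "\<psi> u = \<psi> v"
    obtain S where S: "S \<in> \<S>" "\<psi> u = \<phi> S u" "\<psi> v = \<phi> S v" using two[OF uv(1,2)] by blast
    have "\<phi> S u = \<phi> S v" using uv(3) unfolding S(2,3) .
    from inj_onD[OF bij_betw_imp_inj_on[OF emb(2)[OF S(1)]] this uv(1,2)] show "u = v" .
  qed
  define T where "T = \<psi> ` verts F"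
  have "T \<subseteq> verts G"
  proof
    fix y assume "y \<in> T"
    then obtain v where v: "v \<in> verts F" "y = \<psi> v" by (auto simp: T_def)
    obtain S where S: "S \<in> \<S>" "\<psi> v = \<phi> S v" using two[OF v(1) v(1)] by blast
    then show "y \<in> verts G"
      using bij_betw_apply[OF emb(2)[OF S(1)] v(1)] emb(1)[OF S(1)] v(2) by auto
  qed
  moreover have "bij_betw \<psi> (verts F) T" using inj by (simp add: bij_betw_def T_def)
  moreover have "\<psi> ` e \<in> edges G" if e: "e \<in> edges F" for e
  proof -
    obtain u v where uv: "e = {u, v}" using Fe[OF e] by (auto simp: card_2_iff)
    then have "u \<in> verts F" "v \<in> verts F" using Fe[OF e] by auto
    then obtain S where S: "S \<in> \<S>" "\<psi> u = \<phi> S u" "\<psi> v = \<phi> S v" using two by blast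
    then have "\<psi> ` e = \<phi> S ` e" using uv by simp
    then show ?thesis using emb(3)[OF S(1) e] by simp
  qed
  ultimately have T: "T \<in> span_family r G F"
    unfolding span_family_iff_embedding[OF F G] by (intro conjI exI[of _ \<psi>] ballI) simp_all
  \<comment> \<open>Such an \<open>S\<close> shares the core and two blocks with \<open>T\<close>,
    that is \<open>l + 2 * d\<close> points, more than \<open>L\<close> allows for distinct
    sets.\<close>
  have eq: "S = T"
    if S: "S \<in> \<S>" "\<forall>v\<in>P 0. \<phi> S v = x 0 v" "\<forall>v\<in>P j. \<phi> S v = x j v" and j: "j \<noteq> 0" "j < m" for S j
  proof (rule ccontr)
    assume "S \<noteq> T"
    let ?Q = "P\<^sub>0 \<union> P 0 \<union> P j"
    have QF: "?Q \<subseteq> verts F" by (auto simp: P_def P\<^sub>0_def)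
    have finQ: "finite P\<^sub>0" "finite (P i)" for i using finF by (auto simp: P_def P\<^sub>0_def)
    have "card (P\<^sub>0 \<union> P 0 \<union> P j) = card (P\<^sub>0 \<union> P 0) + card (P j)"
      by (rule card_Un_disjoint) (use finQ j in \<open>auto simp: P_def P\<^sub>0_def\<close>)
    also have "card (P\<^sub>0 \<union> P 0) = card P\<^sub>0 + card (P 0)"
      by (rule card_Un_disjoint) (use finQ in \<open>auto simp: P_def P\<^sub>0_def\<close>)
    finally have "l + 2 * d = card ?Q" using card j m by simp
    also have "\<dots> = card (\<psi> ` ?Q)" using card_image[OF inj_on_subset[OF inj QF]] by simp
    also have "\<dots> \<le> card (S \<inter> T)"
    proof (rule card_mono)
      show "finite (S \<inter> T)" using finF by (simp add: T_def)
      show "\<psi> ` ?Q \<subseteq> S \<inter> T"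
      proof
        fix y assume "y \<in> \<psi> ` ?Q"
        then obtain v where v: "v \<in> ?Q" "y = \<psi> v" by blast
        then have vF: "v \<in> verts F" using QF by blast
        then have "y \<in> T" using v(2) by (simp add: T_def)
        moreover have "y \<in> S"
          using agree[OF S v(1)] bij_betw_apply[OF emb(2)[OF S(1)] vF] v(2) by simp
        ultimately show "y \<in> S \<inter> T" by simp
      qed
    qed
    finally have "l + 2 * d \<le> card (S \<inter> T)" .
    moreover have "S \<in> span_family r G F"
      unfolding span_family_iff_embedding[OF F G] using emb[OF S(1)]
      by (intro conjI exI[of _ "\<phi> S"] ballI) simp_all
    then have "card (S \<inter> T) \<in> L" using int T \<open>S \<noteq> T\<close> by (simp add: span_intersecting_def)
    ultimately show False using L by (meson not_le)
  qed
  \<comment> \<open>The members obtained for the pairs of positions 0 and \<open>i\<close> all equal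
    \<open>T\<close>, so a single embedding agrees with \<open>x\<close> on every block.\<close>
  obtain S where S: "S \<in> \<S>" "\<forall>v\<in>P 0. \<phi> S v = x 0 v" "\<forall>v\<in>P 1. \<phi> S v = x 1 v"
    using x[of 0 1] m by auto
  have ST: "S = T" by (rule eq[OF S]) (use m in auto)
  have "\<forall>v\<in>P i. \<phi> S v = x i v" if i: "i < m" for i
  proof (cases "i = 0")
    case True
    then show ?thesis using S(2) by simp
  next
    case False
    then obtain S' where S': "S' \<in> \<S>" "\<forall>v\<in>P 0. \<phi> S' v = x 0 v" "\<forall>v\<in>P i. \<phi> S' v = x i v"
      using x[of 0 i] i by auto
    have "S' = S" using eq[OF S' False i] ST by simp
    then show ?thesis using S'(3) by simp
  qed
  then show ?thesis using S(1) by blast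
qed

text \<open>
  The vertices of the linear system are embeddings restricted to the positions of one block, tagged
  with the index of the block.
\<close>
lemma typed_family_card_le:
  fixes G :: "'a ugraph" and F :: "'b ugraph" and \<phi> :: "'a set \<Rightarrow> 'b \<Rightarrow> 'a" and t :: "'b \<Rightarrow> 'a + nat"
    and c :: real
  defines "P \<equiv> \<lambda>i. {v \<in> verts F. t v = Inr i}" and "P\<^sub>0 \<equiv> {v \<in> verts F. \<exists>y. t v = Inl y}"
  assumes RS: "forces_spurious_clique TYPE(nat \<times> ('b \<Rightarrow> 'a)) m c n"
    and W: "finite W" "card W \<le> n" "\<And>S i. S \<in> \<S> \<Longrightarrow> i < m \<Longrightarrow> (i, restrict (\<phi> S) (P i)) \<in> W"
  assumes F: "simple_graph F" "card (verts F) = r" and G: "simple_graph G"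
    and int: "span_intersecting r G F L" and L: "\<And>k. k \<in> L \<Longrightarrow> k < l + 2 * d" and m: "m \<ge> 2"
    and emb: "\<And>S. S \<in> \<S> \<Longrightarrow> S \<subseteq> verts G" "\<And>S. S \<in> \<S> \<Longrightarrow> bij_betw (\<phi> S) (verts F) S"
      "\<And>S e. S \<in> \<S> \<Longrightarrow> e \<in> edges F \<Longrightarrow> \<phi> S ` e \<in> edges G"
    and t: "\<And>S v y. S \<in> \<S> \<Longrightarrow> v \<in> verts F \<Longrightarrow> t v = Inl y \<Longrightarrow> \<phi> S v = y"
      "\<And>v i. v \<in> verts F \<Longrightarrow> t v = Inr i \<Longrightarrow> i < m"
    and card: "card P\<^sub>0 = l" "\<And>i. i < m \<Longrightarrow> card (P i) = d"
  shows "card \<S> \<le> c * real n ^ 2"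
proof (rule ccontr)
  assume "\<not> ?thesis"
  then have large: "c * real n ^ 2 \<le> card \<S>" by simp
  have finF: "finite (verts F)" using F(1) by (simp add: simple_graph_def)
  define f where "f S i = (i, restrict (\<phi> S) (P i))" for S i
  have f_eq: "\<phi> S v = \<phi> S' v" if "f S i = f S' i" "v \<in> P i" for S S' i v
  proof -
    have "restrict (\<phi> S) (P i) v = restrict (\<phi> S') (P i) v" using that(1) by (simp add: f_def)
    then show ?thesis using that(2) by simp
  qed
  \<comment> \<open>Linearity: agreement on two blocks, together with the common core, gives
    \<open>l + 2 * d\<close> common points, too many for distinct members.\<close>
  have lin: "S = S'"
    if S: "S \<in> \<S>" "S' \<in> \<S>" and ij: "i < m" "j < m" "i \<noteq> j" and e: "f S i = f S' i" "f S j = f S' j"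
    for S S' i j
  proof (rule ccontr)
    assume ne: "S \<noteq> S'"
    let ?Q = "P\<^sub>0 \<union> P i \<union> P j"
    have QF: "?Q \<subseteq> verts F" by (auto simp: P_def P\<^sub>0_def)
    have finQ: "finite P\<^sub>0" "finite (P i)" for i using finF by (auto simp: P_def P\<^sub>0_def)
    have "card (P\<^sub>0 \<union> P i \<union> P j) = card (P\<^sub>0 \<union> P i) + card (P j)"
      by (rule card_Un_disjoint) (use finQ ij in \<open>auto simp: P_def P\<^sub>0_def\<close>)
    also have "card (P\<^sub>0 \<union> P i) = card P\<^sub>0 + card (P i)"
      by (rule card_Un_disjoint) (use finQ in \<open>auto simp: P_def P\<^sub>0_def\<close>)
    finally have "l + 2 * d = card ?Q" using card ij by simp
    also have "\<dots> = card (\<phi> S ` ?Q)"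
      using card_image[OF inj_on_subset[OF bij_betw_imp_inj_on[OF emb(2)[OF S(1)]] QF]] by simp
    also have "\<dots> \<le> card (S \<inter> S')"
    proof (rule card_mono)
      show "finite (S \<inter> S')"
        using emb(1)[OF S(1)] G by (meson finite_Int finite_subset simple_graph_def)
      show "\<phi> S ` ?Q \<subseteq> S \<inter> S'"
      proof
        fix y assume "y \<in> \<phi> S ` ?Q"
        then obtain v where v: "v \<in> ?Q" "y = \<phi> S v" by blast
        then have vF: "v \<in> verts F" using QF by blast
        have "\<phi> S v = \<phi> S' v"
        proof (cases "v \<in> P\<^sub>0")
          case True
          then obtain z where "t v = Inl z" by (auto simp: P\<^sub>0_def)
          then show ?thesis using t(1)[OF S(1) vF] t(1)[OF S(2) vF] by simp
        next
          case False
          then show ?thesis using v(1) f_eq[OF e(1)] f_eq[OF e(2)] by blast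
        qed
        then show "y \<in> S \<inter> S'"
          using bij_betw_apply[OF emb(2)[OF S(1)] vF] bij_betw_apply[OF emb(2)[OF S(2)] vF] v(2) by simp
      qed
    qed
    finally have "l + 2 * d \<le> card (S \<inter> S')" .
    moreover have "R \<in> span_family r G F" if "R \<in> \<S>" for R
      unfolding span_family_iff_embedding[OF F G] using emb[OF that]
      by (intro conjI exI[of _ "\<phi> R"] ballI) simp_all
    then have "S \<in> span_family r G F" "S' \<in> span_family r G F" using S by simp_all
    then have "card (S \<inter> S') \<in> L" using int ne by (simp add: span_intersecting_def)
    ultimately show False using L by (meson not_le)
  qed
  have "inj_on f \<S>"
  proof (rule inj_onI)
    fix S S' assume S: "S \<in> \<S>" "S' \<in> \<S>" "f S = f S'"
    show "S = S'" by (rule lin[OF S(1,2), of 0 1]) (use m S(3) in auto)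
  qed
  then have cf: "card (f ` \<S>) = card \<S>" by (rule card_image)
  have "\<exists>x. (\<forall>i<m. \<forall>j<m. i \<noteq> j \<longrightarrow> (\<exists>g\<in>f ` \<S>. g i = x i \<and> g j = x j)) \<and>
      \<not> (\<exists>g\<in>f ` \<S>. \<forall>i<m. g i = x i)"
  proof (rule forces_spurious_cliqueD[OF RS W(1,2), of _ fst])
    show "\<forall>g\<in>f ` \<S>. \<forall>i<m. g i \<in> W \<and> fst (g i) = i" using W(3) by (simp add: f_def)
    show "\<forall>g\<in>f ` \<S>. \<forall>h\<in>f ` \<S>. \<forall>i<m. \<forall>j<m. i \<noteq> j \<longrightarrow> g i = h i \<longrightarrow> g j = h j \<longrightarrow> g = h"
      using lin by blast
    show "c * real n ^ 2 \<le> card (f ` \<S>)" using large cf by simp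
  qed
  then obtain x where x: "\<And>i j. i < m \<Longrightarrow> j < m \<Longrightarrow> i \<noteq> j \<Longrightarrow> \<exists>S\<in>\<S>. f S i = x i \<and> f S j = x j"
    and nx: "\<not> (\<exists>S\<in>\<S>. \<forall>i<m. f S i = x i)" by auto
  have fx: "\<phi> S v = snd (x i) v" if "f S i = x i" "v \<in> P i" for S i v
  proof -
    have "snd (x i) v = restrict (\<phi> S) (P i) v" using that(1) by (simp add: f_def flip: that(1))
    then show ?thesis using that(2) by simp
  qed
  have pairs: "\<exists>S\<in>\<S>. (\<forall>v\<in>P i. \<phi> S v = snd (x i) v) \<and> (\<forall>v\<in>P j. \<phi> S v = snd (x j) v)"
    if ij: "i < m" "j < m" "i \<noteq> j" for i j
  proof -
    obtain S where S: "S \<in> \<S>" "f S i = x i" "f S j = x j" using x[OF ij] by blast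
    show ?thesis using S(1) fx[OF S(2)] fx[OF S(3)] by (intro bexI[of _ S] conjI ballI)
  qed
  \<comment> \<open>The glued copy shows that the spurious clique comes from a member after all,
    against \<open>nx\<close>.\<close>
  have "\<exists>S\<in>\<S>. \<forall>i<m. \<forall>v\<in>P i. \<phi> S v = snd (x i) v"
    unfolding P_def
    by (rule spurious_copy[OF F G int L m emb t card[unfolded P_def P\<^sub>0_def] pairs[unfolded P_def]])
  then obtain S where S: "S \<in> \<S>" "\<And>i v. i < m \<Longrightarrow> v \<in> P i \<Longrightarrow> \<phi> S v = snd (x i) v" by blast
  have "f S i = x i" if i: "i < m" for i
  proof -
    define j :: nat where "j = (if i = 0 then 1 else 0)"
    have "j < m" "i \<noteq> j" using m by (auto simp: j_def)
    then obtain S' where S': "f S' i = x i" using x[OF i] by blast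
    then have xi: "x i = (i, restrict (\<phi> S') (P i))" by (simp add: f_def)
    have "restrict (\<phi> S) (P i) = restrict (\<phi> S') (P i)"
      by (rule restrict_ext) (use S(2)[OF i] xi in simp)
    then show ?thesis using xi by (simp add: f_def)
  qed
  then show False using nx S(1) by blast
qed

section \<open>Members that consist of a core and blocks\<close>

lemma finite_bijection:
  assumes "finite A" "card A = m"
  obtains g where "bij_betw g {..<m::nat} A"
  using ex_bij_betw_nat_finite[OF assms(1)] assms(2) by (auto simp: atLeast0LessThan)

text \<open>Fix for each covered member an embedding of \<open>F\<close> and an enumeration of its
  \<open>m\<close> blocks. The members split into at most \<open>(l\<^sub>1 + m) ^ r\<close> types,
  and \<open>typed_family_card_le\<close> bounds each class. The quantity
  \<open>m * (card (verts G) * r ^ r)\<close> bounds the number of vertices of the linear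
  system.\<close>

lemma covered_block_family_card_le:
  fixes G :: "'a ugraph" and F :: "'b ugraph" and c :: real
  assumes F: "simple_graph F" "card (verts F) = r" and l: "l\<^sub>1 < l\<^sub>2" "r = l\<^sub>1 + m * (l\<^sub>2 - l\<^sub>1)"
    and m: "m \<ge> 3"
    and RS: "forces_spurious_clique TYPE(nat \<times> ('b \<Rightarrow> 'a)) m c (m * (card (verts G) * r ^ r))"
    and G: "simple_graph G" and int: "span_intersecting r G F L" and L: "\<And>k. k \<in> L \<Longrightarrow> k \<le> l\<^sub>2"
    and sub: "H \<subseteq> span_family r G F" and sys: "intersecting_system (verts G) r {l\<^sub>1, l\<^sub>2} H"
    and D: "card D = l\<^sub>1" "\<And>S. S \<in> H \<Longrightarrow> D \<subseteq> S" and c: "c \<ge> 0"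
  shows "card {S \<in> H. covered r H ((\<lambda>x. {x}) ` verts G) S}
    \<le> (real l\<^sub>1 + real m) ^ r * (c * real (m * (card (verts G) * r ^ r)) ^ 2)"
proof (cases "{S \<in> H. covered r H ((\<lambda>x. {x}) ` verts G) S} = {}")
  case True
  show ?thesis unfolding True using c by simp
next
  case False
  define H1 where "H1 = {S \<in> H. covered r H ((\<lambda>x. {x}) ` verts G) S}"
  have V: "finite (verts G)" and finF: "finite (verts F)"
    using G F(1) by (simp_all add: simple_graph_def)
  have m_pos: "m * (l\<^sub>2 - l\<^sub>1) > 0" using m l(1) by simp
  interpret block_system "verts G" r l\<^sub>1 l\<^sub>2 H D
    by unfold_locales (use V sys D l m_pos in simp_all)
  define d where "d = l\<^sub>2 - l\<^sub>1"
  have d: "d > 0" using l by (simp add: d_def)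
  have H1H: "S \<in> H" and H1cov: "covered r H ((\<lambda>x. {x}) ` verts G) S" if "S \<in> H1" for S
    using that by (simp_all add: H1_def)
  have finH1: "finite H1" using finite_system[OF V sys] by (simp add: H1_def)
  have "\<exists>\<phi>. bij_betw \<phi> (verts F) S \<and> (\<forall>e\<in>edges F. \<phi> ` e \<in> edges G)" if "S \<in> H1" for S
    using H1H[OF that] sub span_family_iff_embedding[OF F G, of S] by blast
  then obtain \<phi> where \<phi>: "\<And>S. S \<in> H1 \<Longrightarrow> bij_betw (\<phi> S) (verts F) S"
    "\<And>S e. S \<in> H1 \<Longrightarrow> e \<in> edges F \<Longrightarrow> \<phi> S ` e \<in> edges G" by metis
  have "\<exists>\<sigma>. bij_betw \<sigma> {..<m} {B \<in> blocks. B \<subseteq> S}" if "S \<in> H1" for S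
  proof -
    have "(l\<^sub>2 - l\<^sub>1) * card {B \<in> blocks. B \<subseteq> S} = r - l\<^sub>1"
      by (rule card_blocks_in[OF H1H[OF that] H1cov[OF that]])
    then have "card {B \<in> blocks. B \<subseteq> S} = m" using l d by (simp add: d_def)
    then show ?thesis using finite_bijection[of "{B \<in> blocks. B \<subseteq> S}" m] finite_blocks by auto
  qed
  then obtain \<sigma> where \<sigma>: "\<And>S. S \<in> H1 \<Longrightarrow> bij_betw (\<sigma> S) {..<m} {B \<in> blocks. B \<subseteq> S}" by metis
  have \<sigma>B: "\<sigma> S i \<in> blocks" "\<sigma> S i \<subseteq> S" if "S \<in> H1" "i < m" for S i
    using bij_betw_apply[OF \<sigma>[OF that(1)], of i] that(2) by auto
  let ?Q = "\<lambda>S v y. y \<in> Inl ` D \<union> Inr ` {..<m} \<and> (\<forall>a. y = Inl a \<longrightarrow> \<phi> S v = a) \<and>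
      (\<forall>i. y = Inr i \<longrightarrow> \<phi> S v \<in> \<sigma> S i)"
  have ex\<tau>: "\<exists>y. ?Q S v y" if S: "S \<in> H1" and v: "v \<in> verts F" for S v
  proof (cases "\<phi> S v \<in> D")
    case True
    then show ?thesis by (intro exI[of _ "Inl (\<phi> S v)"]) simp
  next
    case False
    then have "\<phi> S v \<in> \<Union> {B \<in> blocks. B \<subseteq> S}"
      using blocks_cover[OF H1H[OF S] H1cov[OF S]] bij_betw_apply[OF \<phi>(1)[OF S] v] by blast
    then obtain B where B: "B \<in> {B \<in> blocks. B \<subseteq> S}" "\<phi> S v \<in> B" by blast
    have "B \<in> \<sigma> S ` {..<m}" using B(1) bij_betw_imp_surj_on[OF \<sigma>[OF S]] by simp
    then obtain i where "i < m" "\<sigma> S i = B" by auto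
    then show ?thesis using B(2) by (intro exI[of _ "Inr i"]) simp
  qed
  define \<tau> where "\<tau> S v = (SOME y. ?Q S v y)" for S v
  have Q\<tau>: "?Q S v (\<tau> S v)" if "S \<in> H1" "v \<in> verts F" for S v
    unfolding \<tau>_def by (rule someI_ex[OF ex\<tau>[OF that]])
  have \<tau>: "\<tau> S v \<in> Inl ` D \<union> Inr ` {..<m}" "\<tau> S v = Inl a \<Longrightarrow> \<phi> S v = a"
    "\<tau> S v = Inr i \<Longrightarrow> \<phi> S v \<in> \<sigma> S i" if "S \<in> H1" "v \<in> verts F" for S v a i
    using Q\<tau>[OF that] by simp_all
  let ?Y = "Inl ` D \<union> Inr ` {..<m} :: ('a + nat) set"
  obtain S0 where S0: "S0 \<in> H1" using False by (auto simp: H1_def)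
  have finD: "finite D"
    using D(2)[OF H1H[OF S0]] finite_system_member[OF V sys H1H[OF S0]] finite_subset by blast
  have finY: "finite ?Y" using finD by simp
  have cY: "card ?Y \<le> l\<^sub>1 + m"
  proof -
    have "card ?Y \<le> card (Inl ` D :: ('a + nat) set) + card (Inr ` {..<m} :: ('a + nat) set)"
      by (rule card_Un_le)
    also have "\<dots> \<le> card D + card {..<m}" by (intro add_mono card_image_le) (use finD in simp_all)
    finally show ?thesis using D(1) by simp
  qed
  define types where "types = PiE (verts F) (\<lambda>_. ?Y)"
  have fin_types: "finite types" using finF finY by (simp add: types_def finite_PiE)
  have c_types: "card types \<le> (l\<^sub>1 + m) ^ r"
    unfolding types_def using F(2) finF cY by (simp add: card_PiE power_mono)
  define ty where "ty S = restrict (\<tau> S) (verts F)" for S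
  have "ty S \<in> types" if "S \<in> H1" for S
    using \<tau>(1)[OF that] by (simp add: ty_def types_def)
  then have "H1 \<subseteq> (\<Union>t\<in>types. {S \<in> H1. ty S = t})" by blast
  then have "card H1 \<le> card (\<Union>t\<in>types. {S \<in> H1. ty S = t})"
    using finH1 fin_types by (intro card_mono) auto
  also have "\<dots> \<le> (\<Sum>t\<in>types. card {S \<in> H1. ty S = t})" by (rule card_UN_le[OF fin_types])
  finally have "real (card H1) \<le> (\<Sum>t\<in>types. real (card {S \<in> H1. ty S = t}))"
    by (simp flip: of_nat_sum)
  also have "\<dots> \<le> (\<Sum>t\<in>types. c * real (m * (card (verts G) * r ^ r)) ^ 2)"
  proof (rule sum_mono)
    fix t assume "t \<in> types"
    define \<S> where "\<S> = {S \<in> H1. ty S = t}"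
    have SH1: "S \<in> H1" and tS: "v \<in> verts F \<Longrightarrow> t v = \<tau> S v" if "S \<in> \<S>" for S v
      using that by (auto simp: \<S>_def ty_def)
    show "real (card {S \<in> H1. ty S = t}) \<le> c * real (m * (card (verts G) * r ^ r)) ^ 2"
    proof (cases "\<S> = {}")
      case True
      then show ?thesis using c by (simp add: \<S>_def[symmetric])
    next
      case False
      then obtain S1 where S1: "S1 \<in> \<S>" by blast
      define P where "P i = {v \<in> verts F. t v = Inr i}" for i
      define P\<^sub>0 where "P\<^sub>0 = {v \<in> verts F. \<exists>y. t v = Inl y}"
      have t1: "\<phi> S v = y" if "S \<in> \<S>" "v \<in> verts F" "t v = Inl y" for S v y
        using \<tau>(2)[OF SH1[OF that(1)] that(2)] tS[OF that(1,2)] that(3) by simp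
      have t3: "\<phi> S v \<in> \<sigma> S i" if "S \<in> \<S>" "v \<in> verts F" "t v = Inr i" for S v i
        using \<tau>(3)[OF SH1[OF that(1)] that(2)] tS[OF that(1,2)] that(3) by simp
      have tY: "t v \<in> ?Y" if "v \<in> verts F" for v
        using \<tau>(1)[OF SH1[OF S1] that] tS[OF S1 that] by simp
      have t2: "i < m" if "v \<in> verts F" "t v = Inr i" for v i
        using tY[OF that(1)] that(2) by auto
      have t4: "y \<in> D" if "v \<in> verts F" "t v = Inl y" for v y
        using tY[OF that(1)] that(2) by auto
      \<comment> \<open>One member \<open>S1\<close> of the class suffices to see that the type
        assigns \<open>d\<close> positions to each block and \<open>l\<^sub>1\<close> to the
        core.\<close>
      have imP: "\<phi> S1 ` P i = \<sigma> S1 i" if i: "i < m" for i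
      proof
        show "\<phi> S1 ` P i \<subseteq> \<sigma> S1 i" using t3[OF S1] by (auto simp: P_def)
        show "\<sigma> S1 i \<subseteq> \<phi> S1 ` P i"
        proof
          fix y assume y: "y \<in> \<sigma> S1 i"
          then have "y \<in> S1" using \<sigma>B(2)[OF SH1[OF S1] i] by blast
          then obtain v where v: "v \<in> verts F" "y = \<phi> S1 v"
            using bij_betw_imp_surj_on[OF \<phi>(1)[OF SH1[OF S1]]] by blast
          have "t v = Inr i"
          proof (cases "t v")
            case (Inl z)
            then have "y \<in> D" using t1[OF S1 v(1) Inl] t4[OF v(1) Inl] v(2) by simp
            then show ?thesis using y blockD(4)[OF \<sigma>B(1)[OF SH1[OF S1] i]] by blast
          next
            case (Inr j)
            have j: "j < m" by (rule t2[OF v(1) Inr])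
            have "y \<in> \<sigma> S1 j" using t3[OF S1 v(1) Inr] v(2) by simp
            then have "\<sigma> S1 i = \<sigma> S1 j"
              using blocks_disjoint[OF \<sigma>B(1)[OF SH1[OF S1] i] \<sigma>B(1)[OF SH1[OF S1] j]] y by blast
            then have "i = j"
              using inj_onD[OF bij_betw_imp_inj_on[OF \<sigma>[OF SH1[OF S1]]], of i j] i j by simp
            then show ?thesis using Inr by simp
          qed
          then show "y \<in> \<phi> S1 ` P i" using v by (simp add: P_def)
        qed
      qed
      have imP0: "\<phi> S1 ` P\<^sub>0 = D"
      proof
        show "\<phi> S1 ` P\<^sub>0 \<subseteq> D"
        proof
          fix y assume "y \<in> \<phi> S1 ` P\<^sub>0"
          then obtain v z where v: "v \<in> verts F" "y = \<phi> S1 v" "t v = Inl z" by (auto simp: P\<^sub>0_def)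
          then show "y \<in> D" using t1[OF S1 v(1,3)] t4[OF v(1,3)] by simp
        qed
        show "D \<subseteq> \<phi> S1 ` P\<^sub>0"
        proof
          fix y assume y: "y \<in> D"
          then have "y \<in> S1" using D(2)[OF H1H[OF SH1[OF S1]]] by blast
          then obtain v where v: "v \<in> verts F" "y = \<phi> S1 v"
            using bij_betw_imp_surj_on[OF \<phi>(1)[OF SH1[OF S1]]] by blast
          have "\<exists>z. t v = Inl z"
          proof (cases "t v")
            case (Inr j)
            have "y \<in> \<sigma> S1 j" using t3[OF S1 v(1) Inr] v(2) by simp
            then show ?thesis using y blockD(4)[OF \<sigma>B(1)[OF SH1[OF S1] t2[OF v(1) Inr]]] by blast
          qed simp
          then show "y \<in> \<phi> S1 ` P\<^sub>0" using v by (simp add: P\<^sub>0_def)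
        qed
      qed
      have inj: "inj_on (\<phi> S1) A" if "A \<subseteq> verts F" for A
        by (rule inj_on_subset[OF bij_betw_imp_inj_on[OF \<phi>(1)[OF SH1[OF S1]]] that])
      have cP0: "card P\<^sub>0 = l\<^sub>1"
        using card_image[OF inj, of P\<^sub>0] imP0 D(1) by (simp add: P\<^sub>0_def)
      have cP: "card (P i) = d" if "i < m" for i
        using card_image[OF inj, of "P i"] imP[OF that] blockD(3)[OF \<sigma>B(1)[OF SH1[OF S1] that]]
        by (simp add: P_def d_def)
      \<comment> \<open>For each index there are at most \<open>card (verts G)\<close> blocks
        \<open>B\<close> and \<open>d ^ d\<close> maps from the \<open>d\<close> positions into
        \<open>B\<close>.\<close>
      define W where "W = (SIGMA i:{..<m}. \<Union>B\<in>blocks. PiE (P i) (\<lambda>_. B))"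
      have finP: "finite (P i)" for i using finF by (simp add: P_def)
      have finW': "finite (\<Union>B\<in>blocks. PiE (P i) (\<lambda>_. B))" for i
        using finite_blocks finP blockD(2) by (intro finite_UN_I finite_PiE) auto
      then have finW: "finite W" by (simp add: W_def)
      have dr: "d \<le> r" "1 \<le> r" using l(2) m m_pos unfolding d_def[symmetric] by (cases m; simp)+
      have "card W = (\<Sum>i\<in>{..<m}. card (\<Union>B\<in>blocks. PiE (P i) (\<lambda>_. B)))"
        unfolding W_def using finW' by (intro card_SigmaI) auto
      also have "\<dots> \<le> (\<Sum>i\<in>{..<m}. card (verts G) * r ^ r)"
      proof (rule sum_mono)
        fix i assume i: "i \<in> {..<m}"
        have "card (\<Union>B\<in>blocks. PiE (P i) (\<lambda>_. B)) \<le> (\<Sum>B\<in>blocks. card (PiE (P i) (\<lambda>_. B)))"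
          by (rule card_UN_le[OF finite_blocks])
        also have "\<dots> = (\<Sum>B\<in>blocks. d ^ d)"
          by (rule sum.cong) (use i in \<open>simp_all add: card_PiE finP cP blockD(3) d_def\<close>)
        also have "\<dots> = card blocks * d ^ d" by simp
        also have "\<dots> \<le> card (verts G) * r ^ r"
        proof (rule mult_mono[OF card_blocks_le])
          have "d ^ d \<le> r ^ d" using dr by (intro power_mono) auto
          also have "\<dots> \<le> r ^ r" using dr by (intro power_increasing) auto
          finally show "d ^ d \<le> r ^ r" .
        qed simp_all
        finally show "card (\<Union>B\<in>blocks. PiE (P i) (\<lambda>_. B)) \<le> card (verts G) * r ^ r" .
      qed
      finally have cW: "card W \<le> m * (card (verts G) * r ^ r)" by simp
      have inW: "(i, restrict (\<phi> S) (P i)) \<in> W" if S: "S \<in> \<S>" and i: "i < m" for S i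
      proof -
        have "restrict (\<phi> S) (P i) \<in> PiE (P i) (\<lambda>_. \<sigma> S i)"
          using t3[OF S] by (auto simp: P_def)
        then show ?thesis using \<sigma>B(1)[OF SH1[OF S] i] i unfolding W_def by blast
      qed
      have L': "k < l\<^sub>1 + 2 * d" if "k \<in> L" for k
        using L[OF that] l(1) d unfolding d_def by simp
      have m2: "2 \<le> m" using m by simp
      have SV: "S \<subseteq> verts G" if "S \<in> \<S>" for S
        by (rule intersecting_systemD(1)[OF sys H1H[OF SH1[OF that]]])
      have "real (card \<S>) \<le> c * real (m * (card (verts G) * r ^ r)) ^ 2"
        by (rule typed_family_card_le[OF RS finW cW inW[unfolded P_def] F G int L' m2 SV
              \<phi>(1)[OF SH1] \<phi>(2)[OF SH1] t1 t2 cP0[unfolded P\<^sub>0_def] cP[unfolded P_def]])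
      then show ?thesis by (simp add: \<S>_def)
    qed
  qed
  also have "\<dots> = card types * (c * real (m * (card (verts G) * r ^ r)) ^ 2)" by simp
  also have "\<dots> \<le> (real l\<^sub>1 + real m) ^ r * (c * real (m * (card (verts G) * r ^ r)) ^ 2)"
  proof (rule mult_right_mono)
    have "real (card types) \<le> real ((l\<^sub>1 + m) ^ r)" using c_types by (simp only: of_nat_le_iff)
    then show "card types \<le> (real l\<^sub>1 + real m) ^ r" by simp
  qed (use c in simp)
  finally show ?thesis by (simp add: H1_def)
qed

text \<open>The family \<open>H\<close> stems from removing small intersection sizes, but the glued
  copy may lie outside \<open>H\<close>. Hence the whole span family has to satisfy
  \<open>L\<close>, whose elements are at most \<open>l\<^sub>2\<close>.\<close>

lemma span_subfamily_small:
  fixes F :: "'b ugraph" and c :: real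
  assumes F: "simple_graph F" "card (verts F) = r" and l: "l\<^sub>1 < l\<^sub>2" "r = l\<^sub>1 + m * (l\<^sub>2 - l\<^sub>1)"
    and m: "m \<ge> 3" and c: "c > 0" and L: "\<And>k. k \<in> L \<Longrightarrow> k \<le> l\<^sub>2"
  shows "\<exists>N. \<forall>(G :: 'a ugraph) H. N \<le> card (verts G) \<longrightarrow> simple_graph G \<longrightarrow>
    span_intersecting r G F L \<longrightarrow> H \<subseteq> span_family r G F \<longrightarrow>
    intersecting_system (verts G) r {l\<^sub>1, l\<^sub>2} H \<longrightarrow> real (card H) \<le> c * real (card (verts G)) ^ 2"
proof -
  define K :: real where "K = (real l\<^sub>1 + real m) ^ r"
  define q :: nat where "q = m * r ^ r"
  have dpos: "m * (l\<^sub>2 - l\<^sub>1) > 0" using m l(1) by simp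
  then have r: "r > 0" using l(2) by linarith
  have K: "K > 0" using m by (simp add: K_def)
  have q: "q \<ge> 1" using m r by (simp add: q_def Suc_le_eq)
  \<comment> \<open>Summing over at most \<open>2 ^ r\<close> cores leaves \<open>c / 2 ^ r\<close>
    for each. With \<open>c'\<close> the covered members take half of it.\<close>
  define c' where "c' = c / (2 * 2 ^ r * K * real q ^ 2)"
  have c': "c' > 0" using c K q by (simp add: c'_def)
  obtain N0 where N0: "\<forall>n\<ge>N0. forces_spurious_clique TYPE(nat \<times> ('b \<Rightarrow> 'a)) m c' n"
    using linear_system_spurious_clique[OF m c', where 'v = "nat \<times> ('b \<Rightarrow> 'a)"] by (elim exE)
  let ?\<phi> = "fact r * real r ^ r"
  \<comment> \<open>From \<open>N1\<close> on, the linearly many uncovered members fit into the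
    other half.\<close>
  obtain N1 :: nat where N1: "2 * 2 ^ r * ?\<phi> / c \<le> N1" using real_arch_simple by blast
  have "real (card H) \<le> c * real (card (verts G)) ^ 2"
    if n: "max N0 N1 \<le> card (verts G)" and G: "simple_graph G" and int: "span_intersecting r G F L"
      and sub: "H \<subseteq> span_family r G F" and sys: "intersecting_system (verts G) r {l\<^sub>1, l\<^sub>2} H"
    for G :: "'a ugraph" and H
  proof -
    let ?n = "card (verts G)"
    have V: "finite (verts G)" using G by (simp add: simple_graph_def)
    have "?n \<le> q * ?n" using q by (cases q) auto
    moreover have "q * ?n = m * (?n * r ^ r)" by (simp add: q_def)
    ultimately have "N0 \<le> m * (?n * r ^ r)" using n by linarith
    note RS = N0[rule_format, OF this]
    have core: "real (card H') \<le> c / 2 ^ r * real ?n ^ 2"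
      if D: "D \<subseteq> verts G" "card D = l\<^sub>1" and H': "H' \<subseteq> H" "\<And>S. S \<in> H' \<Longrightarrow> D \<subseteq> S" for D H'
    proof -
      have sys': "intersecting_system (verts G) r {l\<^sub>1, l\<^sub>2} H'"
        by (rule intersecting_system_subset[OF sys H'(1)])
      have sub': "H' \<subseteq> span_family r G F" using sub H'(1) by blast
      let ?T = "(\<lambda>x. {x}) ` verts G"
      have "finite H'" by (rule finite_system[OF V sys'])
      then have "card H' = card ({S \<in> H'. covered r H' ?T S} \<union> {S \<in> H'. \<not> covered r H' ?T S})"
        by (intro arg_cong[of _ _ card]) blast
      also have "\<dots> \<le> card {S \<in> H'. covered r H' ?T S} + card {S \<in> H'. \<not> covered r H' ?T S}"
        by (rule card_Un_le)
      finally have "real (card H') \<le> card {S \<in> H'. covered r H' ?T S} + real (card {S \<in> H'. \<not> covered r H' ?T S})"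
        by linarith
      moreover have "card {S \<in> H'. covered r H' ?T S} \<le> (real l\<^sub>1 + real m) ^ r * (c' * real (m * (?n * r ^ r)) ^ 2)"
        using covered_block_family_card_le[OF F l m RS G int L sub' sys' D(2) H'(2)] c' by simp
      moreover have "(real l\<^sub>1 + real m) ^ r * (c' * real (m * (?n * r ^ r)) ^ 2) = c / 2 ^ r / 2 * real ?n ^ 2"
      proof -
        have e: "real (m * (?n * r ^ r)) = real q * real ?n" "(real l\<^sub>1 + real m) ^ r = K"
          by (simp_all add: q_def K_def)
        show ?thesis unfolding e using K q by (simp add: c'_def power_mult_distrib)
      qed
      moreover have "real (card {S \<in> H'. \<not> covered r H' ?T S}) \<le> c / 2 ^ r / 2 * real ?n ^ 2"
      proof -
        have "card {S \<in> H'. \<not> covered r H' ?T S} \<le> card ?T * (fact r * r ^ r)"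
          by (rule not_covered_card_le[OF V sys' r]) (use V in simp)
        also have "card ?T = ?n" by (intro card_image) simp
        finally have "real (card {S \<in> H'. \<not> covered r H' ?T S}) \<le> real (?n * (fact r * r ^ r))"
          by (simp only: of_nat_le_iff)
        also have "\<dots> = ?\<phi> * real ?n" by simp
        also have "\<dots> \<le> (c / 2 ^ r / 2 * real ?n) * real ?n"
        proof (rule mult_right_mono)
          have "2 * 2 ^ r * ?\<phi> / c \<le> real ?n" using N1 n by simp
          then have "2 * 2 ^ r * ?\<phi> \<le> c * real ?n" using c by (simp add: pos_divide_le_eq mult.commute)
          then show "?\<phi> \<le> c / 2 ^ r / 2 * real ?n" by (simp add: field_simps)
        qed simp
        finally show ?thesis by (simp add: power2_eq_square)
      qed
      ultimately show ?thesis by linarith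
    qed
    have "real (card H) \<le> 2 ^ r * (c / 2 ^ r * real ?n ^ 2)"
    proof (rule card_le_by_cores[OF V sys _ _ _ core])
      show "l\<^sub>1 \<le> x" if "x \<in> {l\<^sub>1, l\<^sub>2}" for x using that l by auto
      show "l\<^sub>1 \<le> r" using l(2) by simp
    qed (use c in simp_all)
    then show ?thesis by simp
  qed
  then show ?thesis by (intro exI[of _ "max N0 N1"] allI impI)
qed

section \<open>From set systems to the extremal function\<close>

lemma Psi_le:
  fixes F :: "'b ugraph" and B :: real
  assumes "0 \<le> B" "\<And>G :: nat ugraph. simple_graph G \<Longrightarrow> card (verts G) = n \<Longrightarrow>
    span_intersecting r G F L \<Longrightarrow> real (num_copies G F) \<le> B"
  shows "real (Psi r n F L) \<le> B"
proof (cases "span_counts r n F L = {}")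
  case True
  then show ?thesis using assms(1) by (simp add: Psi_def)
next
  case False
  then have "Psi r n F L \<in> span_counts r n F L"
    using Max_in[OF finite_span_counts False] by (simp add: Psi_def)
  then show ?thesis using assms(2) by (auto simp: span_counts_def)
qed

lemma Psi_le_span_family:
  fixes F :: "'b ugraph" and B :: real
  assumes F: "card (verts F) = r" and B: "0 \<le> B"
    "\<And>G :: nat ugraph. simple_graph G \<Longrightarrow> card (verts G) = n \<Longrightarrow> span_intersecting r G F L \<Longrightarrow>
      real (card (span_family r G F)) \<le> B"
  shows "real (Psi r n F L) \<le> B * 2 ^ (2 ^ r)"
proof (rule Psi_le)
  fix G :: "nat ugraph" assume G: "simple_graph G" "card (verts G) = n" "span_intersecting r G F L"
  have "real (num_copies G F) \<le> real (card (span_family r G F) * 2 ^ (2 ^ r))"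
    using num_copies_le[OF F G(1)] by (simp only: of_nat_le_iff)
  also have "\<dots> = real (card (span_family r G F)) * 2 ^ (2 ^ r)" by simp
  also have "\<dots> \<le> B * 2 ^ (2 ^ r)" by (rule mult_right_mono[OF B(2)[OF G]]) simp
  finally show "real (num_copies G F) \<le> B * 2 ^ (2 ^ r)" .
qed (use B(1) in simp)

lemma Psi_bigo_if_power_bounded:
  fixes F :: "'b ugraph"
  assumes F: "card (verts F) = r" and bd: "power_bounded TYPE(nat) r L e"
  shows "(\<lambda>n. real (Psi r n F L)) \<in> O(\<lambda>n. real n ^ e)"
proof -
  obtain C where C: "C \<ge> 0" "\<forall>(V :: nat set) H. finite V \<longrightarrow> intersecting_system V r L H \<longrightarrow>
    real (card H) \<le> C * real (card V) ^ e"
    using bd by (rule power_boundedE)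
  have "real (Psi r n F L) \<le> C * real n ^ e * 2 ^ (2 ^ r)" for n
  proof (rule Psi_le_span_family[OF F])
    fix G :: "nat ugraph" assume G: "simple_graph G" "card (verts G) = n" "span_intersecting r G F L"
    have "finite (verts G)" using G(1) by (simp add: simple_graph_def)
    then show "real (card (span_family r G F)) \<le> C * real n ^ e"
      using C(2) span_family_system[OF G(3)] G(2) by blast
  qed (use C(1) in simp)
  then have "norm (real (Psi r n F L)) \<le> (C * 2 ^ (2 ^ r)) * norm (real n ^ e)" for n
    by (simp add: mult_ac)
  then show ?thesis by (intro bigoI[of _ "C * 2 ^ (2 ^ r)"] always_eventually allI)
qed

lemma power_smallo_Suc: "(\<lambda>n. real n ^ e) \<in> o(\<lambda>n. real n ^ Suc e)"
proof (rule landau_o.smallI)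
  fix c :: real assume c: "c > 0"
  obtain N :: nat where N: "1 / c \<le> N" using real_arch_simple by blast
  have "norm (real n ^ e) \<le> c * norm (real n ^ Suc e)" if "n \<ge> N" for n
  proof -
    have "1 / c \<le> real n" using N that by linarith
    then have "1 \<le> c * real n" using c by (simp add: field_simps)
    then have "1 * real n ^ e \<le> (c * real n) * real n ^ e" by (intro mult_right_mono) simp_all
    then show ?thesis by (simp add: mult.assoc)
  qed
  then show "\<forall>\<^sub>F n in sequentially. norm (real n ^ e) \<le> c * norm (real n ^ Suc e)"
    by (auto simp: eventually_sequentially)
qed

text \<open>Removing the \<open>s - 2\<close> smallest intersection sizes costs a factor of order
  \<open>n ^ (s - 2)\<close> and leaves \<open>a (s - 1)\<close> and \<open>a s\<close>, where
  members are cores with blocks and number \<open>o(n\<^sup>2)\<close>.\<close>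

lemma Psi_smallo_if_dvd:
  fixes F :: "'b ugraph"
  assumes F: "simple_graph F" "card (verts F) = r" and s: "2 \<le> s"
    and mono: "strict_mono_on {1..s} a" and lt: "a s < r"
    and dvd: "(a s - a (s - 1)) dvd (r - a s)" and ne: "r - a s \<noteq> a s - a (s - 1)"
  shows "(\<lambda>n. real (Psi r n F (a ` {1..s}))) \<in> o(\<lambda>n. real n ^ s)"
proof (rule landau_o.smallI)
  fix c :: real assume c: "c > 0"
  let ?L = "a ` {1..s}"
  define d where "d = a s - a (s - 1)"
  have l: "a (s - 1) < a s" using strict_mono_onD[OF mono, of "s - 1" s] s by simp
  obtain q where q: "r - a s = d * q" using dvd unfolding d_def by (elim dvdE)
  \<comment> \<open>The value 0 is excluded by \<open>a s < r\<close> and the value 1 by the two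
    differences being distinct, so there are \<open>Suc q \<ge> 3\<close> blocks.\<close>
  have "q \<noteq> 0" using q lt by (intro notI) simp
  moreover have "q \<noteq> 1" using q ne by (auto simp: d_def)
  ultimately have m: "3 \<le> Suc q" by simp
  have r: "r = a (s - 1) + Suc q * (a s - a (s - 1))"
    using q l lt by (simp add: d_def mult.commute)
  have L: "k \<le> a s" if k: "k \<in> ?L" for k
  proof -
    obtain i where i: "k = a i" "1 \<le> i" "i \<le> s" using k by auto
    then show ?thesis using strict_mono_onD[OF mono, of i s] by (cases "i = s") auto
  qed
  \<comment> \<open>The constants lost in removing small sizes and in passing from members to
    copies.\<close>
  define K :: real where "K = (2 ^ r) ^ (s - 2) * 2 ^ (2 ^ r)"
  have K: "K > 0" by (simp add: K_def)
  then have cK: "c / K > 0" using c by simp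
  have "\<exists>N. \<forall>(G :: nat ugraph) H. N \<le> card (verts G) \<longrightarrow> simple_graph G \<longrightarrow>
    span_intersecting r G F ?L \<longrightarrow> H \<subseteq> span_family r G F \<longrightarrow>
    intersecting_system (verts G) r {a (s - 1), a s} H \<longrightarrow>
    real (card H) \<le> c / K * real (card (verts G)) ^ 2"
    by (rule span_subfamily_small[OF F l r m cK L])
  then obtain N where
    N: "\<forall>(G :: nat ugraph) H. N \<le> card (verts G) \<longrightarrow> simple_graph G \<longrightarrow>
    span_intersecting r G F ?L \<longrightarrow> H \<subseteq> span_family r G F \<longrightarrow>
    intersecting_system (verts G) r {a (s - 1), a s} H \<longrightarrow>
    real (card H) \<le> c / K * real (card (verts G)) ^ 2" by (elim exE)
  have "norm (real (Psi r n F ?L)) \<le> c * norm (real n ^ s)" if n: "N \<le> n" for n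
  proof -
    have "real (Psi r n F ?L) \<le> ((2 ^ r * real n) ^ (s - 2) * (c / K * real n ^ 2)) * 2 ^ (2 ^ r)"
    proof (rule Psi_le_span_family[OF F(2)])
      fix G :: "nat ugraph"
      assume G: "simple_graph G" "card (verts G) = n" "span_intersecting r G F ?L"
      have V: "finite (verts G)" using G(1) by (simp add: simple_graph_def)
      have "real (card (span_family r G F))
          \<le> (2 ^ r * real (card (verts G))) ^ (s - 2) * (c / K * real n ^ 2)"
      proof (rule remove_bottoms[OF V mono lt _ span_family_system[OF G(3)]])
        fix H assume H: "H \<subseteq> span_family r G F"
          "intersecting_system (verts G) r (a ` {1 + (s - 2)..s}) H"
        have "{1 + (s - 2)..s} = {s - 1, s}" using s by auto
        then have "intersecting_system (verts G) r {a (s - 1), a s} H" using H(2) by simp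
        then show "real (card H) \<le> c / K * real n ^ 2"
          using N[rule_format, of G H] n G H(1) by simp
      qed (use s c K in simp_all)
      then show "real (card (span_family r G F))
          \<le> (2 ^ r * real n) ^ (s - 2) * (c / K * real n ^ 2)" using G(2) by simp
    qed (use c K in simp)
    also have "\<dots> = c / K * K * (real n ^ (s - 2) * real n ^ 2)"
      by (simp add: K_def power_mult_distrib mult_ac)
    also have "real n ^ (s - 2) * real n ^ 2 = real n ^ s"
      by (simp only: power_add[symmetric] le_add_diff_inverse2[OF s])
    also have "c / K * K = c" using K by simp
    finally show ?thesis by simp
  qed
  then show "\<forall>\<^sub>F n in sequentially. norm (real (Psi r n F ?L)) \<le> c * norm (real n ^ s)"
    by (auto simp: eventually_sequentially)
qed

theorem theorem1p8:
  fixes r s :: nat and F :: "'b ugraph" and L :: "nat set" and l :: "nat \<Rightarrow> nat"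
  assumes "r \<ge> 3"
    and "simple_graph F" and "card (verts F) = r"
    and "L = l ` {1..s}" and "strict_mono_on {1..s} l"
    and "L \<subseteq> {0..r - 1}"
    and "s \<notin> {1, r}"
    and "\<not> arith_prog (l(Suc s := r)) (Suc s)"
  shows "(\<lambda>n. real (Psi r n F L)) \<in> o(\<lambda>n. real n ^ s)
    \<and> ((r - l s = l s - l (s - 1)
         \<or> (r - l s \<noteq> l s - l (s - 1) \<and> \<not> (l s - l (s - 1)) dvd (r - l s)))
       \<longrightarrow> (\<lambda>n. real (Psi r n F L)) \<in> O(\<lambda>n. real n ^ (s - 1)))"
proof -
  define a where "a = l(Suc s := r)"
  \<comment> \<open>For \<open>s = 0\<close> the sequence consists of \<open>r\<close> alone and
    counts as an arithmetic progression.\<close>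
  have "s \<noteq> 0"
  proof
    assume "s = 0"
    then have "arith_prog (l(Suc s := r)) (Suc s)" by (simp add: arith_prog_def)
    with assms(8) show False by blast
  qed
  then have s: "2 \<le> s" using assms(7) by simp
  have al: "a i = l i" if "i \<le> s" for i using that by (simp add: a_def)
  have aS: "a (Suc s) = r" by (simp add: a_def)
  have aL: "a ` {1..s} = L" unfolding assms(4) by (intro image_cong) (simp_all add: al)
  have lr: "l i < r" if "1 \<le> i" "i \<le> s" for i
  proof -
    have "l i \<in> L" unfolding assms(4) using that by simp
    then have "l i \<le> r - 1" using assms(6) by auto
    then show ?thesis using assms(1) by simp
  qed
  have mono: "strict_mono_on {1..Suc s} a"
  proof (rule strict_mono_onI)
    fix i j assume ij: "i \<in> {1..Suc s}" "j \<in> {1..Suc s}" "i < j"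
    show "a i < a j"
    proof (cases "j = Suc s")
      case True
      then show ?thesis using ij lr[of i] al[of i] aS by simp
    next
      case False
      then show ?thesis using ij strict_mono_onD[OF assms(5), of i j] al[of i] al[of j] by simp
    qed
  qed
  show ?thesis
  \<comment> \<open>In the first case the \<open>O\<close> bound also yields the \<open>o\<close>
    bound; in the second the premise of the \<open>O\<close> claim is false.\<close>
  proof (cases "r - l s = l s - l (s - 1) \<or> \<not> (l s - l (s - 1)) dvd (r - l s)")
    case True
    have "power_bounded TYPE(nat) (a (Suc s)) (a ` {1..s}) (s - 1)"
      by (rule power_bounded_not_arith_prog[OF mono s])
         (use assms(8) True al[of s] al[of "s - 1"] aS in \<open>simp_all add: a_def[symmetric]\<close>)
    then have bigo: "(\<lambda>n. real (Psi r n F L)) \<in> O(\<lambda>n. real n ^ (s - 1))"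
      unfolding aL aS by (rule Psi_bigo_if_power_bounded[OF assms(3)])
    moreover have "(\<lambda>n. real n ^ (s - 1)) \<in> o(\<lambda>n. real n ^ s)"
      using power_smallo_Suc[of "s - 1"] s by simp
    ultimately show ?thesis by (blast intro: landau_o.big_small_trans)
  next
    case False
    have "(\<lambda>n. real (Psi r n F (l ` {1..s}))) \<in> o(\<lambda>n. real n ^ s)"
      by (rule Psi_smallo_if_dvd[OF assms(2,3) s assms(5)]) (use False lr[of s] s in simp_all)
    then show ?thesis using False assms(4) by simp
  qed
qed

end
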